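(* Let $d\ge 1$ and let $\mathcal{G}=(X_1,X_2,E,\nu)$ be a $d$-regular bipartite graphing. For every $\varepsilon>0$ there is a measurable proper edge coloring $c:E\to\{1,\dots,d+1\}$ of $\mathcal{G}$ such that the measure of the set of edges of color $d+1$ satisfies $\widetilde\nu(c^{-1}(d+1))\le\varepsilon$.
   Context: A graphing is a simple undirected graph $\mathcal{G}=(X,E,\nu)$ whose vertex set $X$ is a standard Borel space with a Borel probability measure $\nu$, whose (symmetric) edge set $E\subseteq X\times X$ is Borel, whose degrees are uniformly bounded, and such that $\int_A\deg(x,B)\,d\nu(x)=\int_B\deg(x,A)\,d\nu(x)$ for all measurable $A,B\subseteq X$, where $\deg(x,S)$ is the number of edges from $x$ to $S$. It is bipartite, written $\mathcal{G}=(X_1,X_2,E,\nu)$, if $X=X_1\sqcup X_2$ is a partition into measurable sets and every edge joins $X_1$ to $X_2$. The edge measure is $\widetilde\nu(C)=\frac12\int_X\deg_C(x)\,d\nu(x)$ for a measurable set of edges $C\subseteq E$, where $\deg_C(x)$ is the number of edges of $C$ adjacent to $x$. An edge coloring is proper if edges sharing a vertex have different colors. Measurability is with respect to the measure (null sets may be discarded); it is not required that the coloring be Borel on every component. *)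

theory Defs
  imports "HOL-Probability.Probability_Measure"
begin

definition polish_topology :: "'a topology \<Rightarrow> bool" where
  "polish_topology T \<longleftrightarrow> completely_metrizable_space T \<and> separable_space T"

definition standard_borel :: "'a measure \<Rightarrow> bool" where
  "standard_borel M \<longleftrightarrow>
     (\<exists>T. polish_topology T \<and> topspace T = space M \<and>
          sets M = sigma_sets (space M) {U. openin T U})"

text \<open>
  An undirected edge \<open>{x, y}\<close> is represented by the two ordered pairs \<open>(x, y)\<close> and
  \<open>(y, x)\<close>, so a set of edges is a symmetric relation \<open>C\<close>, and \<open>C `` {x}\<close> is the set of
  neighbours of \<open>x\<close> along edges of \<open>C\<close>. The cardinalities below are taken only for
  relations with finite sections, as the bounded degree condition ensures.
\<close>

definition deg :: "('a \<times> 'a) set \<Rightarrow> 'a \<Rightarrow> 'a set \<Rightarrow> nat" where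
  "deg E x S = card (E `` {x} \<inter> S)"

locale graphing = prob_space \<nu> for \<nu> :: "'a measure" +
  fixes E :: "('a \<times> 'a) set"
  assumes standard_borel: "standard_borel \<nu>"
    and edges_borel: "E \<in> sets (\<nu> \<Otimes>\<^sub>M \<nu>)"
    and edges_sym: "sym E"
    and edges_irrefl: "irrefl E"
    and bounded_degree: "\<exists>D. \<forall>x\<in>space \<nu>. finite (E `` {x}) \<and> card (E `` {x}) \<le> D"
    and measure_preserving:
      "\<And>A B. A \<in> sets \<nu> \<Longrightarrow> B \<in> sets \<nu> \<Longrightarrow>
         (\<integral>\<^sup>+x\<in>A. of_nat (deg E x B) \<partial>\<nu>) = (\<integral>\<^sup>+x\<in>B. of_nat (deg E x A) \<partial>\<nu>)"

locale bipartite_graphing = graphing \<nu> E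
  for \<nu> :: "'a measure" and X\<^sub>1 X\<^sub>2 :: "'a set" and E :: "('a \<times> 'a) set" +
  assumes parts_measurable: "X\<^sub>1 \<in> sets \<nu>" "X\<^sub>2 \<in> sets \<nu>"
    and parts_disjoint: "X\<^sub>1 \<inter> X\<^sub>2 = {}"
    and parts_cover: "X\<^sub>1 \<union> X\<^sub>2 = space \<nu>"
    and edges_between: "E \<subseteq> X\<^sub>1 \<times> X\<^sub>2 \<union> X\<^sub>2 \<times> X\<^sub>1"

definition regular_graph :: "nat \<Rightarrow> 'a set \<Rightarrow> ('a \<times> 'a) set \<Rightarrow> bool" where
  "regular_graph d X E \<longleftrightarrow> (\<forall>x\<in>X. finite (E `` {x}) \<and> card (E `` {x}) = d)"

text \<open>
  The edge measure of a symmetric \<open>C\<close>. If \<open>C\<close> is measurable only up to a null set, its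
  degree function is measurable for the completion of \<open>\<nu>\<close>; the integral is still the right one,
  because \<open>\<integral>\<^sup>+\<close> has the same value for \<open>\<nu>\<close> and for its completion
  (lemma \<open>nn_integral_completion\<close>).
\<close>

definition edge_measure :: "'a measure \<Rightarrow> ('a \<times> 'a) set \<Rightarrow> ennreal" where
  "edge_measure \<nu> C = (\<integral>\<^sup>+x. of_nat (deg C x UNIV) \<partial>\<nu>) / 2"

definition proper_edge_coloring :: "('a \<times> 'a) set \<Rightarrow> 'c set \<Rightarrow> ('a \<times> 'a \<Rightarrow> 'c) \<Rightarrow> bool" where
  "proper_edge_coloring E K c \<longleftrightarrow>
     c \<in> E \<rightarrow> K \<and>
     (\<forall>x y. (x, y) \<in> E \<longrightarrow> c (x, y) = c (y, x)) \<and>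
     (\<forall>x y z. (x, y) \<in> E \<longrightarrow> (x, z) \<in> E \<longrightarrow> y \<noteq> z \<longrightarrow> c (x, y) \<noteq> c (x, z))"

text \<open>
  Measurability with respect to the edge measure, for colorings with countably many colors:
  the coloring is Borel after discarding a null set \<open>N\<close> of edges.
\<close>

definition measurable_edge_coloring ::
    "'a measure \<Rightarrow> ('a \<times> 'a) set \<Rightarrow> ('a \<times> 'a \<Rightarrow> 'c) \<Rightarrow> bool" where
  "measurable_edge_coloring \<nu> E c \<longleftrightarrow>
     (\<exists>N \<in> sets (\<nu> \<Otimes>\<^sub>M \<nu>). N \<subseteq> E \<and> sym N \<and> edge_measure \<nu> N = 0 \<and>
        c \<in> restrict_space (\<nu> \<Otimes>\<^sub>M \<nu>) (E - N) \<rightarrow>\<^sub>M count_space UNIV)"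

end

theory Submission
  imports Defs
begin

text \<open>
  A measurable partial coloring is improved by swapping two colors along alternating chains. In a
  bipartite graph chains that start on the same side at vertices missing the second color are
  pairwise disjoint, so many edges can be treated simultaneously, and if no chain of length at most
  \<open>L\<close> helps, the uncolored edges have measure \<open>O(1 / L)\<close>. With \<open>d\<close> colors this leaves few
  uncolored edges. With \<open>d + 1\<close> colors every vertex misses a color, so a chain may be cut anywhere and
  continued by a second one, as in the measurable Vizing theorem of Grebik and Pikhurko; then the
  uncolored edges have measure \<open>O(1 / L\<^sup>2)\<close>. Passing from \<open>L\<close> to \<open>2 L\<close> recolors a set of measure
  \<open>O(L) \<cdot> O(1 / L\<^sup>2)\<close>, so doubling \<open>L\<close> forever changes only a set of small measure in total, and the
  colorings converge to one that is defined almost everywhere and rarely uses color \<open>d + 1\<close>. On the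
  exceptional null set Koenig's theorem is applied without any measurability.
  Measurability rests on capacitability: projections of Borel sets are measurable for the
  completion, whence a Lusin--Novikov theorem outside an invariant null set.
\<close>

section \<open>Projections of measurable sets\<close>

text \<open>With \<open>d\<close> colors alone the scheme stalls: at chain length \<open>L\<close>
  the uncolored part has order 1 / L while recoloring along such chains costs a factor of order
  \<open>L\<close>, so the changes need not be summable. A spare color at every vertex buys the
  missing factor. Along a chain that cannot be shortened about \<open>L\<close> inner vertices each
  start a further long chain; those in a fixed pair of colors are disjoint, so their starting points
  have measure of order 1 / L, and every first chain uses up about \<open>L\<close> of them. The
  initial coloring avoids color \<open>d + 1\<close>, hence every edge that ends up with it was
  changed at some stage, and the total change bounds its measure. At each scale a coloring without
  worthwhile improvement is needed. It comes from a form of Ekeland's variational principle for the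
  pseudometric \<open>dist_col\<close>: an improvement counts only if its cost is at most a fixed
  multiple of its gain, which also bounds the cost of reaching the optimum. Bipartiteness replaces
  the fans of Vizing's theorem: by parity a chain from one end of an uncolored edge never runs into
  the other.\<close>

definition prefix_determined :: "(nat \<Rightarrow> (nat \<Rightarrow> nat) \<Rightarrow> 'b) \<Rightarrow> bool" where
  "prefix_determined F \<longleftrightarrow> (\<forall>n \<sigma> \<tau>. (\<forall>i<n. \<sigma> i = \<tau> i) \<longrightarrow> F n \<sigma> = F n \<tau>)"

lemma prefix_determinedD:
  "prefix_determined F \<Longrightarrow> (\<And>i. i < n \<Longrightarrow> \<sigma> i = \<tau> i) \<Longrightarrow> F n \<sigma> = F n \<tau>"
  by (auto simp: prefix_determined_def)

text \<open>For countable unions: \<open>\<sigma> 0\<close> selects a member of the family and the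
  remaining entries are its branch. The constant level 0 leaves room for reading
  \<open>\<sigma> 0\<close>.\<close>

lemma prefix_determined_shift:
  assumes "\<And>i. prefix_determined (F i)"
  shows "prefix_determined (\<lambda>n \<sigma>. case n of 0 \<Rightarrow> X | Suc k \<Rightarrow> F (\<sigma> 0) k (\<lambda>j. \<sigma> (Suc j)))"
  unfolding prefix_determined_def
proof (intro allI impI)
  fix n and \<sigma> \<tau> :: "nat \<Rightarrow> nat" assume eq: "\<forall>i<n. \<sigma> i = \<tau> i"
  show "(case n of 0 \<Rightarrow> X | Suc k \<Rightarrow> F (\<sigma> 0) k (\<lambda>j. \<sigma> (Suc j))) =
      (case n of 0 \<Rightarrow> X | Suc k \<Rightarrow> F (\<tau> 0) k (\<lambda>j. \<tau> (Suc j)))"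
  proof (cases n)
    case (Suc k)
    have "F (\<sigma> 0) k (\<lambda>j. \<sigma> (Suc j)) = F (\<sigma> 0) k (\<lambda>j. \<tau> (Suc j))"
      by (rule prefix_determinedD[OF assms]) (use eq Suc in simp)
    then show ?thesis using eq Suc by simp
  qed simp
qed

lemma prod_encode_less_mono: "j < k \<Longrightarrow> prod_encode (i, j) < prod_encode (i, k)"
proof (induction k)
  case (Suc k)
  have step: "prod_encode (i, k) < prod_encode (i, Suc k)"
    by (simp add: prod_encode_def)
  show ?case
  proof (cases "j = k")
    case True
    then show ?thesis using step by (simp only:)
  next
    case False
    then have "prod_encode (i, j) < prod_encode (i, k)" using Suc by linarith
    then show ?thesis using step by (rule less_trans)
  qed
qed simp

text \<open>For countable intersections: one sequence carries a branch for every \<open>i\<close>,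
  with entry \<open>j\<close> stored at \<open>prod_encode (i, j)\<close>. Level
  \<open>prod_encode (i, k)\<close> reads the first \<open>k\<close> entries of branch
  \<open>i\<close>, all of which are stored below it.\<close>

lemma prefix_determined_interleave:
  assumes "\<And>i. prefix_determined (F i)"
  shows "prefix_determined (\<lambda>n \<sigma>. case prod_decode n of (i, k) \<Rightarrow> F i k (\<lambda>j. \<sigma> (prod_encode (i, j))))"
  unfolding prefix_determined_def
proof (intro allI impI)
  fix n and \<sigma> \<tau> :: "nat \<Rightarrow> nat" assume eq: "\<forall>i<n. \<sigma> i = \<tau> i"
  obtain i k where n: "prod_decode n = (i, k)" by fastforce
  then have "n = prod_encode (i, k)" by (metis prod_decode_inverse)
  then have "F i k (\<lambda>j. \<sigma> (prod_encode (i, j))) = F i k (\<lambda>j. \<tau> (prod_encode (i, j)))"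
    by (intro prefix_determinedD[OF assms]) (use eq prod_encode_less_mono in blast)
  then show "(case prod_decode n of (i, k) \<Rightarrow> F i k (\<lambda>j. \<sigma> (prod_encode (i, j)))) =
      (case prod_decode n of (i, k) \<Rightarrow> F i k (\<lambda>j. \<tau> (prod_encode (i, j))))"
    by (simp add: n)
qed

text \<open>The Suslin operation on rectangles. A scheme indexed by finite sequences is encoded as a
  function of infinite ones whose \<open>n\<close>-th level sees only the first \<open>n\<close>
  entries.\<close>

definition suslin :: "'a set set \<Rightarrow> 'b set set \<Rightarrow> ('a \<times> 'b) set set" where
  "suslin \<A> \<F> = {C. \<exists>A F. prefix_determined A \<and> prefix_determined F \<and>
     (\<forall>n \<sigma>. A n \<sigma> \<in> \<A> \<and> F n \<sigma> \<in> \<F>) \<and> C = (\<Union>\<sigma>. \<Inter>n. A n \<sigma> \<times> F n \<sigma>)}"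

lemma suslin_familyE:
  fixes C :: "nat \<Rightarrow> ('a \<times> 'b) set"
  assumes C: "\<And>i. C i \<in> suslin \<A> \<F>"
  obtains A F where "\<And>i. prefix_determined (A i)" "\<And>i. prefix_determined (F i)"
    "\<And>i n \<sigma>. A i n \<sigma> \<in> \<A>" "\<And>i n \<sigma>. F i n \<sigma> \<in> \<F>"
    "\<And>i. C i = (\<Union>\<sigma>. \<Inter>n. A i n \<sigma> \<times> F i n \<sigma>)"
proof -
  have "\<forall>i. \<exists>AF. prefix_determined (fst AF) \<and> prefix_determined (snd AF) \<and>
     (\<forall>n \<sigma>. fst AF n \<sigma> \<in> \<A> \<and> snd AF n \<sigma> \<in> \<F>) \<and>
     C i = (\<Union>\<sigma>. \<Inter>n. fst AF n \<sigma> \<times> snd AF n \<sigma>)"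
    using C unfolding suslin_def mem_Collect_eq split_paired_Ex fst_conv snd_conv by (rule allI)
  from choice[OF this] obtain AF where "\<forall>i. prefix_determined (fst (AF i)) \<and>
     prefix_determined (snd (AF i)) \<and> (\<forall>n \<sigma>. fst (AF i) n \<sigma> \<in> \<A> \<and> snd (AF i) n \<sigma> \<in> \<F>) \<and>
     C i = (\<Union>\<sigma>. \<Inter>n. fst (AF i) n \<sigma> \<times> snd (AF i) n \<sigma>)" ..
  note AF = this[rule_format]
  show ?thesis
  proof (rule that)
    show "prefix_determined (fst (AF i))" "prefix_determined (snd (AF i))" for i
      using AF[of i] by (simp_all only:)
    show "fst (AF i) n \<sigma> \<in> \<A>" "snd (AF i) n \<sigma> \<in> \<F>" for i n \<sigma>
      using AF[of i] by (simp_all only:)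
    show "C i = (\<Union>\<sigma>. \<Inter>n. fst (AF i) n \<sigma> \<times> snd (AF i) n \<sigma>)" for i
      using AF[of i] by (simp only:)
  qed
qed

lemma suslin_Times:
  assumes "A \<in> \<A>" "F \<in> \<F>"
  shows "A \<times> F \<in> suslin \<A> \<F>"
  unfolding suslin_def
  by (rule CollectI, rule exI[of _ "\<lambda>_ _. A"], rule exI[of _ "\<lambda>_ _. F"])
     (use assms in \<open>auto simp: prefix_determined_def\<close>)

lemma suslin_UN:
  fixes C :: "nat \<Rightarrow> ('a \<times> 'b) set"
  assumes C: "\<And>i. C i \<in> suslin \<A> \<F>"
    and top: "X \<in> \<A>" "Y \<in> \<F>" "\<A> \<subseteq> Pow X" "\<F> \<subseteq> Pow Y"
  shows "(\<Union>i. C i) \<in> suslin \<A> \<F>"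
proof -
  obtain A F where AF: "\<And>i. prefix_determined (A i)" "\<And>i. prefix_determined (F i)"
    "\<And>i n \<sigma>. A i n \<sigma> \<in> \<A>" "\<And>i n \<sigma>. F i n \<sigma> \<in> \<F>"
    "\<And>i. C i = (\<Union>\<sigma>. \<Inter>n. A i n \<sigma> \<times> F i n \<sigma>)"
    by (rule suslin_familyE[where C = C, OF C]) (rule that)
  define A' where "A' n \<sigma> = (case n of 0 \<Rightarrow> X | Suc k \<Rightarrow> A (\<sigma> 0) k (\<lambda>j. \<sigma> (Suc j)))" for n \<sigma>
  define F' where "F' n \<sigma> = (case n of 0 \<Rightarrow> Y | Suc k \<Rightarrow> F (\<sigma> 0) k (\<lambda>j. \<sigma> (Suc j)))" for n \<sigma>
  have "prefix_determined A'"
    unfolding A'_def[abs_def] by (rule prefix_determined_shift[OF AF(1)])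
  moreover have "prefix_determined F'"
    unfolding F'_def[abs_def] by (rule prefix_determined_shift[OF AF(2)])
  moreover have "A' n \<sigma> \<in> \<A>" "F' n \<sigma> \<in> \<F>" for n \<sigma>
    using top(1,2) AF(3,4) by (auto simp: A'_def F'_def split: nat.split)
  moreover have "(\<Union>i. C i) = (\<Union>\<sigma>. \<Inter>n. A' n \<sigma> \<times> F' n \<sigma>)"
  proof (rule set_eqI, rule iffI)
    fix z assume "z \<in> (\<Union>i. C i)"
    then obtain i \<sigma> where z: "\<And>n. z \<in> A i n \<sigma> \<times> F i n \<sigma>"
      unfolding AF(5) by blast
    have "z \<in> A' n (case_nat i \<sigma>) \<times> F' n (case_nat i \<sigma>)" for n
    proof (cases n)
      case 0
      then show ?thesis using z[of 0] AF(3)[of i 0 \<sigma>] AF(4)[of i 0 \<sigma>] top(3,4)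
        by (cases z) (simp add: A'_def F'_def, blast)
    next
      case (Suc k)
      then show ?thesis using z[of k] by (simp add: A'_def F'_def)
    qed
    then show "z \<in> (\<Union>\<sigma>. \<Inter>n. A' n \<sigma> \<times> F' n \<sigma>)" by blast
  next
    fix z assume "z \<in> (\<Union>\<sigma>. \<Inter>n. A' n \<sigma> \<times> F' n \<sigma>)"
    then obtain \<sigma> where z: "\<And>n. z \<in> A' n \<sigma> \<times> F' n \<sigma>" by blast
    have "z \<in> A (\<sigma> 0) n (\<lambda>j. \<sigma> (Suc j)) \<times> F (\<sigma> 0) n (\<lambda>j. \<sigma> (Suc j))" for n
      using z[of "Suc n"] by (simp add: A'_def F'_def)
    then show "z \<in> (\<Union>i. C i)" unfolding AF(5) by blast
  qed
  ultimately show ?thesis unfolding suslin_def by blast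
qed

lemma suslin_INT:
  fixes C :: "nat \<Rightarrow> ('a \<times> 'b) set"
  assumes C: "\<And>i. C i \<in> suslin \<A> \<F>"
  shows "(\<Inter>i. C i) \<in> suslin \<A> \<F>"
proof -
  obtain A F where AF: "\<And>i. prefix_determined (A i)" "\<And>i. prefix_determined (F i)"
    "\<And>i n \<sigma>. A i n \<sigma> \<in> \<A>" "\<And>i n \<sigma>. F i n \<sigma> \<in> \<F>"
    "\<And>i. C i = (\<Union>\<sigma>. \<Inter>n. A i n \<sigma> \<times> F i n \<sigma>)"
    by (rule suslin_familyE[where C = C, OF C]) (rule that)
  define p where "p \<sigma> i = (\<lambda>j. \<sigma> (prod_encode (i, j)))" for \<sigma> :: "nat \<Rightarrow> nat" and i
  define A' where "A' n \<sigma> = (case prod_decode n of (i, k) \<Rightarrow> A i k (p \<sigma> i))" for n \<sigma>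
  define F' where "F' n \<sigma> = (case prod_decode n of (i, k) \<Rightarrow> F i k (p \<sigma> i))" for n \<sigma>
  have "prefix_determined A'"
    unfolding A'_def[abs_def] p_def by (rule prefix_determined_interleave[OF AF(1)])
  moreover have "prefix_determined F'"
    unfolding F'_def[abs_def] p_def by (rule prefix_determined_interleave[OF AF(2)])
  moreover have "A' n \<sigma> \<in> \<A>" "F' n \<sigma> \<in> \<F>" for n \<sigma>
    using AF(3,4) by (auto simp: A'_def F'_def split: prod.split)
  moreover have "(\<Inter>i. C i) = (\<Union>\<sigma>. \<Inter>n. A' n \<sigma> \<times> F' n \<sigma>)"
  proof (rule set_eqI, rule iffI)
    fix z assume "z \<in> (\<Inter>i. C i)"
    then have "\<forall>i. \<exists>\<sigma>. \<forall>n. z \<in> A i n \<sigma> \<times> F i n \<sigma>"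
      by (simp only: AF(5) INT_iff UN_iff ball_UNIV bex_UNIV simp_thms)
    then obtain s where z: "\<And>i n. z \<in> A i n (s i) \<times> F i n (s i)" by metis
    define \<sigma> where "\<sigma> n = (case prod_decode n of (i, j) \<Rightarrow> s i j)" for n
    have "p \<sigma> i = s i" for i by (auto simp: p_def \<sigma>_def)
    then have "z \<in> A' n \<sigma> \<times> F' n \<sigma>" for n
      using z by (auto simp: A'_def F'_def split: prod.split)
    then show "z \<in> (\<Union>\<sigma>. \<Inter>n. A' n \<sigma> \<times> F' n \<sigma>)" by blast
  next
    fix z assume "z \<in> (\<Union>\<sigma>. \<Inter>n. A' n \<sigma> \<times> F' n \<sigma>)"
    then obtain \<sigma> where z: "\<And>n. z \<in> A' n \<sigma> \<times> F' n \<sigma>" by blast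
    have "z \<in> A i n (p \<sigma> i) \<times> F i n (p \<sigma> i)" for i n
      using z[of "prod_encode (i, n)"] by (simp add: A'_def F'_def)
    then show "z \<in> (\<Inter>i. C i)" unfolding AF(5) by blast
  qed
  ultimately show ?thesis unfolding suslin_def by blast
qed

section \<open>Capacitability in a complete metric space\<close>

context Metric_space
begin

text \<open>Choquet's capacitability argument: the bounds \<open>m k\<close> on the coordinates of \<open>\<sigma>\<close> are chosen one after
  the other, each losing no outer measure below \<open>r\<close>; compactness of the bounded sequences then puts
  the intersection of the measurable outer approximations \<open>K k\<close> inside the projection.\<close>

lemma shrinking_suslin_proj:
  fixes N :: "'x measure" and r :: ennreal
  assumes "mcomplete" "finite_measure N"
    and A: "prefix_determined A" "\<And>n \<sigma>. A n \<sigma> \<in> sets N"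
    and F: "prefix_determined F" "\<And>n \<sigma>. closedin mtopology (F n \<sigma>)"
    and diam: "\<And>n \<sigma> x y. x \<in> F (Suc n) \<sigma> \<Longrightarrow> y \<in> F (Suc n) \<sigma> \<Longrightarrow> d x y \<le> 2 / Suc n"
    and r: "r < outer_measure_of N {x. \<exists>\<sigma> y. \<forall>n. x \<in> A n \<sigma> \<and> y \<in> F n \<sigma>}"
  shows "\<exists>B\<in>sets N. B \<subseteq> {x. \<exists>\<sigma> y. \<forall>n. x \<in> A n \<sigma> \<and> y \<in> F n \<sigma>} \<and> r \<le> emeasure N B"
proof -
  interpret N: finite_measure N by fact
  define P where "P k m = {x. \<exists>\<sigma>. (\<forall>j<k. \<sigma> j \<le> m j) \<and> (\<exists>y. \<forall>n. x \<in> A n \<sigma> \<and> y \<in> F n \<sigma>)}"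
    for k and m :: "nat \<Rightarrow> nat"
  have P_sub: "P k m \<subseteq> space N" for k m
  proof
    fix x assume "x \<in> P k m"
    then obtain \<sigma> where "x \<in> A 0 \<sigma>" unfolding P_def by blast
    then show "x \<in> space N" using sets.sets_into_space[OF A(2)] by blast
  qed
  have P_Suc: "P k m = (\<Union>v. P (Suc k) (m(k := v)))" for k m
  proof (intro set_eqI iffI)
    fix x assume "x \<in> P k m"
    then obtain \<sigma> where s: "\<forall>j<k. \<sigma> j \<le> m j" "\<exists>y. \<forall>n. x \<in> A n \<sigma> \<and> y \<in> F n \<sigma>"
      by (auto simp: P_def)
    have "x \<in> P (Suc k) (m(k := \<sigma> k))"
      using s unfolding P_def by (intro CollectI exI[of _ \<sigma>]) (auto simp: less_Suc_eq)
    then show "x \<in> (\<Union>v. P (Suc k) (m(k := v)))" by blast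
  next
    fix x assume "x \<in> (\<Union>v. P (Suc k) (m(k := v)))"
    then obtain v \<sigma> where s: "\<forall>j<Suc k. \<sigma> j \<le> (m(k := v)) j" "\<exists>y. \<forall>n. x \<in> A n \<sigma> \<and> y \<in> F n \<sigma>"
      by (auto simp: P_def)
    have "\<sigma> j \<le> m j" if "j < k" for j using s(1)[rule_format, of j] that by simp
    then show "x \<in> P k m"
      using s(2) unfolding P_def by (intro CollectI exI[of _ \<sigma>]) auto
  qed
  have "\<exists>ms. \<forall>k. r < outer_measure_of N (P k (ms k)) \<and> (\<exists>v. ms (Suc k) = (ms k)(k := v))"
  proof (rule dependent_nat_choice)
    show "\<exists>m. r < outer_measure_of N (P 0 m)"
      using r by (auto simp: P_def)
  next
    fix m k assume "r < outer_measure_of N (P k m)"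
    moreover have "incseq (\<lambda>v. P (Suc k) (m(k := v)))"
    proof (rule incseq_SucI, rule subsetI)
      fix v x assume "x \<in> P (Suc k) (m(k := v))"
      then obtain \<sigma> where s: "\<forall>j<Suc k. \<sigma> j \<le> (m(k := v)) j" "\<exists>y. \<forall>n. x \<in> A n \<sigma> \<and> y \<in> F n \<sigma>"
        by (auto simp: P_def)
      have "\<sigma> j \<le> (m(k := Suc v)) j" if "j < Suc k" for j
        using s(1)[rule_format, OF that] by (auto split: if_splits)
      then show "x \<in> P (Suc k) (m(k := Suc v))"
        using s(2) unfolding P_def by (intro CollectI exI[of _ \<sigma>]) auto
    qed
    then have "outer_measure_of N (P k m) = (SUP v. outer_measure_of N (P (Suc k) (m(k := v))))"
      unfolding P_Suc[of k m] using P_sub by (intro SUP_outer_measure_of_incseq[symmetric]) auto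
    ultimately show "\<exists>m'. r < outer_measure_of N (P (Suc k) m') \<and> (\<exists>v. m' = m(k := v))"
      by (auto simp: less_SUP_iff)
  qed
  then obtain ms where ms: "\<And>k. r < outer_measure_of N (P k (ms k))"
    "\<And>k. \<exists>v. ms (Suc k) = (ms k)(k := v)" by blast
  define m where "m k = ms (Suc k) k" for k
  have agree: "j < k \<Longrightarrow> ms k j = m j" for j k
  proof (induction k)
    case (Suc k)
    then show ?case
      using ms(2)[of k] by (cases "j = k") (auto simp: m_def)
  qed simp
  have Pm: "r < outer_measure_of N (P k m)" for k
  proof -
    have "P k m = P k (ms k)" using agree by (auto simp: P_def)
    then show ?thesis using ms(1) by simp
  qed
  \<comment> \<open>A finitary version of membership in the projection: only levels up to
    \<open>k\<close> are tested, and the witness \<open>y\<close> may depend on \<open>k\<close>.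
    This turns \<open>K k\<close> into a finite union of measurable sets.\<close>
  define good where "good x k \<sigma> \<longleftrightarrow> (\<forall>j<k. \<sigma> j \<le> m j) \<and> (\<forall>n\<le>k. x \<in> A n \<sigma>) \<and>
    (\<exists>y. \<forall>n\<le>k. y \<in> F n \<sigma>)" for x k \<sigma>
  have good_mono: "good x k \<sigma>" if "good x l \<sigma>" "k \<le> l" for x k l \<sigma>
    using that unfolding good_def by (meson order_trans less_le_trans)
  have good_cong: "good x k \<tau>" if "good x k \<sigma>" "\<And>i. i < k \<Longrightarrow> \<sigma> i = \<tau> i" for x k \<sigma> \<tau>
  proof -
    have "A n \<sigma> = A n \<tau>" "F n \<sigma> = F n \<tau>" if "n \<le> k" for n
      using that \<open>\<And>i. i < k \<Longrightarrow> \<sigma> i = \<tau> i\<close>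
      by (auto intro!: prefix_determinedD[OF A(1)] prefix_determinedD[OF F(1)])
    then show ?thesis using that unfolding good_def by auto
  qed
  define K where "K k = {x. \<exists>\<sigma>. good x k \<sigma>}" for k
  have K_meas: "K k \<in> sets N" for k
  proof -
    \<comment> \<open>Entries from \<open>k\<close> on do not influence \<open>good x k\<close>, so
      they are normalized to 0; finitely many bounded prefixes remain.\<close>
    define S where "S = {\<sigma>::nat\<Rightarrow>nat. \<forall>j. (j \<in> {..<k} \<longrightarrow> \<sigma> j \<in> {..Max (m ` {..<k})}) \<and> (j \<notin> {..<k} \<longrightarrow> \<sigma> j = 0)}"
    have "finite S" unfolding S_def by (rule finite_set_of_finite_funs) auto
    have "K k = (\<Union>\<sigma>\<in>{\<sigma>\<in>S. (\<forall>j<k. \<sigma> j \<le> m j) \<and> (\<exists>y. \<forall>n\<le>k. y \<in> F n \<sigma>)}. \<Inter>n\<in>{..k}. A n \<sigma>)"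
    proof (intro set_eqI iffI)
      fix x assume "x \<in> K k"
      then obtain \<sigma> where s: "good x k \<sigma>" by (auto simp: K_def)
      define \<tau> where "\<tau> j = (if j < k then \<sigma> j else 0)" for j
      have g: "good x k \<tau>" by (rule good_cong[OF s]) (auto simp: \<tau>_def)
      have "\<tau> j \<le> Max (m ` {..<k})" if "j < k" for j
        using g that by (meson Max_ge finite_imageI finite_lessThan good_def imageI lessThan_iff order_trans)
      then have "\<tau> \<in> S" by (auto simp: S_def \<tau>_def)
      then show "x \<in> (\<Union>\<sigma>\<in>{\<sigma>\<in>S. (\<forall>j<k. \<sigma> j \<le> m j) \<and> (\<exists>y. \<forall>n\<le>k. y \<in> F n \<sigma>)}. \<Inter>n\<in>{..k}. A n \<sigma>)"
        using g by (auto simp: good_def)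
    next
      fix x assume "x \<in> (\<Union>\<sigma>\<in>{\<sigma>\<in>S. (\<forall>j<k. \<sigma> j \<le> m j) \<and> (\<exists>y. \<forall>n\<le>k. y \<in> F n \<sigma>)}. \<Inter>n\<in>{..k}. A n \<sigma>)"
      then show "x \<in> K k" by (auto simp: K_def good_def)
    qed
    also have "\<dots> \<in> sets N"
      using \<open>finite S\<close> A(2) by (intro sets.finite_UN sets.finite_INT) auto
    finally show ?thesis .
  qed
  have "decseq K"
    unfolding decseq_def K_def using good_mono by blast
  have rK: "r \<le> emeasure N (K k)" for k
  proof -
    have "P k m \<subseteq> K k" unfolding P_def K_def good_def by blast
    then have "outer_measure_of N (P k m) \<le> emeasure N (K k)"
      using K_meas by (metis outer_measure_of_eq outer_measure_of_mono)
    then show ?thesis using Pm[of k] by (meson less_le_trans less_imp_le)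
  qed
  have "r \<le> emeasure N (\<Inter>k. K k)"
  proof -
    have "emeasure N (\<Inter>k. K k) = (INF k. emeasure N (K k))"
      using K_meas \<open>decseq K\<close> by (intro INF_emeasure_decseq[symmetric]) auto
    then show ?thesis using rK by (simp add: INF_greatest)
  qed
  moreover have "(\<Inter>k. K k) \<subseteq> {x. \<exists>\<sigma> y. \<forall>n. x \<in> A n \<sigma> \<and> y \<in> F n \<sigma>}"
  proof
    fix x assume x: "x \<in> (\<Inter>k. K k)"
    \<comment> \<open>Koenig's lemma on the finitely branching tree of good prefixes.\<close>
    have "\<exists>ss. \<forall>j. (\<forall>k. \<exists>\<tau>. (\<forall>i<j. \<tau> i = ss j i) \<and> good x k \<tau>) \<and> (\<exists>v. ss (Suc j) = (ss j)(j := v))"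
    proof (rule dependent_nat_choice)
      show "\<exists>s. \<forall>k. \<exists>\<tau>. (\<forall>i<0. \<tau> i = s i) \<and> good x k \<tau>" using x by (auto simp: K_def)
    next
      fix s j assume ok: "\<forall>k. \<exists>\<tau>. (\<forall>i<j. \<tau> i = s i) \<and> good x k \<tau>"
      have "\<exists>v. \<forall>k. \<exists>\<tau>. (\<forall>i<Suc j. \<tau> i = (s(j := v)) i) \<and> good x k \<tau>"
      proof (rule ccontr)
        assume "\<not> ?thesis"
        then obtain kk where kk: "\<And>v \<tau>. (\<forall>i<Suc j. \<tau> i = (s(j := v)) i) \<Longrightarrow> \<not> good x (kk v) \<tau>"
          by metis
        define k where "k = max (Suc j) (Max (kk ` {..m j}))"
        obtain \<tau> where t: "\<forall>i<j. \<tau> i = s i" "good x k \<tau>" using ok by blast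
        have "\<tau> j \<le> m j" using t(2) by (auto simp: good_def k_def)
        then have "kk (\<tau> j) \<le> k" by (auto simp: k_def le_max_iff_disj)
        then have "good x (kk (\<tau> j)) \<tau>" using good_mono t(2) by blast
        moreover have "\<forall>i<Suc j. \<tau> i = (s(j := \<tau> j)) i" using t(1) by (auto simp: less_Suc_eq)
        ultimately show False using kk by blast
      qed
      then show "\<exists>s'. (\<forall>k. \<exists>\<tau>. (\<forall>i<Suc j. \<tau> i = s' i) \<and> good x k \<tau>) \<and> (\<exists>v. s' = s(j := v))"
        by blast
    qed
    then obtain ss where ss: "\<And>j k. \<exists>\<tau>. (\<forall>i<j. \<tau> i = ss j i) \<and> good x k \<tau>"
      "\<And>j. \<exists>v. ss (Suc j) = (ss j)(j := v)" by blast
    define \<sigma> where "\<sigma> j = ss (Suc j) j" for j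
    have agree: "j < k \<Longrightarrow> ss k j = \<sigma> j" for j k
    proof (induction k)
      case (Suc k)
      then show ?case using ss(2)[of k] by (cases "j = k") (auto simp: \<sigma>_def)
    qed simp
    have g: "good x k \<sigma>" for k
      using ss(1)[of k k] agree good_cong by metis
    \<comment> \<open>The witnesses so far serve finitely many levels each. Shrinking diameters make
      them a Cauchy sequence, and closedness of the sets \<open>F n \<sigma>\<close> puts its limit
      into all of them.\<close>
    then have "\<forall>k. \<exists>y. \<forall>n\<le>k. y \<in> F n \<sigma>" by (auto simp: good_def)
    then obtain y where y: "\<And>k n. n \<le> k \<Longrightarrow> y k \<in> F n \<sigma>" by metis
    have "y k \<in> M" for k
      using y[of k k] closedin_subset[OF F(2)[of k \<sigma>]] by auto
    moreover have "\<exists>n0. \<forall>n n'. n0 \<le> n \<longrightarrow> n0 \<le> n' \<longrightarrow> d (y n) (y n') < e" if "e > 0" for e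
    proof -
      obtain n0 where n0: "2 / real (Suc n0) < e"
      proof -
        obtain n0 where "inverse (real (Suc n0)) < e / 2" using \<open>e > 0\<close> reals_Archimedean[of "e / 2"] by auto
        then show ?thesis by (intro that[of n0]) (simp add: field_simps)
      qed
      have "d (y n) (y n') < e" if "Suc n0 \<le> n" "Suc n0 \<le> n'" for n n'
        using diam[OF y[OF that(1)] y[OF that(2)]] n0 by simp
      then show ?thesis by blast
    qed
    ultimately have "MCauchy y" unfolding MCauchy_def by blast
    then obtain z where z: "limitin mtopology y z sequentially" using assms(1) mcomplete_def by blast
    have "z \<in> F n \<sigma>" for n
      by (rule limitin_closedin[OF z F(2)]) (use y in \<open>auto simp: eventually_sequentially\<close>)
    moreover have "x \<in> A n \<sigma>" for n using g[of n] by (auto simp: good_def)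
    ultimately show "x \<in> {x. \<exists>\<sigma> y. \<forall>n. x \<in> A n \<sigma> \<and> y \<in> F n \<sigma>}" by blast
  qed
  moreover have "(\<Inter>k. K k) \<in> sets N" using K_meas by auto
  ultimately show ?thesis by blast
qed

text \<open>Any scheme can be refined to a shrinking one: each entry of the new branch packs, by
  \<open>prod_encode\<close>, an old entry together with the index of a ball of radius
  \<open>1 / Suc k\<close> about a point of the dense sequence \<open>q\<close>. Then measurable
  subsets of the projection exhaust its outer measure, so it lies between two measurable sets that
  differ by a null set.\<close>

lemma mcomplete_suslin_proj:
  fixes N :: "'x measure" and q :: "nat \<Rightarrow> 'a"
  assumes "mcomplete" "finite_measure N"
    and q: "\<And>n. q n \<in> M" "\<And>y e. y \<in> M \<Longrightarrow> 0 < e \<Longrightarrow> \<exists>n. d (q n) y < e"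
    and C: "C \<in> suslin (sets N) {F. closedin mtopology F}"
  shows "fst ` C \<in> sets (completion N)"
proof -
  obtain A F where AF: "prefix_determined A" "prefix_determined F" "\<And>n \<sigma>. A n \<sigma> \<in> sets N"
    "\<And>n \<sigma>. closedin mtopology (F n \<sigma>)" "C = (\<Union>\<sigma>. \<Inter>n. A n \<sigma> \<times> F n \<sigma>)"
    using C by (auto simp: suslin_def)
  define A' where "A' n \<sigma> = A n (\<lambda>j. fst (prod_decode (\<sigma> j)))" for n \<sigma>
  define F' where "F' n \<sigma> = F n (\<lambda>j. fst (prod_decode (\<sigma> j))) \<inter>
    (case n of 0 \<Rightarrow> M | Suc k \<Rightarrow> mcball (q (snd (prod_decode (\<sigma> k)))) (1 / Suc k))" for n \<sigma>
  have proj: "fst ` C = {x. \<exists>\<sigma> y. \<forall>n. x \<in> A' n \<sigma> \<and> y \<in> F' n \<sigma>}"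
  proof (intro set_eqI iffI)
    fix x assume "x \<in> fst ` C"
    then obtain \<sigma> y where xy: "\<And>n. x \<in> A n \<sigma>" "\<And>n. y \<in> F n \<sigma>" unfolding AF(5) by force
    have yM: "y \<in> M" using xy(2)[of 0] closedin_subset[OF AF(4)[of 0 \<sigma>]] by auto
    then have "\<forall>k. \<exists>n. d (q n) y < 1 / Suc k" using q(2) by simp
    then obtain t where t: "\<And>k. d (q (t k)) y < 1 / Suc k" by metis
    define \<tau> where "\<tau> k = prod_encode (\<sigma> k, t k)" for k
    have "x \<in> A' n \<tau> \<and> y \<in> F' n \<tau>" for n
      using xy yM less_imp_le[OF t] q(1) by (auto simp: A'_def F'_def \<tau>_def split: nat.split)
    then show "x \<in> {x. \<exists>\<sigma> y. \<forall>n. x \<in> A' n \<sigma> \<and> y \<in> F' n \<sigma>}" by blast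
  next
    fix x assume "x \<in> {x. \<exists>\<sigma> y. \<forall>n. x \<in> A' n \<sigma> \<and> y \<in> F' n \<sigma>}"
    then obtain \<sigma> y where "\<And>n. x \<in> A' n \<sigma> \<and> y \<in> F' n \<sigma>" by blast
    then have "(x, y) \<in> C" unfolding AF(5) A'_def F'_def by blast
    then show "x \<in> fst ` C" by force
  qed
  have pd: "prefix_determined A'" "prefix_determined F'"
  proof -
    show "prefix_determined A'"
      unfolding prefix_determined_def
    proof (intro allI impI)
      fix n and \<sigma> \<tau> :: "nat \<Rightarrow> nat" assume eq: "\<forall>i<n. \<sigma> i = \<tau> i"
      show "A' n \<sigma> = A' n \<tau>"
        unfolding A'_def by (rule prefix_determinedD[OF AF(1)]) (use eq in simp)
    qed
    show "prefix_determined F'"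
      unfolding prefix_determined_def
    proof (intro allI impI)
      fix n and \<sigma> \<tau> :: "nat \<Rightarrow> nat" assume eq: "\<forall>i<n. \<sigma> i = \<tau> i"
      have "F n (\<lambda>j. fst (prod_decode (\<sigma> j))) = F n (\<lambda>j. fst (prod_decode (\<tau> j)))"
        by (rule prefix_determinedD[OF AF(2)]) (use eq in simp)
      then show "F' n \<sigma> = F' n \<tau>" using eq by (cases n) (simp_all add: F'_def)
    qed
  qed
  have diam: "d x y \<le> 2 / Suc n" if "x \<in> F' (Suc n) \<sigma>" "y \<in> F' (Suc n) \<sigma>" for n \<sigma> x y
  proof -
    define c where "c = q (snd (prod_decode (\<sigma> n)))"
    have "c \<in> M" "x \<in> M" "y \<in> M" "d c x \<le> 1 / Suc n" "d c y \<le> 1 / Suc n"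
      using that by (auto simp: F'_def c_def)
    then show ?thesis using triangle''[of x c y] commute[of x c] by simp
  qed
  have cl: "closedin mtopology (F' n \<sigma>)" for n \<sigma>
    unfolding F'_def using AF(4) closedin_topspace[of mtopology]
    by (intro closedin_Int) (auto split: nat.split)
  have sA: "A' n \<sigma> \<in> sets N" for n \<sigma> unfolding A'_def by (rule AF(3))
  interpret N: finite_measure N by fact
  let ?P = "fst ` C"
  have sub: "?P \<subseteq> space N"
    unfolding proj using sets.sets_into_space[OF sA] by blast
  obtain G where G: "G \<in> sets N" "?P \<subseteq> G" "outer_measure_of N ?P = emeasure N G"
    using outer_measure_of_attain[OF sub] by blast
  have inner: "\<exists>B\<in>sets N. B \<subseteq> ?P \<and> r \<le> emeasure N B" if "r < emeasure N G" for r
    using shrinking_suslin_proj[where r = r, OF assms(1,2) pd(1) sA pd(2) cl diam] that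
    unfolding G(3)[symmetric] proj by simp
  show ?thesis
  \<comment> \<open>A sequence strictly below the outer measure exists only if that measure is
    positive.\<close>
  proof (cases "emeasure N G = 0")
    case True
    then have "G \<in> null_sets N" using G(1) by auto
    then show ?thesis using G(2) by (rule null_sets_completion)
  next
    case False
    have "\<exists>r. (\<forall>n::nat. r n < emeasure N G) \<and> r \<longlonglongrightarrow> emeasure N G"
      using approx_from_below_dense_linorder[of 0 "emeasure N G"] False
      by (metis gr_zeroI)
    then obtain r :: "nat \<Rightarrow> ennreal" where r: "\<And>n. r n < emeasure N G" "r \<longlonglongrightarrow> emeasure N G" by blast
    obtain B where B: "\<And>n. B n \<in> sets N" "\<And>n. B n \<subseteq> ?P" "\<And>n. r n \<le> emeasure N (B n)"
      using inner[OF r(1)] by metis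
    let ?B = "\<Union>n. B n"
    have Bs: "?B \<in> sets N" using B(1) by auto
    have "r n \<le> emeasure N ?B" for n
      using B(3)[of n] emeasure_mono[of "B n" ?B N] Bs by (meson UN_upper UNIV_I order_trans)
    then have "emeasure N G \<le> emeasure N ?B"
      using r(2) by (meson LIMSEQ_le_const2)
    moreover have "?B \<subseteq> G" using B(2) G(2) by blast
    ultimately have "emeasure N (G - ?B) = 0"
      using G(1) Bs by (subst emeasure_Diff) (auto simp: diff_eq_0_iff_ennreal less_top[symmetric])
    then have "G - ?B \<in> null_sets N" using G(1) Bs by auto
    then show ?thesis
      by (intro sets_completionI[of ?P ?B "?P - ?B" "G - ?B" N]) (use B(2) G(2) Bs in auto)
  qed
qed

end

text \<open>Complements are carried along since the Suslin operation is not closed under them.\<close>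

lemma pair_sigma_suslin:
  fixes N :: "'x measure" and N' :: "'y measure"
  assumes T: "metrizable_space T" "topspace T = space N'"
      "sets N' = sigma_sets (space N') {U. openin T U}"
    and C: "C \<in> sets (N \<Otimes>\<^sub>M N')"
  shows "C \<in> suslin (sets N) {F. closedin T F}"
proof -
  let ?X = "space N" and ?Y = "space N'" and ?S = "suslin (sets N) {F. closedin T F}"
  define D where "D = {C. C \<subseteq> ?X \<times> ?Y \<and> C \<in> ?S \<and> ?X \<times> ?Y - C \<in> ?S}"
  have UN: "(\<Union>i. C i) \<in> ?S" if "\<And>i::nat. C i \<in> ?S" for C
  proof (rule suslin_UN[where X = ?X and Y = ?Y, OF that])
    show "?Y \<in> {F. closedin T F}" using T(2) by (metis closedin_topspace mem_Collect_eq)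
    show "{F. closedin T F} \<subseteq> Pow ?Y" using T(2) closedin_subset by blast
  qed (auto simp: sets.space_closed)
  have INT: "(\<Inter>i. C i) \<in> ?S" if "\<And>i::nat. C i \<in> ?S" for C
    by (rule suslin_INT[where C = C, OF that])
  have D_compl: "?X \<times> ?Y - C \<in> D" if "C \<in> D" for C
    using that by (auto simp: D_def double_diff)
  have D_UN: "(\<Union>i. C i) \<in> D" if "\<And>i::nat. C i \<in> D" for C
  proof -
    have "?X \<times> ?Y - (\<Union>i. C i) = (\<Inter>i. ?X \<times> ?Y - C i)" by blast
    also have "\<dots> \<in> ?S" using that by (intro INT) (auto simp: D_def)
    finally show ?thesis using that UN[of C] by (auto simp: D_def)
  qed
  have clY: "closedin T ?Y" using T(2) by (metis closedin_topspace)
  have D_left: "A \<times> ?Y \<in> D" if "A \<in> sets N" for A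
  proof -
    have "?X \<times> ?Y - A \<times> ?Y = (?X - A) \<times> ?Y" by blast
    then show ?thesis
      using that clY sets.sets_into_space[OF that] by (auto simp: D_def intro!: suslin_Times)
  qed
  have D_right: "?X \<times> B \<in> D" if "B \<in> sigma_sets ?Y {U. openin T U}" for B
    using that
  proof induction
    case (Basic U)
    then have U: "openin T U" by simp
    \<comment> \<open>In a metrizable space an open set is a countable union of closed sets, while
      its complement is closed already.\<close>
    obtain K where K: "\<And>n::nat. closedin T (K n)" "U = (\<Union>n. K n)"
      using open_imp_fsigma_in[OF T(1) U] unfolding fsigma_in_ascending by metis
    have "?X \<times> U = (\<Union>n. ?X \<times> K n)" using K(2) by auto
    also have "\<dots> \<in> ?S" using K(1) by (intro UN suslin_Times) auto
    finally have "?X \<times> U \<in> ?S" .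
    moreover have "?X \<times> ?Y - ?X \<times> U = ?X \<times> (topspace T - U)" using T(2) by auto
    then have "?X \<times> ?Y - ?X \<times> U \<in> ?S" using U by (auto intro!: suslin_Times)
    moreover have "U \<subseteq> ?Y" using openin_subset[OF U] T(2) by simp
    ultimately show ?case unfolding D_def by auto
  next
    case Empty
    have "?X \<times> ?Y - ?X \<times> ?Y \<in> D" using D_left[of ?X] by (intro D_compl) auto
    then show ?case by simp
  next
    case (Compl B)
    have "?X \<times> (?Y - B) = ?X \<times> ?Y - ?X \<times> B" by blast
    then show ?case using D_compl[OF Compl.IH] by simp
  next
    case (Union B)
    have "?X \<times> (\<Union>i. B i) = (\<Union>i. ?X \<times> B i)" by blast
    then show ?case using D_UN[of "\<lambda>i. ?X \<times> B i"] Union.IH by simp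
  qed
  have D_Int: "C1 \<inter> C2 \<in> D" if "C1 \<in> D" "C2 \<in> D" for C1 C2
  proof -
    have "C1 \<inter> C2 = ?X \<times> ?Y - (\<Union>i::nat. if i = 0 then ?X \<times> ?Y - C1 else ?X \<times> ?Y - C2)"
      using that by (auto simp: D_def split: if_splits)
    also have "\<dots> \<in> D" using that by (intro D_compl D_UN) (auto intro: D_compl)
    finally show ?thesis .
  qed
  have "C \<in> sigma_sets (?X \<times> ?Y) {A \<times> B |A B. A \<in> sets N \<and> B \<in> sets N'}"
    using C by (simp add: sets_pair_measure)
  then have "C \<in> D"
  proof induction
    case (Basic R)
    then obtain A B where R: "R = A \<times> B" "A \<in> sets N" "B \<in> sets N'" by blast
    have "R = (A \<times> ?Y) \<inter> (?X \<times> B)"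
      using R sets.sets_into_space[OF R(2)] sets.sets_into_space[OF R(3)] by auto
    also have "\<dots> \<in> D" using R T(3) by (intro D_Int D_left D_right) auto
    finally show ?case .
  next
    case Empty
    have "?X \<times> ?Y - ?X \<times> ?Y \<in> D" using D_left[of ?X] by (intro D_compl) auto
    then show ?case by simp
  qed (auto intro: D_compl D_UN)
  then show ?thesis by (simp add: D_def)
qed

section \<open>Borel graphs modulo null sets\<close>

text \<open>Everything that is used of the Polish topology, phrased with a countable base
  \<open>b\<close>: it separates a point from finitely many others, separates two points inside a
  given base set, and projections of measurable sets are measurable for the completion. The topology
  itself does not appear afterwards.\<close>

lemma standard_borel_base:
  fixes N :: "'a measure"
  assumes sb: "standard_borel N" and fin: "finite_measure N" and ne: "space N \<noteq> {}"
  obtains b :: "nat \<Rightarrow> 'a set" where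
    "\<And>n. b n \<in> sets N" "sets N = sigma_sets (space N) (range b)"
    "\<And>y F. y \<in> space N \<Longrightarrow> finite F \<Longrightarrow> y \<notin> F \<Longrightarrow> \<exists>n. y \<in> b n \<and> b n \<inter> F = {}"
    "\<And>y m n. y \<in> b m \<inter> b n \<Longrightarrow> \<exists>p. y \<in> b p \<and> b p \<subseteq> b m \<inter> b n"
    "\<And>y z n. y \<in> b n \<Longrightarrow> z \<in> b n \<Longrightarrow> y \<noteq> z \<Longrightarrow>
       \<exists>p r. y \<in> b p \<and> z \<in> b r \<and> b p \<inter> b r = {} \<and> b p \<subseteq> b n \<and> b r \<subseteq> b n"
    "\<And>C. C \<in> sets (N \<Otimes>\<^sub>M N) \<Longrightarrow> fst ` C \<in> sets (completion N)"
proof -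
  obtain T where T: "completely_metrizable_space T" "separable_space T" "topspace T = space N"
    "sets N = sigma_sets (space N) {U. openin T U}"
    using sb by (auto simp: standard_borel_def polish_topology_def)
  obtain M d where Md: "Metric_space M d" "Metric_space.mcomplete M d" "T = Metric_space.mtopology M d"
    using T(1) unfolding completely_metrizable_space_def by blast
  interpret Metric_space M d by fact
  have M: "M = space N" using T(3) Md(3) by simp
  obtain D where D: "countable D" "D \<subseteq> M" "mtopology closure_of D = M"
    using T(2) Md(3) by (auto simp: separable_space_def)
  have "D \<noteq> {}" using D(3) M ne by auto
  define q where "q = from_nat_into D"
  have q: "q n \<in> M" for n using D(2) \<open>D \<noteq> {}\<close> by (auto simp: q_def intro: from_nat_into)
  have q_dense: "\<exists>n. d (q n) y < e" if y: "y \<in> M" and e: "0 < e" for y e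
  proof -
    have "y \<in> mtopology closure_of D" using y D(3) by simp
    then obtain z where "z \<in> D" "z \<in> mball y e"
      unfolding metric_closure_of using e by blast
    then show ?thesis
      using from_nat_into_surj[OF D(1)] by (metis q_def commute in_mball)
  qed
  define b where "b n = (case prod_decode n of (i, k) \<Rightarrow> mball (q i) (1 / Suc k))" for n
  have b_open: "openin mtopology (b n)" for n by (auto simp: b_def split: prod.split)
  have base: "\<exists>n. y \<in> b n \<and> b n \<subseteq> U" if U: "openin mtopology U" and y: "y \<in> U" for U y
  proof -
    obtain r where r: "r > 0" "mball y r \<subseteq> U" using U y unfolding openin_mtopology by blast
    have yM: "y \<in> M" using U y openin_mtopology by blast
    obtain k where k: "inverse (real (Suc k)) < r / 2" using r(1) reals_Archimedean[of "r / 2"] by auto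
    obtain i where i: "d (q i) y < 1 / Suc k" using q_dense[OF yM, of "1 / Suc k"] by auto
    have "b (prod_encode (i, k)) \<subseteq> mball y r"
    proof
      fix z assume "z \<in> b (prod_encode (i, k))"
      then have z: "z \<in> M" "d (q i) z < 1 / Suc k" by (auto simp: b_def)
      have "d y z \<le> d (q i) y + d (q i) z" using triangle[of y "q i" z] z(1) yM q commute by simp
      then have "d y z < r" using i z(2) k by (simp add: inverse_eq_divide)
      then show "z \<in> mball y r" using z yM by simp
    qed
    moreover have "y \<in> b (prod_encode (i, k))" using i q yM by (auto simp: b_def)
    ultimately show ?thesis using r(2) by blast
  qed
  have b_sets: "b n \<in> sets N" for n
    unfolding T(4) using b_open Md(3) by (auto intro: sigma_sets.Basic)
  have gen: "sets N = sigma_sets (space N) (range b)"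
  proof
    show "sigma_sets (space N) (range b) \<subseteq> sets N"
      using b_sets by (intro sets.sigma_sets_subset) auto
    show "sets N \<subseteq> sigma_sets (space N) (range b)"
      unfolding T(4)
    proof (rule sigma_sets_mono, rule subsetI)
      fix U assume "U \<in> {U. openin T U}"
      then have U: "openin mtopology U" using Md(3) by simp
      have "\<Union> (b ` {n. b n \<subseteq> U}) \<in> sigma_sets (space N) (range b)"
        by (rule sigma_sets_UNION) auto
      also have "\<Union> (b ` {n. b n \<subseteq> U}) = U" using base[OF U] by blast
      finally show "U \<in> sigma_sets (space N) (range b)" .
    qed
  qed
  show ?thesis
  proof (rule that[of b, OF b_sets gen])
    fix y F assume y: "y \<in> space N" and F: "finite F" "y \<notin> (F :: 'a set)"
    have "closedin mtopology (F \<inter> M)"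
      using F(1) by (intro closedin_Hausdorff_finite Hausdorff_space_mtopology) auto
    then have "openin mtopology (M - F \<inter> M)" by (metis openin_diff openin_topspace topspace_mtopology)
    moreover have "y \<in> M - F \<inter> M" using y F M by simp
    ultimately obtain n where "y \<in> b n" "b n \<subseteq> M - F \<inter> M" using base by blast
    then show "\<exists>n. y \<in> b n \<and> b n \<inter> F = {}" by blast
  next
    fix y m n assume "y \<in> b m \<inter> b n"
    then show "\<exists>p. y \<in> b p \<and> b p \<subseteq> b m \<inter> b n"
      using base[OF openin_Int[OF b_open b_open]] by blast
  next
    fix y z n assume yz: "y \<in> b n" "z \<in> b n" "y \<noteq> z"
    then have "y \<in> topspace mtopology" "z \<in> topspace mtopology" using openin_subset[OF b_open] by blast+
    then obtain U V where UV: "openin mtopology U" "openin mtopology V" "y \<in> U" "z \<in> V" "disjnt U V"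
      using Hausdorff_space_mtopology yz(3) unfolding Hausdorff_space_def by blast
    obtain p where p: "y \<in> b p" "b p \<subseteq> U \<inter> b n"
      using base[OF openin_Int[OF UV(1) b_open[of n]], of y] UV(3) yz(1) by blast
    obtain r where r: "z \<in> b r" "b r \<subseteq> V \<inter> b n"
      using base[OF openin_Int[OF UV(2) b_open[of n]], of z] UV(4) yz(2) by blast
    show "\<exists>p r. y \<in> b p \<and> z \<in> b r \<and> b p \<inter> b r = {} \<and> b p \<subseteq> b n \<and> b r \<subseteq> b n"
      using p r UV(5) unfolding disjnt_def by blast
  next
    fix C assume C: "C \<in> sets (N \<Otimes>\<^sub>M N)"
    have "C \<in> suslin (sets N) {F. closedin mtopology F}"
    proof (rule pair_sigma_suslin[OF _ _ _ C])
      show "metrizable_space mtopology" by (rule metrizable_space_mtopology)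
      show "topspace mtopology = space N" by (rule trans[OF topspace_mtopology M])
      show "sets N = sigma_sets (space N) {U. openin mtopology U}" using T(4) unfolding Md(3) .
    qed
    from mcomplete_suslin_proj[where q = q, OF Md(2) fin q q_dense this]
    show "fst ` C \<in> sets (completion N)" .
  qed
qed

section \<open>Invariant null sets and measurable selection of neighbours\<close>

context graphing
begin

lemma edges_subset: "E \<subseteq> space \<nu> \<times> space \<nu>"
  using sets.sets_into_space[OF edges_borel] by (simp add: space_pair_measure)

lemma finite_section: "finite (E `` {x})"
proof (cases "x \<in> space \<nu>")
  case True
  then show ?thesis using bounded_degree by blast
next
  case False
  then have "E `` {x} = {}" using edges_subset by blast
  then show ?thesis by simp
qed

lemma proj_completion: "C \<in> sets (\<nu> \<Otimes>\<^sub>M \<nu>) \<Longrightarrow> fst ` C \<in> sets (completion \<nu>)"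
  by (rule standard_borel_base[OF standard_borel finite_measure_axioms not_empty])

text \<open>By mass transport the number of edges from the whole space into \<open>N\<close>
  integrates to that of the edges out of \<open>N\<close>, which is 0. The neighbourhood is a
  projection and so measurable only for the completion; the argument is applied to its Borel part
  \<open>S\<close>.\<close>

lemma null_neighbourhood:
  assumes N: "N \<in> null_sets \<nu>"
  shows "\<exists>N'\<in>null_sets \<nu>. E `` N \<subseteq> N'"
proof -
  let ?P = "fst ` (E \<inter> space \<nu> \<times> N)"
  have "E \<inter> space \<nu> \<times> N \<in> sets (\<nu> \<Otimes>\<^sub>M \<nu>)"
    using N edges_borel by (intro sets.Int pair_measureI) auto
  then obtain S Q N' where P: "?P = S \<union> Q" "Q \<subseteq> N'" "N' \<in> null_sets \<nu>" "S \<in> sets \<nu>"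
    using sets_completionE[OF proj_completion] by metis
  have "emeasure \<nu> S = (\<integral>\<^sup>+x. indicator S x \<partial>\<nu>)" using P(4) by simp
  also have "\<dots> \<le> (\<integral>\<^sup>+x\<in>space \<nu>. of_nat (deg E x N) \<partial>\<nu>)"
  proof (rule nn_integral_mono)
    fix x assume x: "x \<in> space \<nu>"
    have "1 \<le> deg E x N" if "x \<in> S"
    proof -
      have "E `` {x} \<inter> N \<noteq> {}" using that P(1) by force
      then show ?thesis unfolding deg_def using finite_section by (simp add: Suc_le_eq card_gt_0_iff)
    qed
    then have "(1::ennreal) \<le> of_nat (deg E x N)" if "x \<in> S"
      using that by (metis of_nat_1 of_nat_le_iff)
    then show "indicator S x \<le> of_nat (deg E x N) * (indicator (space \<nu>) x :: ennreal)"
      using x by (auto simp: indicator_def)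
  qed
  also have "\<dots> = (\<integral>\<^sup>+x\<in>N. of_nat (deg E x (space \<nu>)) \<partial>\<nu>)"
    using N by (intro measure_preserving) auto
  also have "\<dots> = (\<integral>\<^sup>+x. 0 \<partial>\<nu>)"
    by (rule nn_integral_cong_AE, rule AE_mp[OF AE_not_in[OF N]]) (auto simp: indicator_def)
  finally have "S \<in> null_sets \<nu>" using P(4) by auto
  then have "S \<union> N' \<in> null_sets \<nu>" using P(3) by auto
  moreover have "E `` N \<subseteq> S \<union> N'"
  proof
    fix y assume "y \<in> E `` N"
    then obtain x where "x \<in> N" "(x, y) \<in> E" by blast
    then have "(y, x) \<in> E" using edges_sym by (simp add: symD)
    then have "(y, x) \<in> E \<inter> space \<nu> \<times> N" using \<open>x \<in> N\<close> edges_subset by blast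
    then have "y \<in> ?P" by force
    then show "y \<in> S \<union> N'" using P by blast
  qed
  ultimately show ?thesis by blast
qed

text \<open>An invariant null set can be discarded without changing the edges at the vertices that
  remain.\<close>

lemma null_saturation:
  assumes N: "N \<in> null_sets \<nu>"
  shows "\<exists>N'\<in>null_sets \<nu>. N \<subseteq> N' \<and> E `` N' \<subseteq> N'"
proof -
  have "\<exists>f. \<forall>n. (f n \<in> null_sets \<nu> \<and> (n = 0 \<longrightarrow> N \<subseteq> f n)) \<and> E `` f n \<subseteq> f (Suc n)"
  proof (rule dependent_nat_choice)
    show "\<exists>x. x \<in> null_sets \<nu> \<and> (0 = (0::nat) \<longrightarrow> N \<subseteq> x)" using N by blast
  qed (use null_neighbourhood in blast)
  then obtain f where "\<forall>n. (f n \<in> null_sets \<nu> \<and> (n = 0 \<longrightarrow> N \<subseteq> f n)) \<and> E `` f n \<subseteq> f (Suc n)" ..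
  then have f: "\<And>n. f n \<in> null_sets \<nu>" "N \<subseteq> f 0" "\<And>n. E `` f n \<subseteq> f (Suc n)" by simp_all
  have "(\<Union>n. f n) \<in> null_sets \<nu>" using f(1) by (rule null_sets_UN)
  moreover have "E `` (\<Union>n. f n) \<subseteq> (\<Union>n. f n)" using f(3) by blast
  moreover have "N \<subseteq> (\<Union>n. f n)" using f(2) by blast
  ultimately show ?thesis by blast
qed

text \<open>A substitute for the Lusin--Novikov theorem.\<close>

lemma lusin_novikov_mod_null:
  obtains N G where "N \<in> null_sets \<nu>" "E `` N \<subseteq> N"
    "\<And>n::nat. G n \<in> sets (\<nu> \<Otimes>\<^sub>M \<nu>)" "\<And>n. single_valued (G n)"
    "(\<Union>n. G n) = E \<inter> (space \<nu> - N) \<times> space \<nu>"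
    "\<And>C. C \<in> sets (\<nu> \<Otimes>\<^sub>M \<nu>) \<Longrightarrow> C \<subseteq> E \<inter> (space \<nu> - N) \<times> space \<nu> \<Longrightarrow> Domain C \<in> sets \<nu>"
proof -
  obtain b :: "nat \<Rightarrow> 'a set" where b: "\<And>n. b n \<in> sets \<nu>" "sets \<nu> = sigma_sets (space \<nu>) (range b)"
    "\<And>y F. y \<in> space \<nu> \<Longrightarrow> finite F \<Longrightarrow> y \<notin> F \<Longrightarrow> \<exists>n. y \<in> b n \<and> b n \<inter> F = {}"
    "\<And>y m n. y \<in> b m \<inter> b n \<Longrightarrow> \<exists>p. y \<in> b p \<and> b p \<subseteq> b m \<inter> b n"
    "\<And>y z n. y \<in> b n \<Longrightarrow> z \<in> b n \<Longrightarrow> y \<noteq> z \<Longrightarrow>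
       \<exists>p r. y \<in> b p \<and> z \<in> b r \<and> b p \<inter> b r = {} \<and> b p \<subseteq> b n \<and> b r \<subseteq> b n"
    by (rule standard_borel_base[OF standard_borel finite_measure_axioms not_empty]) (rule that)
  define D where "D n = fst ` (E \<inter> space \<nu> \<times> b n)" for n
  have D_iff: "x \<in> D n \<longleftrightarrow> (\<exists>y\<in>b n. (x, y) \<in> E)" for x n
  proof
    assume "x \<in> D n"
    then obtain y where "(x, y) \<in> E \<inter> space \<nu> \<times> b n" unfolding D_def by force
    then show "\<exists>y\<in>b n. (x, y) \<in> E" by blast
  next
    assume "\<exists>y\<in>b n. (x, y) \<in> E"
    then obtain y where "(x, y) \<in> E \<inter> space \<nu> \<times> b n" using edges_subset by blast
    then show "x \<in> D n" unfolding D_def by force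
  qed
  have "D n \<in> sets (completion \<nu>)" for n
    unfolding D_def using edges_borel b(1) by (intro proj_completion sets.Int pair_measureI) auto
  then have "\<forall>n. \<exists>S N'. N' \<in> null_sets \<nu> \<and> S \<in> sets \<nu> \<and> D n - N' = S - N'"
  proof (intro allI)
    fix n
    obtain S Q N' where "D n = S \<union> Q" "Q \<subseteq> N'" "N' \<in> null_sets \<nu>" "S \<in> sets \<nu>"
      using sets_completionE[OF \<open>D n \<in> sets (completion \<nu>)\<close>] by metis
    then show "\<exists>S N'. N' \<in> null_sets \<nu> \<and> S \<in> sets \<nu> \<and> D n - N' = S - N'" by blast
  qed
  then obtain S N0 where S: "\<And>n. N0 n \<in> null_sets \<nu>" "\<And>n. S n \<in> sets \<nu>" "\<And>n. D n - N0 n = S n - N0 n"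
    by metis
  have "(\<Union>n. N0 n) \<in> null_sets \<nu>" using S(1) by (rule null_sets_UN)
  \<comment> \<open>Each \<open>D n\<close> agrees with a Borel set off \<open>N0 n\<close>; outside
    one invariant null set they are all Borel at once.\<close>
  from null_saturation[OF this]
  obtain N where N: "N \<in> null_sets \<nu>" "(\<Union>n. N0 n) \<subseteq> N" "E `` N \<subseteq> N" by blast
  define X where "X = space \<nu> - N"
  have X: "X \<in> sets \<nu>" using N(1) by (auto simp: X_def)
  have DX: "X \<inter> D n \<in> sets \<nu>" for n
  proof -
    have "X \<inter> D n = X \<inter> S n" using S(3)[of n] N(2) unfolding X_def by blast
    then show ?thesis using X S(2) by auto
  qed
  \<comment> \<open>\<open>single n\<close> consists of the vertices of \<open>X\<close> with
    exactly one neighbour in \<open>b n\<close>: two neighbours there would lie in disjoint base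
    sets inside \<open>b n\<close>. So uniqueness is a countable Boolean combination of the sets
    \<open>X \<inter> D p\<close>.\<close>
  define sep where "sep n = {(p, r). b p \<inter> b r = {} \<and> b p \<subseteq> b n \<and> b r \<subseteq> b n}" for n
  define single where "single n = X \<inter> D n - (\<Union>(p, r)\<in>sep n. X \<inter> D p \<inter> (X \<inter> D r))" for n
  have single_sets: "single n \<in> sets \<nu>" for n
    unfolding single_def by (intro sets.Diff DX sets.countable_UN') (auto intro: DX)
  have single_unique: "y = z" if "x \<in> single n" "(x, y) \<in> E" "(x, z) \<in> E" "y \<in> b n" "z \<in> b n" for x y z n
  proof (rule ccontr)
    note xyz = that
    assume "y \<noteq> z"
    from b(5)[OF xyz(4,5) this] obtain p r where pr: "y \<in> b p" "z \<in> b r" "b p \<inter> b r = {}" "b p \<subseteq> b n" "b r \<subseteq> b n"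
      by blast
    then have "x \<in> D p" "x \<in> D r" using xyz D_iff by blast+
    moreover have "x \<in> X" using xyz(1) by (simp add: single_def)
    moreover have "(p, r) \<in> sep n" using pr by (simp add: sep_def)
    ultimately show False using xyz(1) unfolding single_def by blast
  qed
  have single_ex: "\<exists>y. (x, y) \<in> E \<and> y \<in> b n" if "x \<in> single n" for x n
    using that D_iff by (auto simp: single_def)
  \<comment> \<open>The identity off \<open>single n\<close> is a default value that keeps
    \<open>f n\<close> a total map of the space.\<close>
  define f where "f n x = (if x \<in> single n then THE y. (x, y) \<in> E \<and> y \<in> b n else x)" for n x
  have f: "(x, f n x) \<in> E" "f n x \<in> b n" if "x \<in> single n" for x n
  proof -
    have "\<exists>!y. (x, y) \<in> E \<and> y \<in> b n" using single_ex[OF that] single_unique[OF that] by blast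
    from theI'[OF this] show "(x, f n x) \<in> E" "f n x \<in> b n" using that by (simp_all add: f_def)
  qed
  have f_meas: "f n \<in> \<nu> \<rightarrow>\<^sub>M \<nu>" for n
  proof (rule measurable_sigma_sets[OF b(2)])
    show "range b \<subseteq> Pow (space \<nu>)" using b(1) sets.sets_into_space by blast
    show "f n \<in> space \<nu> \<rightarrow> space \<nu>"
      using f(1) edges_subset by (auto simp: f_def split: if_splits) (metis f_def mem_Sigma_iff subsetD)
    fix B assume "B \<in> range b"
    then obtain m where B: "B = b m" by blast
    \<comment> \<open>On \<open>single n\<close> the selected neighbour lies in \<open>b m\<close>
      iff some base set inside \<open>b n \<inter> b m\<close> contains a neighbour.\<close>
    have "f n -` B \<inter> space \<nu> = (b m - single n) \<union> (single n \<inter> (\<Union>p\<in>{p. b p \<subseteq> b n \<inter> b m}. X \<inter> D p))"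
      (is "?L = ?R")
    proof (intro set_eqI iffI)
      fix x assume x: "x \<in> ?L"
      show "x \<in> ?R"
      proof (cases "x \<in> single n")
        case True
        then have "f n x \<in> b n \<inter> b m" using f(2) x B by blast
        then obtain p where p: "f n x \<in> b p" "b p \<subseteq> b n \<inter> b m" using b(4) by blast
        moreover have "x \<in> D p" using D_iff p(1) f(1)[OF True] by blast
        moreover have "x \<in> X" using True by (simp add: single_def)
        ultimately show ?thesis using True by blast
      qed (use x B in \<open>simp add: f_def\<close>)
    next
      fix x assume x: "x \<in> ?R"
      show "x \<in> ?L"
      proof (cases "x \<in> single n")
        case True
        then obtain p where p: "b p \<subseteq> b n \<inter> b m" "x \<in> D p" using x by blast
        then obtain y where y: "y \<in> b p" "(x, y) \<in> E" using D_iff by blast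
        then have "f n x = y" using single_unique[OF True f(1)[OF True] y(2) f(2)[OF True]] p(1) by blast
        moreover have "x \<in> space \<nu>" using y(2) edges_subset by blast
        ultimately show ?thesis using y(1) p(1) B by blast
      next
        case False
        then show ?thesis using x B sets.sets_into_space[OF b(1)[of m]] by (auto simp: f_def)
      qed
    qed
    also have "\<dots> \<in> sets \<nu>"
      using b(1) single_sets DX by (intro sets.Un sets.Int sets.Diff sets.countable_UN') auto
    finally show "f n -` B \<inter> space \<nu> \<in> sets \<nu>" .
  qed
  define G where "G n = E \<inter> single n \<times> b n" for n
  have G_f: "y = f n x" "x \<in> single n" if "(x, y) \<in> G n" for x y n
    using that single_unique[of x n y "f n x"] f[of x n] by (auto simp: G_def)
  have G_UN: "(\<Union>n. G n) = E \<inter> X \<times> space \<nu>"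
  proof (intro equalityI subsetI)
    fix e assume "e \<in> (\<Union>n. G n)"
    then show "e \<in> E \<inter> X \<times> space \<nu>" using edges_subset by (auto simp: G_def single_def)
  next
    fix e assume e: "e \<in> E \<inter> X \<times> space \<nu>"
    obtain x y where xy: "e = (x, y)" "(x, y) \<in> E" "x \<in> X" "y \<in> space \<nu>" using e by auto
    obtain n where n: "y \<in> b n" "b n \<inter> (E `` {x} - {y}) = {}"
      using b(3)[OF xy(4), of "E `` {x} - {y}"] finite_section by blast
    have "x \<in> single n"
      using n xy D_iff unfolding single_def sep_def by blast
    then show "e \<in> (\<Union>n. G n)" using xy n by (auto simp: G_def)
  qed
  show ?thesis
  proof (rule that[of N G, OF N(1,3)])
    show "G n \<in> sets (\<nu> \<Otimes>\<^sub>M \<nu>)" for n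
      unfolding G_def using edges_borel single_sets b(1) by (intro sets.Int pair_measureI) auto
    show "single_valued (G n)" for n
      unfolding single_valued_def using G_f(1)[of _ _ n] by metis
    show "(\<Union>n. G n) = E \<inter> (space \<nu> - N) \<times> space \<nu>" using G_UN by (simp add: X_def)
    fix C assume C: "C \<in> sets (\<nu> \<Otimes>\<^sub>M \<nu>)" "C \<subseteq> E \<inter> (space \<nu> - N) \<times> space \<nu>"
    \<comment> \<open>The graphs of the \<open>f n\<close> cover the edges over \<open>X\<close>, so
      projecting \<open>C\<close> amounts to countably many preimages under measurable maps.\<close>
    have "Domain C = (\<Union>n. single n \<inter> ((\<lambda>x. (x, f n x)) -` C \<inter> space \<nu>))"
    proof (intro equalityI subsetI)
      fix x assume "x \<in> Domain C"
      then obtain y where y: "(x, y) \<in> C" by blast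
      then have "(x, y) \<in> E \<inter> X \<times> space \<nu>" using C(2) unfolding X_def by blast
      then obtain n where "(x, y) \<in> G n" unfolding G_UN[symmetric] by blast
      then have "y = f n x" "x \<in> single n" using G_f by blast+
      moreover have "x \<in> space \<nu>" using \<open>(x, y) \<in> E \<inter> X \<times> space \<nu>\<close> by (simp add: X_def)
      ultimately have "x \<in> single n \<inter> ((\<lambda>x. (x, f n x)) -` C \<inter> space \<nu>)" using y by simp
      then show "x \<in> (\<Union>n. single n \<inter> ((\<lambda>x. (x, f n x)) -` C \<inter> space \<nu>))" by blast
    qed auto
    also have "\<dots> \<in> sets \<nu>"
    proof (rule sets.countable_nat_UN, rule image_subsetI, rule sets.Int[OF single_sets])
      fix n :: nat
      have "(\<lambda>x. (x, f n x)) \<in> \<nu> \<rightarrow>\<^sub>M \<nu> \<Otimes>\<^sub>M \<nu>" using f_meas by (intro measurable_Pair) auto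
      then show "(\<lambda>x. (x, f n x)) -` C \<inter> space \<nu> \<in> sets \<nu>" using C(1) by (rule measurable_sets)
    qed
    finally show "Domain C \<in> sets \<nu>" .
  qed
qed

end

section \<open>Alternating chains and Koenig's edge coloring theorem\<close>

text \<open>Color 0 stands for \<open>uncolored\<close>, also off \<open>E\<close>; the true colors are \<open>1, \<dots>, K\<close>.\<close>

definition partial_coloring :: "('a \<times> 'a) set \<Rightarrow> nat \<Rightarrow> ('a \<times> 'a \<Rightarrow> nat) \<Rightarrow> bool" where
  "partial_coloring E K c \<longleftrightarrow> (\<forall>e. c e \<le> K) \<and> (\<forall>e. c e \<noteq> 0 \<longrightarrow> e \<in> E) \<and>
     (\<forall>x y. c (x, y) = c (y, x)) \<and> (\<forall>x y z. c (x, y) = c (x, z) \<and> c (x, y) \<noteq> 0 \<longrightarrow> y = z)"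

definition missing :: "('a \<times> 'a \<Rightarrow> nat) \<Rightarrow> nat \<Rightarrow> 'a \<Rightarrow> bool" where
  "missing c a x \<longleftrightarrow> (\<forall>y. c (x, y) \<noteq> a)"

text \<open>Fixing the vertices that miss \<open>a\<close> makes \<open>cnbr c a\<close> an involution.\<close>

definition cnbr :: "('a \<times> 'a \<Rightarrow> nat) \<Rightarrow> nat \<Rightarrow> 'a \<Rightarrow> 'a" where
  "cnbr c a x = (if missing c a x then x else SOME y. c (x, y) = a)"

primrec chain :: "('a \<times> 'a \<Rightarrow> nat) \<Rightarrow> nat \<Rightarrow> nat \<Rightarrow> nat \<Rightarrow> 'a \<Rightarrow> 'a" where
  "chain c a b 0 x = x"
| "chain c a b (Suc k) x = cnbr c (if even k then a else b) (chain c a b k x)"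

text \<open>A chain that reaches an endpoint turns around; \<open>run c a b k x\<close> says that the first \<open>k\<close> steps
  are proper ones.\<close>

definition run :: "('a \<times> 'a \<Rightarrow> nat) \<Rightarrow> nat \<Rightarrow> nat \<Rightarrow> nat \<Rightarrow> 'a \<Rightarrow> bool" where
  "run c a b k x \<longleftrightarrow> (\<forall>j<k. chain c a b (Suc j) x \<noteq> chain c a b j x)"

definition kempe_set :: "('a \<times> 'a \<Rightarrow> nat) \<Rightarrow> nat \<Rightarrow> nat \<Rightarrow> 'a set \<Rightarrow> 'a set" where
  "kempe_set c a b Q = {chain c a b j y |j y. y \<in> Q \<and> run c a b j y}"

text \<open>Testing \<open>fst e\<close> alone is enough in the intended use: \<open>Z\<close> is
  closed under \<open>cnbr c a\<close> and \<open>cnbr c b\<close>, so an edge of color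
  \<open>a\<close> or \<open>b\<close> has both ends in \<open>Z\<close> or none. The edges of
  \<open>M\<close>, in contrast, cross between \<open>Z\<close> and its complement.\<close>

definition kempe :: "('a \<times> 'a \<Rightarrow> nat) \<Rightarrow> nat \<Rightarrow> nat \<Rightarrow> 'a set \<Rightarrow> ('a \<times> 'a) set \<Rightarrow> 'a \<times> 'a \<Rightarrow> nat" where
  "kempe c a b Z M e = (if e \<in> M then a
     else if fst e \<in> Z then (if c e = a then b else if c e = b then a else c e) else c e)"

text \<open>The \<open>S\<close>-ends of \<open>M\<close> are to miss \<open>b\<close> and the other
  ends \<open>a\<close>. Swapping along the chains from the \<open>S\<close>-ends makes these miss
  \<open>a\<close> as well, so that \<open>M\<close> can take color \<open>a\<close>.\<close>

definition augment :: "('a \<times> 'a \<Rightarrow> nat) \<Rightarrow> nat \<Rightarrow> nat \<Rightarrow> 'a set \<Rightarrow> ('a \<times> 'a) set \<Rightarrow> 'a \<times> 'a \<Rightarrow> nat" where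
  "augment c a b S M = kempe c a b (kempe_set c a b (Domain M \<inter> S)) M"

lemma run_0 [simp]: "run c a b 0 x"
  by (simp add: run_def)

lemma run_Suc: "run c a b (Suc k) x \<longleftrightarrow> run c a b k x \<and> chain c a b (Suc k) x \<noteq> chain c a b k x"
  unfolding run_def less_Suc_eq by blast

lemma run_mono: "run c a b k x \<Longrightarrow> j \<le> k \<Longrightarrow> run c a b j x"
  by (simp add: run_def)

locale sided_graph =
  fixes E :: "('a \<times> 'a) set" and S :: "'a set"
  assumes symE: "sym E"
    and side: "(x, y) \<in> E \<Longrightarrow> x \<in> S \<longleftrightarrow> y \<notin> S"
begin

context
  fixes K :: nat and c :: "'a \<times> 'a \<Rightarrow> nat"
  assumes pc: "partial_coloring E K c"
begin

lemma color_le: "c e \<le> K"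
  using pc[unfolded partial_coloring_def, THEN conjunct1] by (rule spec)

lemma color_edge: "c (x, y) \<noteq> 0 \<Longrightarrow> (x, y) \<in> E"
  by (rule pc[unfolded partial_coloring_def, THEN conjunct2, THEN conjunct1, rule_format])

lemma color_sym: "c (x, y) = c (y, x)"
  by (rule pc[unfolded partial_coloring_def, THEN conjunct2, THEN conjunct2, THEN conjunct1, rule_format])

lemma color_unique: "c (x, y) = c (x, z) \<Longrightarrow> c (x, y) \<noteq> 0 \<Longrightarrow> y = z"
  by (rule pc[unfolded partial_coloring_def, THEN conjunct2, THEN conjunct2, THEN conjunct2, rule_format, of x])
    (rule conjI)

lemma color_side: "c (x, y) \<noteq> 0 \<Longrightarrow> x \<in> S \<longleftrightarrow> y \<notin> S"
  by (rule side[OF color_edge])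

lemma cnbr_missing: "missing c a x \<Longrightarrow> cnbr c a x = x"
  by (simp add: cnbr_def)

lemma color_cnbr: "\<not> missing c a x \<Longrightarrow> c (x, cnbr c a x) = a"
proof -
  assume m: "\<not> missing c a x"
  then have "\<exists>y. c (x, y) = a" by (simp add: missing_def)
  from someI_ex[OF this] show ?thesis using m by (simp only: cnbr_def if_False)
qed

lemma cnbr_eq:
  assumes "c (x, y) = a" "a \<noteq> 0"
  shows "cnbr c a x = y"
proof -
  have "\<not> missing c a x" using assms by (auto simp: missing_def)
  then have "c (x, cnbr c a x) = a" by (rule color_cnbr)
  then show ?thesis using color_unique[of x "cnbr c a x" y] assms by metis
qed

lemma cnbr_fixed_iff:
  assumes "a \<noteq> 0"
  shows "cnbr c a x = x \<longleftrightarrow> missing c a x"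
proof
  assume *: "cnbr c a x = x"
  show "missing c a x"
  proof (rule ccontr)
    assume "\<not> missing c a x"
    then have "c (x, x) \<noteq> 0" using color_cnbr[of a x] * assms by metis
    from color_side[OF this] show False by simp
  qed
qed (rule cnbr_missing)

lemma cnbr_cnbr:
  assumes "a \<noteq> 0"
  shows "cnbr c a (cnbr c a x) = x"
proof (cases "missing c a x")
  case False
  then have "c (x, cnbr c a x) = a" by (rule color_cnbr)
  then have "c (cnbr c a x, x) = a" using color_sym[of x "cnbr c a x"] by metis
  then show ?thesis using assms by (rule cnbr_eq)
qed (simp add: cnbr_missing)

lemma cnbr_inj: "a \<noteq> 0 \<Longrightarrow> cnbr c a x = cnbr c a y \<Longrightarrow> x = y"
  by (metis cnbr_cnbr)

lemma chain_side:
  assumes "a \<noteq> 0" "b \<noteq> 0"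
  shows "run c a b k x \<Longrightarrow> chain c a b k x \<in> S \<longleftrightarrow> (x \<in> S \<longleftrightarrow> even k)"
proof (induction k)
  case (Suc k)
  let ?t = "if even k then a else b"
  have t: "?t \<noteq> 0" using assms by simp
  have "cnbr c ?t (chain c a b k x) \<noteq> chain c a b k x" using Suc.prems by (simp add: run_Suc)
  then have "\<not> missing c ?t (chain c a b k x)" using cnbr_missing by blast
  then have "c (chain c a b k x, chain c a b (Suc k) x) = ?t" using color_cnbr by simp
  then have "chain c a b k x \<in> S \<longleftrightarrow> chain c a b (Suc k) x \<notin> S" using t color_side by metis
  then show ?case using Suc by (auto simp: run_Suc)
qed simp

text \<open>In a bipartite graph two starting points on the same side never share a chain: running
  backwards along the shorter one, the longer one would have stopped.\<close>

lemma chain_inj: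
  assumes ab: "a \<noteq> 0" "b \<noteq> 0" and m: "missing c b x" "missing c b x'" and s: "x \<in> S \<longleftrightarrow> x' \<in> S"
  shows "run c a b i x \<Longrightarrow> run c a b j x' \<Longrightarrow> chain c a b i x = chain c a b j x' \<Longrightarrow> i = j \<and> x = x'"
proof (induction i arbitrary: j)
  case 0
  show ?case
  proof (cases j)
    case (Suc k)
    have "x = chain c a b j x'" using 0(3) by simp
    then have "x \<in> S \<longleftrightarrow> (x' \<in> S \<longleftrightarrow> even j)" using chain_side[OF ab 0(2)] by metis
    then have "even j" using s by blast
    then have "x = cnbr c b (chain c a b k x')" using 0(3) Suc by simp
    then have "chain c a b k x' = x" using cnbr_cnbr[OF ab(2)] m(1) cnbr_missing by metis
    moreover have "chain c a b (Suc k) x' = x" using 0(3) Suc by simp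
    ultimately have False using 0(2) Suc by (simp add: run_Suc)
    then show ?thesis ..
  qed (use 0 in simp)
next
  case (Suc i)
  have par: "even (Suc i) \<longleftrightarrow> even j"
    using chain_side[OF ab Suc.prems(1)] chain_side[OF ab Suc.prems(2)] Suc.prems(3) s by metis
  show ?case
  proof (cases j)
    case 0
    then have "odd i" using par by simp
    then have "x' = cnbr c b (chain c a b i x)" using Suc.prems(3) 0 by simp
    then have "chain c a b i x = x'" using cnbr_cnbr[OF ab(2)] m(2) cnbr_missing by metis
    moreover have "chain c a b (Suc i) x = x'" using Suc.prems(3) 0 by simp
    ultimately have False using Suc.prems(1) by (simp add: run_Suc)
    then show ?thesis ..
  next
    case (Suc l)
    let ?t = "if even i then a else b"
    have "cnbr c ?t (chain c a b i x) = cnbr c ?t (chain c a b l x')"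
      using Suc.prems(3) Suc par by simp
    then have "chain c a b i x = chain c a b l x'" using cnbr_inj ab by (metis (full_types))
    then have "i = l \<and> x = x'" using Suc.IH[of l] Suc.prems Suc by (auto simp: run_Suc)
    then show ?thesis using Suc by simp
  qed
qed

text \<open>From a vertex of a chain one of the colors leads onward, or fixes the last vertex, and
  the other leads back; at the start the latter is \<open>b\<close>, which is missing there.\<close>

lemma kempe_set_closed:
  assumes ab: "a \<noteq> 0" "b \<noteq> 0" and m: "\<And>y. y \<in> Q \<Longrightarrow> missing c b y" and v: "v \<in> kempe_set c a b Q"
  shows "cnbr c a v \<in> kempe_set c a b Q" "cnbr c b v \<in> kempe_set c a b Q"
proof -
  obtain j y where j: "v = chain c a b j y" "y \<in> Q" "run c a b j y"
    using v unfolding kempe_set_def by (elim CollectE exE conjE) (rule that)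
  let ?t = "if even j then a else b" and ?u = "if even j then b else a"
  have nxt: "cnbr c ?t v = chain c a b (Suc j) y" unfolding j(1) by simp
  then have "cnbr c ?t v = v \<or> run c a b (Suc j) y" using j(3) unfolding run_Suc j(1) by metis
  moreover have "cnbr c ?t v \<in> kempe_set c a b Q" if "run c a b (Suc j) y"
    unfolding nxt kempe_set_def using that j(2) by blast
  ultimately have next_mem: "cnbr c ?t v \<in> kempe_set c a b Q" using v by metis
  have prev_mem: "cnbr c ?u v \<in> kempe_set c a b Q"
  proof (cases j)
    case 0
    then have "v = y" "?u = b" using j(1) by simp_all
    then show ?thesis using cnbr_missing[OF m[OF j(2)]] v by simp
  next
    case (Suc k)
    have "v = cnbr c ?u (chain c a b k y)" unfolding j(1) Suc by simp
    moreover have "?u \<noteq> 0" using ab by simp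
    ultimately have *: "cnbr c ?u v = chain c a b k y" using cnbr_cnbr by metis
    have "run c a b k y" using j(3) Suc by (simp add: run_Suc)
    then show ?thesis unfolding * kempe_set_def using j(2) by blast
  qed
  show "cnbr c a v \<in> kempe_set c a b Q" "cnbr c b v \<in> kempe_set c a b Q"
    using next_mem prev_mem by (cases "even j"; simp)+
qed

text \<open>By parity a chain starting on the opposite side can enter \<open>x\<close> only along an
  edge of color \<open>a\<close>, which \<open>x\<close> misses. In an odd cycle the swap could
  instead run into the other end of the edge to be colored.\<close>

lemma notin_kempe_set:
  assumes ab: "a \<noteq> 0" "b \<noteq> 0" and s: "\<And>y. y \<in> Q \<Longrightarrow> y \<in> S \<longleftrightarrow> x \<notin> S" and m: "missing c a x"
  shows "x \<notin> kempe_set c a b Q"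
proof
  assume "x \<in> kempe_set c a b Q"
  then obtain j y where j: "x = chain c a b j y" "y \<in> Q" "run c a b j y"
    unfolding kempe_set_def by (elim CollectE exE conjE) (rule that)
  have "odd j" using chain_side[OF ab j(3)] s[OF j(2)] unfolding j(1)[symmetric] by blast
  then obtain k where k: "j = Suc k" "even k" by (metis oddE even_Suc Suc_eq_plus1)
  then have "x = cnbr c a (chain c a b k y)" unfolding j(1) k(1) by simp
  then have "chain c a b k y = x" using cnbr_cnbr[OF ab(1)] m cnbr_missing by metis
  then show False using j k by (simp add: run_Suc)
qed

lemma kempe_partial_coloring:
  assumes a: "a \<noteq> 0" "a \<le> K" and b: "b \<noteq> 0" "b \<le> K"
    and Z: "\<And>v. v \<in> Z \<Longrightarrow> cnbr c a v \<in> Z" "\<And>v. v \<in> Z \<Longrightarrow> cnbr c b v \<in> Z"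
    and M: "M \<subseteq> E" "sym M" "single_valued M" "\<And>e. e \<in> M \<Longrightarrow> c e = 0"
    and MZ: "\<And>x y. (x, y) \<in> M \<Longrightarrow> x \<in> Z \<Longrightarrow> y \<notin> Z \<and> missing c b x"
      "\<And>x y. (x, y) \<in> M \<Longrightarrow> x \<notin> Z \<Longrightarrow> missing c a x"
  shows "partial_coloring E K (kempe c a b Z M)"
proof -
  have Z_edge: "x \<in> Z \<longleftrightarrow> y \<in> Z" if "c (x, y) = a \<or> c (x, y) = b" for x y
  proof -
    have "c (x, y) \<noteq> 0" using that a b by metis
    then have "cnbr c (c (x, y)) x = y" "cnbr c (c (x, y)) y = x"
      using cnbr_eq[of x y "c (x, y)"] cnbr_eq[of y x "c (x, y)"] color_sym[of y x] by simp_all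
    then show ?thesis using that Z by metis
  qed
  have M_new: False if xy: "(x, y) \<in> M" and z: "(x, z) \<notin> M" and col: "kempe c a b Z M (x, z) = a" for x y z
  proof (cases "x \<in> Z")
    case True
    then have "missing c b x" using MZ(1)[OF xy] by blast
    then have "c (x, z) \<noteq> b" by (simp add: missing_def)
    then show ?thesis using col True z by (auto simp: kempe_def split: if_splits)
  next
    case False
    then have "missing c a x" using MZ(2)[OF xy] by blast
    then show ?thesis using col False z by (auto simp: kempe_def missing_def)
  qed
  show ?thesis
    unfolding partial_coloring_def
  proof (intro conjI allI impI)
    fix e show "kempe c a b Z M e \<le> K" using a b color_le by (simp add: kempe_def)
  next
    fix e assume "kempe c a b Z M e \<noteq> 0"
    then show "e \<in> E" using M(1) a b color_edge by (cases e) (auto simp: kempe_def split: if_splits)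
  next
    fix x y
    have "(x, y) \<in> M \<longleftrightarrow> (y, x) \<in> M" using M(2) by (auto dest: symD)
    then show "kempe c a b Z M (x, y) = kempe c a b Z M (y, x)"
      using Z_edge[of x y] color_sym[of x y] by (auto simp: kempe_def)
  next
    fix x y z assume *: "kempe c a b Z M (x, y) = kempe c a b Z M (x, z) \<and> kempe c a b Z M (x, y) \<noteq> 0"
    consider "(x, y) \<in> M" "(x, z) \<in> M" | "(x, y) \<in> M" "(x, z) \<notin> M" | "(x, y) \<notin> M" "(x, z) \<in> M"
      | "(x, y) \<notin> M" "(x, z) \<notin> M" by blast
    then show "y = z"
    proof cases
      case 1
      then show ?thesis using M(3) by (simp add: single_valued_def)
    next
      case 2
      then have "kempe c a b Z M (x, z) = a" using * by (simp add: kempe_def)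
      then show ?thesis using M_new 2 by blast
    next
      case 3
      then have "kempe c a b Z M (x, y) = a" using * by (simp add: kempe_def)
      then show ?thesis using M_new 3 by blast
    next
      case 4
      then have "c (x, y) = c (x, z)" "c (x, y) \<noteq> 0"
        using * a b by (auto simp: kempe_def split: if_splits)
      then show ?thesis by (rule color_unique)
    qed
  qed
qed

lemma kempe_eq_0_iff:
  "a \<noteq> 0 \<Longrightarrow> b \<noteq> 0 \<Longrightarrow> kempe c a b Z M e = 0 \<longleftrightarrow> c e = 0 \<and> e \<notin> M"
  by (simp add: kempe_def)

lemma augment_partial_coloring:
  assumes a: "a \<noteq> 0" "a \<le> K" and b: "b \<noteq> 0" "b \<le> K"
    and M: "M \<subseteq> E" "sym M" "single_valued M" "\<And>e. e \<in> M \<Longrightarrow> c e = 0"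
    and miss: "\<And>y x. (y, x) \<in> M \<Longrightarrow> y \<in> S \<Longrightarrow> missing c b y \<and> missing c a x"
  shows "partial_coloring E K (augment c a b S M)"
    "\<And>e. augment c a b S M e = 0 \<longleftrightarrow> c e = 0 \<and> e \<notin> M"
proof -
  let ?Q = "Domain M \<inter> S"
  let ?Z = "kempe_set c a b ?Q"
  have Qb: "missing c b y" if "y \<in> ?Q" for y using that miss by blast
  have in_Z: "y \<in> ?Z" if "(y, x) \<in> M" "y \<in> S" for x y
    unfolding kempe_set_def using that by (intro CollectI exI[of _ 0] exI[of _ y]) auto
  have notin_Z: "x \<notin> ?Z" if "(y, x) \<in> M" "y \<in> S" for x y
  proof (rule notin_kempe_set[OF a(1) b(1)])
    have "x \<notin> S" using that M(1) side by blast
    then show "z \<in> S \<longleftrightarrow> x \<notin> S" if "z \<in> ?Q" for z using that by blast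
    show "missing c a x" using miss that by blast
  qed
  have flip: "(y, x) \<in> M" if "(x, y) \<in> M" for x y using that M(2) by (rule symD[rotated])
  have sides: "x \<in> S \<longleftrightarrow> y \<notin> S" if "(x, y) \<in> M" for x y using that M(1) side by blast
  show "partial_coloring E K (augment c a b S M)"
    unfolding augment_def
  proof (rule kempe_partial_coloring[OF a b _ _ M])
    show "cnbr c a v \<in> ?Z" "cnbr c b v \<in> ?Z" if "v \<in> ?Z" for v
      using kempe_set_closed[OF a(1) b(1) Qb that] by blast+
  next
    fix x y assume xy: "(x, y) \<in> M" "x \<in> ?Z"
    have "x \<in> S" using notin_Z[OF flip[OF xy(1)]] xy sides by blast
    then show "y \<notin> ?Z \<and> missing c b x" using notin_Z[OF xy(1)] miss xy(1) by blast
  next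
    fix x y assume xy: "(x, y) \<in> M" "x \<notin> ?Z"
    have "x \<notin> S" using in_Z[OF xy(1)] xy by blast
    then have "y \<in> S" using sides xy(1) by blast
    then show "missing c a x" using miss flip[OF xy(1)] by blast
  qed
  show "augment c a b S M e = 0 \<longleftrightarrow> c e = 0 \<and> e \<notin> M" for e
    unfolding augment_def using a(1) b(1) by (rule kempe_eq_0_iff)
qed

text \<open>Pigeonhole in two situations: with \<open>d + 1\<close> colors every vertex misses one,
  with \<open>d\<close> colors the ends of an uncolored edge do.\<close>

lemma ex_missing:
  assumes fin: "finite (E `` {x})"
    and deg: "card (E `` {x}) < K \<or> card (E `` {x}) \<le> K \<and> (\<exists>y. (x, y) \<in> E \<and> c (x, y) = 0)"
  shows "\<exists>a. a \<noteq> 0 \<and> a \<le> K \<and> missing c a x"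
proof (rule ccontr)
  assume "\<not> ?thesis"
  then have "{1..K} \<subseteq> (\<lambda>y. c (x, y)) ` {y \<in> E `` {x}. c (x, y) \<noteq> 0}"
    using color_edge unfolding missing_def by force
  then have "K \<le> card {y \<in> E `` {x}. c (x, y) \<noteq> 0}"
    using surj_card_le[OF finite_subset[OF _ fin], of "{y \<in> E `` {x}. c (x, y) \<noteq> 0}" "{1..K}" "\<lambda>y. c (x, y)"]
    by auto
  moreover have "card {y \<in> E `` {x}. c (x, y) \<noteq> 0} \<le> card (E `` {x})"
    using fin by (intro card_mono) auto
  moreover have "card {y \<in> E `` {x}. c (x, y) \<noteq> 0} < card (E `` {x})" if "(x, y) \<in> E" "c (x, y) = 0" for y
    by (rule psubset_card_mono[OF fin]) (use that in blast)
  ultimately show False using deg by force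
qed

end

section \<open>Koenig's theorem, for finite graphs and by compactness for infinite ones\<close>

lemma partial_coloring_total_finite:
  assumes "finite E" and deg: "\<And>x. card (E `` {x}) \<le> d"
  shows "\<exists>c. partial_coloring E d c \<and> (\<forall>e\<in>E. c e \<noteq> 0)"
proof -
  let ?u = "\<lambda>c. card {e \<in> E. c e = (0::nat)}"
  have "partial_coloring E d (\<lambda>_. 0)" by (simp add: partial_coloring_def)
  \<comment> \<open>A coloring with the fewest uncolored edges; if one were left, augmenting along
    that single edge would beat it.\<close>
  then obtain c where c: "partial_coloring E d c" "\<And>c'. partial_coloring E d c' \<Longrightarrow> ?u c \<le> ?u c'"
    using ex_has_least_nat[of "partial_coloring E d" "\<lambda>_. 0" ?u] by blast
  have "c e \<noteq> 0" if "e \<in> E" for e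
  proof
    assume "c e = 0"
    obtain y x where yx: "(y, x) \<in> E" "c (y, x) = 0" "y \<in> S"
    proof (cases e)
      case (Pair y x)
      then show ?thesis using that[of y x] that[of x y] \<open>e \<in> E\<close> \<open>c e = 0\<close> symE side color_sym[OF c(1)]
        by (metis symD)
    qed
    have xy: "(x, y) \<in> E" "c (x, y) = 0" using yx symE color_sym[OF c(1)] by (auto dest: symD)
    have fin: "finite (E `` {z})" for z using \<open>finite E\<close> by (rule finite_Image)
    obtain b where b: "b \<noteq> 0" "b \<le> d" "missing c b y" using ex_missing[OF c(1) fin] deg yx by blast
    obtain a where a: "a \<noteq> 0" "a \<le> d" "missing c a x" using ex_missing[OF c(1) fin] deg xy by blast
    let ?M = "{(y, x), (x, y)}"
    have "x \<notin> S" using side yx by blast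
    then have "x \<noteq> y" using yx(3) by blast
    have M: "?M \<subseteq> E" "sym ?M" "single_valued ?M" "\<And>e. e \<in> ?M \<Longrightarrow> c e = 0"
      using yx xy \<open>x \<noteq> y\<close> by (auto simp: sym_def single_valued_def)
    have miss: "missing c b v \<and> missing c a w" if "(v, w) \<in> ?M" "v \<in> S" for v w
      using that \<open>x \<notin> S\<close> a b by auto
    have aug: "partial_coloring E d (augment c a b S ?M)"
      by (rule augment_partial_coloring(1)[OF c(1) a(1,2) b(1,2) M miss])
    have aug0: "augment c a b S ?M e = 0 \<longleftrightarrow> c e = 0 \<and> e \<notin> ?M" for e
      by (rule augment_partial_coloring(2)[OF c(1) a(1,2) b(1,2) M miss])
    have "{e \<in> E. augment c a b S ?M e = 0} \<subset> {e \<in> E. c e = 0}"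
      using yx(1,2) by (auto simp only: aug0)
    then have "?u (augment c a b S ?M) < ?u c" using \<open>finite E\<close> by (intro psubset_card_mono) auto
    then show False using c(2)[OF aug] by simp
  qed
  then show ?thesis using c(1) by blast
qed

end

text \<open>Tychonoff: being proper is a family of conditions on two edges each, closed in a product
  of finite discrete spaces. Finitely many of them concern a finite subgraph and can be met
  together.\<close>

lemma konig_edge_coloring:
  fixes E :: "('a \<times> 'a) set"
  assumes "sided_graph E S" and deg: "\<And>x. finite (E `` {x})" "\<And>x. card (E `` {x}) \<le> d"
  shows "\<exists>f. proper_edge_coloring E {1..d} f"
proof -
  interpret sided_graph E S by fact
  define X where "X = product_topology (\<lambda>e::'a \<times> 'a. discrete_topology {1..d}) E"
  define ok where "ok e e' i j \<longleftrightarrow> (e' = prod.swap e \<longrightarrow> i = j) \<and>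
      (fst e = fst e' \<and> snd e \<noteq> snd e' \<longrightarrow> i \<noteq> j)" for e e' :: "'a \<times> 'a" and i j :: nat
  define C where "C p = {f \<in> topspace X. ok (fst p) (snd p) (f (fst p)) (f (snd p))}" for p
  have "compact_space X"
    unfolding X_def compact_space_product_topology by (simp add: compact_space_discrete_topology)
  have top: "topspace X = E \<rightarrow>\<^sub>E {1..d}" by (simp add: X_def)
  have closed: "closedin X (C p)" if "p \<in> E \<times> E" for p
  proof -
    obtain e e' where p: "p = (e, e')" "e \<in> E" "e' \<in> E" using \<open>p \<in> E \<times> E\<close> by auto
    have cl: "closedin X {f \<in> topspace X. f e = i}" if "e \<in> E" "i \<in> {1..d}" for e i
    proof -
      have "continuous_map X (discrete_topology {1..d}) (\<lambda>f. f e)"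
        unfolding X_def using that(1) by (rule continuous_map_product_projection)
      then have "closedin X {f \<in> topspace X. f e \<in> {i}}"
        using that(2) by (intro closedin_continuous_map_preimage) auto
      then show ?thesis by simp
    qed
    let ?R = "{(i, j) \<in> {1..d} \<times> {1..d}. ok e e' i j}"
    have "f e \<in> {1..d}" "f e' \<in> {1..d}" if "f \<in> topspace X" for f
      using that p(2,3) unfolding top by blast+
    then have "C p = (\<Union>(i, j)\<in>?R. {f \<in> topspace X. f e = i} \<inter> {f \<in> topspace X. f e' = j})"
      unfolding C_def p(1) fst_conv snd_conv by blast
    moreover have "finite ?R"
      by (rule finite_subset[of _ "{1..d} \<times> {1..d}"]) auto
    ultimately show ?thesis
      using p(2,3) by (auto intro!: closedin_Union closedin_Int cl)
  qed
  have fip: "\<Inter> \<F> \<noteq> {}" if F: "finite \<F>" "\<F> \<subseteq> C ` (E \<times> E)" for \<F>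
  proof -
    obtain P where P: "P \<subseteq> E \<times> E" "finite P" "\<F> = C ` P"
      using finite_subset_image[OF F] by blast
    define F0 where "F0 = fst ` P \<union> snd ` P"
    \<comment> \<open>Reversed edges are added to obtain a symmetric finite graph.\<close>
    define F where "F = F0 \<union> prod.swap ` F0"
    have "finite F" using P(2) by (simp add: F_def F0_def)
    have swE: "prod.swap e \<in> E" if "e \<in> E" for e using that symE by (cases e) (auto dest: symD)
    have "F0 \<subseteq> E" using P(1) by (force simp: F0_def)
    then have "F \<subseteq> E" using swE by (auto simp: F_def)
    have "prod.swap e \<in> F" if "e \<in> F" for e using that by (auto simp: F_def)
    then have "sym F" unfolding sym_def by (metis swap_simp)
    interpret F: sided_graph F S
    proof
      show "sym F" by fact
      show "x \<in> S \<longleftrightarrow> y \<notin> S" if "(x, y) \<in> F" for x y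
        by (rule side) (use that \<open>F \<subseteq> E\<close> in blast)
    qed
    have "card (F `` {x}) \<le> d" for x
      using card_mono[OF deg(1)[of x] Image_mono[OF \<open>F \<subseteq> E\<close> order_refl]] deg(2)[of x] by linarith
    then obtain c where c: "partial_coloring F d c" "\<forall>e\<in>F. c e \<noteq> 0"
      using F.partial_coloring_total_finite[OF \<open>finite F\<close>] by blast
    \<comment> \<open>Edges outside \<open>F\<close> get the arbitrary color 1, which is available
      since the presence of an edge forces \<open>1 \<le> d\<close>.\<close>
    define f where "f = (\<lambda>e\<in>E. if e \<in> F then c e else 1)"
    have "1 \<le> d" if "e \<in> E" for e
    proof -
      have "E `` {fst e} \<noteq> {}" using that by (cases e) auto
      then have "0 < card (E `` {fst e})" using deg(1) by (simp add: card_gt_0_iff)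
      then show ?thesis using deg(2)[of "fst e"] by linarith
    qed
    moreover have "c e \<in> {1..d}" if "e \<in> F" for e
      using c(2) that F.color_le[OF c(1), of e] by (simp add: Suc_le_eq)
    ultimately have "f \<in> topspace X" unfolding top f_def by auto
    moreover have "ok e e' (f e) (f e')" if "e \<in> F" "e' \<in> F" for e e'
    proof -
      obtain x y x' y' where e: "e = (x, y)" "e' = (x', y')" by (metis surj_pair)
      have f: "f e = c e" "f e' = c e'" using that \<open>F \<subseteq> E\<close> by (auto simp: f_def)
      have "c e \<noteq> 0" using c(2) that by blast
      then show ?thesis
        using F.color_sym[OF c(1), of x y] F.color_unique[OF c(1), of x y y']
        unfolding ok_def f unfolding e by auto
    qed
    moreover have "fst p \<in> F" "snd p \<in> F" if "p \<in> P" for p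
      using that by (auto simp: F_def F0_def)
    ultimately have "f \<in> C p" if "p \<in> P" for p
      using that unfolding C_def by blast
    then show ?thesis using P(3) by blast
  qed
  have "\<Inter> (C ` (E \<times> E)) \<noteq> {}"
    using \<open>compact_space X\<close> closed fip unfolding compact_space_fip by blast
  then obtain f where f: "\<And>e e'. e \<in> E \<Longrightarrow> e' \<in> E \<Longrightarrow> f \<in> C (e, e')" by blast
  have ok: "ok e e' (f e) (f e')" if "e \<in> E" "e' \<in> E" for e e' using f[OF that] by (simp add: C_def)
  have "f \<in> E \<rightarrow> {1..d}" using f unfolding C_def top by blast
  moreover have "f (x, y) = f (y, x)" if "(x, y) \<in> E" for x y
    using ok[OF that, of "(y, x)"] that symE by (auto simp: ok_def dest: symD)
  moreover have "f (x, y) \<noteq> f (x, z)" if "(x, y) \<in> E" "(x, z) \<in> E" "y \<noteq> z" for x y z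
    using ok[OF that(1,2)] that(3) by (simp add: ok_def)
  ultimately show ?thesis unfolding proper_edge_coloring_def by blast
qed

section \<open>The edge measure and measurable colorings\<close>

text \<open>What is left of a graphing when the edges at an invariant null set are deleted; the
  vertex space and \<open>\<nu>\<close> stay as they are. \<open>G\<close> and
  \<open>Domain_sets\<close> record the outcome of \<open>lusin_novikov_mod_null\<close>.\<close>

locale borel_graph = prob_space \<nu> + sided_graph E S
  for \<nu> :: "'a measure" and E :: "('a \<times> 'a) set" and S :: "'a set" +
  fixes d :: nat and G :: "nat \<Rightarrow> ('a \<times> 'a) set"
  assumes S_sets: "S \<in> sets \<nu>"
    and fin_deg: "finite (E `` {x})"
    and deg_le: "card (E `` {x}) \<le> d"
    and G_sets: "G n \<in> sets (\<nu> \<Otimes>\<^sub>M \<nu>)"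
    and G_sv: "single_valued (G n)"
    and G_UN: "(\<Union>n. G n) = E"
    and Domain_sets: "C \<in> sets (\<nu> \<Otimes>\<^sub>M \<nu>) \<Longrightarrow> C \<subseteq> E \<Longrightarrow> Domain C \<in> sets \<nu>"
    and mass_transport: "A \<in> sets \<nu> \<Longrightarrow> B \<in> sets \<nu> \<Longrightarrow>
       (\<integral>\<^sup>+x\<in>A. of_nat (deg E x B) \<partial>\<nu>) = (\<integral>\<^sup>+x\<in>B. of_nat (deg E x A) \<partial>\<nu>)"
begin

abbreviation P where "P \<equiv> \<nu> \<Otimes>\<^sub>M \<nu>"

lemma E_sets: "E \<in> sets P"
  unfolding G_UN[symmetric] using G_sets by (intro sets.countable_nat_UN) auto

lemma space_P: "space P = space \<nu> \<times> space \<nu>"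
  by (rule space_pair_measure)

lemma sets_P_subset: "C \<in> sets P \<Longrightarrow> C \<subseteq> space \<nu> \<times> space \<nu>"
  using sets.sets_into_space[of C P] space_P by simp

lemma E_subset: "E \<subseteq> space \<nu> \<times> space \<nu>"
  using E_sets by (rule sets_P_subset)

text \<open>Counting measure makes additivity in \<open>C\<close> immediate, and the intersection
  with \<open>E\<close> keeps the value finite, so a measure can be built on all of
  \<open>sets P\<close>.\<close>

definition section_count :: "('a \<times> 'a) set \<Rightarrow> 'a \<Rightarrow> ennreal" where
  "section_count C x = emeasure (count_space UNIV) ((C \<inter> E) `` {x})"

lemma section_count_eq: "C \<subseteq> E \<Longrightarrow> section_count C x = of_nat (card (C `` {x}))"
proof -
  assume "C \<subseteq> E"
  then have "finite (C `` {x})" using finite_subset[OF Image_mono[OF _ order_refl] fin_deg] by blast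
  then show ?thesis using \<open>C \<subseteq> E\<close> by (simp add: section_count_def Int_absorb2 emeasure_count_space)
qed

lemma section_count_UN:
  assumes "disjoint_family C"
  shows "section_count (\<Union>i::nat. C i) x = (\<Sum>i. section_count (C i) x)"
proof -
  have "disjoint_family (\<lambda>i. (C i \<inter> E) `` {x})"
    using assms unfolding disjoint_family_on_def by blast
  then have "(\<Sum>i. section_count (C i) x) = emeasure (count_space UNIV) (\<Union>i. (C i \<inter> E) `` {x})"
    unfolding section_count_def by (intro suminf_emeasure) auto
  also have "(\<Union>i. (C i \<inter> E) `` {x}) = ((\<Union>i. C i) \<inter> E) `` {x}" by blast
  finally show ?thesis by (simp add: section_count_def)
qed

lemma section_count_single_valued:
  assumes "C \<subseteq> E" "single_valued C"
  shows "section_count C x = indicator (Domain C) x"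
proof (cases "x \<in> Domain C")
  case True
  then obtain y where "(x, y) \<in> C" by blast
  then have "C `` {x} = {y}" using assms(2) by (auto simp: single_valued_def)
  then show ?thesis using True assms(1) by (simp add: section_count_eq)
next
  case False
  then have "C `` {x} = {}" by blast
  then show ?thesis using False assms(1) by (simp add: section_count_eq)
qed

text \<open>Cutting \<open>C\<close> along the disjointed \<open>G n\<close> leaves graphs of
  partial functions, whose section counts are indicators of their domains.\<close>

lemma section_count_measurable:
  assumes C: "C \<in> sets P"
  shows "section_count C \<in> borel_measurable \<nu>"
proof -
  define H where "H n = C \<inter> disjointed G n" for n
  have H_sub: "H n \<subseteq> E" for n using disjointed_subset[of G n] G_UN unfolding H_def by blast
  have "disjointed G n \<in> sets P" for n
    using sets.range_disjointed_sets[of G P] G_sets by blast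
  then have H_sets: "H n \<in> sets P" for n using C unfolding H_def by blast
  have sv: "single_valued (H n)" for n
    using single_valued_subset[OF _ G_sv] disjointed_subset[of G n] unfolding H_def by blast
  have "disjoint_family H"
    using disjoint_family_disjointed[of G] unfolding H_def disjoint_family_on_def by blast
  moreover have "(\<Union>n. H n) = C \<inter> E"
    unfolding H_def using UN_disjointed_eq[of G] G_UN by blast
  ultimately have "section_count (C \<inter> E) x = (\<Sum>n. section_count (H n) x)" for x
    using section_count_UN[of H x] by simp
  then have "section_count C x = (\<Sum>n. indicator (Domain (H n)) x)" for x
    using section_count_single_valued[OF H_sub sv] by (simp add: section_count_def Int_assoc)
  then have "section_count C = (\<lambda>x. \<Sum>n. indicator (Domain (H n)) x)" by blast
  moreover have "(\<lambda>x. \<Sum>n. indicator (Domain (H n)) x :: ennreal) \<in> borel_measurable \<nu>"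
    using Domain_sets[OF H_sets H_sub] by (intro borel_measurable_suminf_order) auto
  ultimately show ?thesis by simp
qed

text \<open>\<open>EM\<close> counts ordered pairs, so it is twice the edge measure.\<close>

definition EM :: "('a \<times> 'a) measure" where
  "EM = measure_of (space \<nu> \<times> space \<nu>) (sets P) (\<lambda>C. \<integral>\<^sup>+x. section_count C x \<partial>\<nu>)"

lemma sets_EM [simp]: "sets EM = sets P"
  unfolding EM_def using sets.sigma_algebra_axioms[of P] unfolding space_P
  by (rule sigma_algebra.sets_measure_of_eq)

lemma space_EM: "space EM = space \<nu> \<times> space \<nu>"
  using sets_eq_imp_space_eq[OF sets_EM] space_P by simp

lemma emeasure_EM:
  assumes C: "C \<in> sets P"
  shows "emeasure EM C = (\<integral>\<^sup>+x. section_count C x \<partial>\<nu>)"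
  unfolding EM_def
proof (rule emeasure_measure_of_sigma)
  show "sigma_algebra (space \<nu> \<times> space \<nu>) (sets P)"
    using sets.sigma_algebra_axioms[of P] unfolding space_P .
  show "positive (sets P) (\<lambda>C. \<integral>\<^sup>+x. section_count C x \<partial>\<nu>)"
    by (simp add: positive_def section_count_def)
  show "countably_additive (sets P) (\<lambda>C. \<integral>\<^sup>+x. section_count C x \<partial>\<nu>)"
  proof (rule countably_additiveI)
    fix F :: "nat \<Rightarrow> ('a \<times> 'a) set" assume F: "range F \<subseteq> sets P" "disjoint_family F"
    have "(\<Sum>i. \<integral>\<^sup>+x. section_count (F i) x \<partial>\<nu>) = (\<integral>\<^sup>+x. (\<Sum>i. section_count (F i) x) \<partial>\<nu>)"
      using F(1) section_count_measurable by (intro nn_integral_suminf[symmetric]) blast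
    also have "\<dots> = (\<integral>\<^sup>+x. section_count (\<Union>i. F i) x \<partial>\<nu>)"
      using section_count_UN[OF F(2)] by simp
    finally show "(\<Sum>i. \<integral>\<^sup>+x. section_count (F i) x \<partial>\<nu>) = (\<integral>\<^sup>+x. section_count (\<Union>i. F i) x \<partial>\<nu>)" .
  qed
  show "C \<in> sets P" by fact
qed

lemma emeasure_EM_edges:
  assumes "C \<in> sets P" "C \<subseteq> E"
  shows "emeasure EM C = (\<integral>\<^sup>+x. of_nat (deg C x UNIV) \<partial>\<nu>)"
  using assms by (simp add: emeasure_EM section_count_eq deg_def)

lemma section_count_le: "section_count C x \<le> of_nat d"
proof -
  have "section_count C x = of_nat (card ((C \<inter> E) `` {x}))"
    using section_count_eq[of "C \<inter> E" x] by (simp add: section_count_def Int_assoc)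
  also have "card ((C \<inter> E) `` {x}) \<le> card (E `` {x})"
    by (rule card_mono[OF fin_deg]) blast
  finally show ?thesis using deg_le[of x] by (meson of_nat_mono order_trans)
qed

lemma finite_EM: "finite_measure EM"
proof
  have "emeasure EM (space EM) \<le> (\<integral>\<^sup>+x. of_nat d \<partial>\<nu>)"
    unfolding space_EM space_P[symmetric] using section_count_le
    by (simp only: emeasure_EM[OF sets.top]) (rule nn_integral_mono)
  also have "\<dots> = of_nat d" by (simp add: emeasure_space_1)
  finally show "emeasure EM (space EM) \<noteq> \<infinity>" by (auto simp: top_unique)
qed

sublocale EM: finite_measure EM
  by (rule finite_EM)

lemma converse_sets:
  assumes "C \<in> sets P"
  shows "C\<inverse> \<in> sets P"
proof -
  have "C\<inverse> = (\<lambda>(x, y). (y, x)) -` C \<inter> space P"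
    using sets_P_subset[OF assms] unfolding space_P by auto
  then show ?thesis using sets_pair_swap[OF assms] by simp
qed

lemma emeasure_EM_rect:
  assumes "A \<in> sets \<nu>" "B \<in> sets \<nu>"
  shows "emeasure EM (A \<times> B) = (\<integral>\<^sup>+x\<in>A. of_nat (deg E x B) \<partial>\<nu>)"
proof -
  have "section_count (A \<times> B) x = of_nat (deg E x B) * indicator A x" for x
  proof -
    have "section_count (A \<times> B) x = section_count (A \<times> B \<inter> E) x" by (simp add: section_count_def)
    also have "\<dots> = of_nat (card ((A \<times> B \<inter> E) `` {x}))" by (rule section_count_eq) simp
    also have "(A \<times> B \<inter> E) `` {x} = (if x \<in> A then E `` {x} \<inter> B else {})" by auto
    finally show ?thesis by (simp add: deg_def)
  qed
  then show ?thesis using assms by (simp add: emeasure_EM)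
qed

text \<open>\<open>mass_transport\<close> is this equality on rectangles, and rectangles form an
  intersection-stable generator on which finite measures are determined.\<close>

lemma EM_converse:
  assumes C: "C \<in> sets P"
  shows "emeasure EM (C\<inverse>) = emeasure EM C"
proof -
  let ?R = "{A \<times> B |A B. A \<in> sets \<nu> \<and> B \<in> sets \<nu>}"
  let ?D = "distr EM P (\<lambda>(x, y). (y, x))"
  have sw: "(\<lambda>(x, y). (y, x)) \<in> EM \<rightarrow>\<^sub>M P"
    using measurable_pair_swap'[of \<nu> \<nu>] by (simp cong: measurable_cong_sets)
  have D: "emeasure ?D C = emeasure EM (C\<inverse>)" if "C \<in> sets P" for C
  proof -
    have "(\<lambda>(x, y). (y, x)) -` C \<inter> space EM = C\<inverse>"
      using sets_P_subset[OF that] unfolding space_EM by auto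
    then show ?thesis using emeasure_distr[OF sw that] by simp
  qed
  have "EM = ?D"
  proof (rule measure_eqI_generator_eq[where E = ?R and \<Omega> = "space \<nu> \<times> space \<nu>"
        and A = "\<lambda>_. space \<nu> \<times> space \<nu>"])
    show "Int_stable ?R" by (rule Int_stable_pair_measure_generator)
    show "?R \<subseteq> Pow (space \<nu> \<times> space \<nu>)" by (rule pair_measure_closed)
    show "sets EM = sigma_sets (space \<nu> \<times> space \<nu>) ?R" by (simp add: sets_pair_measure)
    show "sets ?D = sigma_sets (space \<nu> \<times> space \<nu>) ?R" by (simp add: sets_pair_measure)
    show "range (\<lambda>_. space \<nu> \<times> space \<nu>) \<subseteq> ?R" by blast
    show "emeasure EM (space \<nu> \<times> space \<nu>) \<noteq> \<infinity>" by simp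
    fix X assume "X \<in> ?R"
    then obtain A B where X: "X = A \<times> B" "A \<in> sets \<nu>" "B \<in> sets \<nu>" by blast
    have "emeasure ?D X = emeasure EM (B \<times> A)"
      using X by (subst D) (auto intro!: arg_cong[where f = "emeasure EM"])
    then show "emeasure EM X = emeasure ?D X"
      using X mass_transport by (simp add: emeasure_EM_rect)
  qed simp
  then show ?thesis using D[OF C] by simp
qed

lemma EM_single_valued:
  assumes "C \<in> sets P" "C \<subseteq> E" "single_valued C"
  shows "emeasure EM C = emeasure \<nu> (Domain C)"
  using assms Domain_sets[OF assms(1,2)] by (simp add: emeasure_EM section_count_single_valued)

text \<open>Color 0 is exempt because its class also contains all pairs outside
  \<open>space P\<close>.\<close>

definition measurable_coloring :: "nat \<Rightarrow> ('a \<times> 'a \<Rightarrow> nat) \<Rightarrow> bool" where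
  "measurable_coloring K c \<longleftrightarrow> partial_coloring E K c \<and> (\<forall>a. a \<noteq> 0 \<longrightarrow> {e. c e = a} \<in> sets P)"

lemma measurable_coloringD:
  assumes "measurable_coloring K c"
  shows "partial_coloring E K c" "a \<noteq> 0 \<Longrightarrow> {e. c e = a} \<in> sets P"
  using assms by (auto simp: measurable_coloring_def)

lemma color_diff_sets:
  assumes "measurable_coloring K c" "measurable_coloring K' c'"
  shows "{e. c e \<noteq> c' e} \<in> sets P"
proof -
  have "{e. c e \<noteq> c' e} = (\<Union>i. ({e. c e = Suc i} - {e. c' e = Suc i}) \<union> ({e. c' e = Suc i} - {e. c e = Suc i}))"
    (is "?L = ?R")
  proof
    show "?L \<subseteq> ?R"
    proof
      fix e assume "e \<in> ?L"
      then have ne: "c e \<noteq> c' e" by simp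
      then consider i where "c e = Suc i" | i where "c' e = Suc i" by (metis not0_implies_Suc)
      then have "\<exists>i. e \<in> ({e. c e = Suc i} - {e. c' e = Suc i}) \<union> ({e. c' e = Suc i} - {e. c e = Suc i})"
        by cases (use ne in \<open>intro exI, force\<close>)+
      then show "e \<in> ?R" by (simp only: UN_iff bex_UNIV)
    qed
  qed auto
  also have "\<dots> \<in> sets P"
    using measurable_coloringD(2)[OF assms(1)] measurable_coloringD(2)[OF assms(2)]
    by (intro sets.countable_nat_UN) auto
  finally show ?thesis .
qed

section \<open>Chains of a measurable coloring as measure preserving maps\<close>

context
  fixes K :: nat and c :: "'a \<times> 'a \<Rightarrow> nat"
  assumes mc: "measurable_coloring K c"
begin

lemma pc: "partial_coloring E K c"
  using mc by (simp add: measurable_coloring_def)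

lemma color_class_sets: "a \<noteq> 0 \<Longrightarrow> {e. c e = a} \<in> sets P"
  using mc by (simp add: measurable_coloring_def)

lemma color_class_subset: "a \<noteq> 0 \<Longrightarrow> {e. c e = a} \<subseteq> E"
  using color_edge[OF pc] by auto

lemma color_class_single_valued: "a \<noteq> 0 \<Longrightarrow> single_valued {e. c e = a}"
  unfolding single_valued_def using color_unique[OF pc] by auto

lemma color_class_Domain: "Domain {e. c e = a} = {x. \<not> missing c a x}"
  by (auto simp: missing_def)

lemma uncolored_sets: "{e \<in> E. c e = 0} \<in> sets P"
proof -
  have "c e \<noteq> 0 \<longleftrightarrow> (\<exists>a\<in>{1..K}. c e = a)" for e using color_le[OF pc, of e] by (auto simp: Suc_le_eq)
  then have "{e \<in> E. c e = 0} = E - (\<Union>a\<in>{1..K}. {e. c e = a})" by blast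
  also have "\<dots> \<in> sets P" using E_sets color_class_sets by (intro sets.Diff sets.finite_UN) auto
  finally show ?thesis .
qed

lemma missing_sets: "a \<noteq> 0 \<Longrightarrow> {x \<in> space \<nu>. missing c a x} \<in> sets \<nu>"
proof -
  assume a: "a \<noteq> 0"
  have "{x \<in> space \<nu>. missing c a x} = space \<nu> - Domain {e. c e = a}"
    by (auto simp: color_class_Domain)
  then show ?thesis using Domain_sets[OF color_class_sets[OF a] color_class_subset[OF a]] by simp
qed

text \<open>A color class is a matching, so its \<open>EM\<close>-measure over a set of starting
  points equals the measure of these points; \<open>EM_converse\<close> exchanges starting points
  and end points. This is how mass transport enters the counting of chains.\<close>

lemma cnbr_image:
  assumes a: "a \<noteq> 0" and B: "B \<in> sets \<nu>"
  shows "cnbr c a ` B \<in> sets \<nu>" "emeasure \<nu> (cnbr c a ` B) = emeasure \<nu> B"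
proof -
  let ?W = "{e. c e = a}"
  let ?W1 = "?W \<inter> space \<nu> \<times> B" and ?W2 = "?W \<inter> B \<times> space \<nu>"
  have W: "?W1 \<in> sets P" "?W1 \<subseteq> E" "single_valued ?W1" "?W2 \<in> sets P" "?W2 \<subseteq> E" "single_valued ?W2"
    using color_class_sets[OF a] color_class_subset[OF a] color_class_single_valued[OF a] B
    by (auto intro: single_valued_subset[rotated])
  have BX: "B \<subseteq> space \<nu>" using B by (rule sets.sets_into_space)
  have conv: "?W1\<inverse> = ?W2" using color_sym[OF pc] by auto
  have D2: "Domain ?W2 = {x \<in> B. \<not> missing c a x}"
    using sets_P_subset[OF color_class_sets[OF a]] by (auto simp: missing_def)
  have D1: "Domain ?W1 = cnbr c a ` {x \<in> B. \<not> missing c a x}"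
  proof (intro equalityI subsetI)
    fix x assume "x \<in> Domain ?W1"
    then obtain y where y: "c (x, y) = a" "y \<in> B" by blast
    then have "c (y, x) = a" using color_sym[OF pc, of x y] by simp
    then have "cnbr c a y = x" "\<not> missing c a y" using cnbr_eq[OF pc] a by (auto simp: missing_def)
    then show "x \<in> cnbr c a ` {x \<in> B. \<not> missing c a x}" using y(2) by blast
  next
    fix x assume "x \<in> cnbr c a ` {x \<in> B. \<not> missing c a x}"
    then obtain y where y: "y \<in> B" "\<not> missing c a y" "x = cnbr c a y" by blast
    then have "c (y, x) = a" using color_cnbr[OF pc] by blast
    then have "c (x, y) = a" using color_sym[OF pc, of x y] by simp
    moreover have "x \<in> space \<nu>" using \<open>c (x, y) = a\<close> sets_P_subset[OF color_class_sets[OF a]] by blast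
    ultimately show "x \<in> Domain ?W1" using y(1) by blast
  qed
  have Ds: "Domain ?W1 \<in> sets \<nu>" "Domain ?W2 \<in> sets \<nu>" using W Domain_sets by blast+
  have img: "cnbr c a ` B = Domain ?W1 \<union> (B - Domain ?W2)"
  proof -
    have "cnbr c a ` B = cnbr c a ` {x \<in> B. \<not> missing c a x} \<union> cnbr c a ` {x \<in> B. missing c a x}" by blast
    also have "cnbr c a ` {x \<in> B. missing c a x} = {x \<in> B. missing c a x}"
      using cnbr_missing[OF pc] by force
    also have "{x \<in> B. missing c a x} = B - Domain ?W2" unfolding D2 by blast
    finally show ?thesis by (simp only: D1)
  qed
  show "cnbr c a ` B \<in> sets \<nu>" unfolding img using Ds B by blast
  have "Domain ?W1 \<inter> (B - Domain ?W2) = {}"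
  proof -
    have "\<not> missing c a x" if "x \<in> Domain ?W1" for x using that by (auto simp: missing_def)
    then show ?thesis unfolding D2 by blast
  qed
  then have "emeasure \<nu> (cnbr c a ` B) = emeasure \<nu> (Domain ?W1) + emeasure \<nu> (B - Domain ?W2)"
    unfolding img using Ds B by (intro plus_emeasure[symmetric]) auto
  also have "emeasure \<nu> (Domain ?W1) = emeasure EM ?W1" using EM_single_valued[OF W(1-3)] by simp
  also have "\<dots> = emeasure EM ?W2" using EM_converse[OF W(1)] conv by simp
  also have "\<dots> = emeasure \<nu> (Domain ?W2)" using EM_single_valued[OF W(4-6)] by simp
  also have "emeasure \<nu> (Domain ?W2) + emeasure \<nu> (B - Domain ?W2) = emeasure \<nu> (Domain ?W2 \<union> (B - Domain ?W2))"
    using Ds B by (intro plus_emeasure) auto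
  also have "Domain ?W2 \<union> (B - Domain ?W2) = B" unfolding D2 by blast
  finally show "emeasure \<nu> (cnbr c a ` B) = emeasure \<nu> B" .
qed

lemma cnbr_space:
  assumes "a \<noteq> 0" "x \<in> space \<nu>"
  shows "cnbr c a x \<in> space \<nu>"
  using sets.sets_into_space[OF cnbr_image(1)[OF assms(1) sets.top]] assms(2) by blast

lemma cnbr_measurable:
  assumes a: "a \<noteq> 0"
  shows "cnbr c a \<in> \<nu> \<rightarrow>\<^sub>M \<nu>"
proof (rule measurableI)
  fix B assume B: "B \<in> sets \<nu>"
  have "cnbr c a -` B \<inter> space \<nu> = cnbr c a ` B"
  proof (intro equalityI subsetI)
    fix x assume "x \<in> cnbr c a -` B \<inter> space \<nu>"
    then show "x \<in> cnbr c a ` B" using cnbr_cnbr[OF pc a, of x] by (metis IntD1 imageI vimageD)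
  next
    fix x assume "x \<in> cnbr c a ` B"
    then obtain y where y: "y \<in> B" "x = cnbr c a y" by blast
    then have "cnbr c a x = y" using cnbr_cnbr[OF pc a] by metis
    moreover have "x \<in> space \<nu>" using y cnbr_space[OF a] sets.sets_into_space[OF B] by blast
    ultimately show "x \<in> cnbr c a -` B \<inter> space \<nu>" using y(1) by simp
  qed
  then show "cnbr c a -` B \<inter> space \<nu> \<in> sets \<nu>" using cnbr_image(1)[OF a B] by simp
qed (rule cnbr_space[OF a])

lemma chain_image:
  assumes ab: "a \<noteq> 0" "b \<noteq> 0" and B: "B \<in> sets \<nu>"
  shows "chain c a b k ` B \<in> sets \<nu> \<and> emeasure \<nu> (chain c a b k ` B) = emeasure \<nu> B"
proof (induction k)
  case 0
  have "chain c a b 0 ` B = B" by simp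
  then show ?case using B by simp
next
  case (Suc k)
  let ?t = "if even k then a else b"
  have t: "?t \<noteq> 0" using ab by simp
  have "chain c a b (Suc k) ` B = cnbr c ?t ` (chain c a b k ` B)" unfolding chain.simps image_image ..
  then show ?case using cnbr_image[OF t] Suc by metis
qed

lemma chain_measurable:
  assumes ab: "a \<noteq> 0" "b \<noteq> 0"
  shows "chain c a b k \<in> \<nu> \<rightarrow>\<^sub>M \<nu>"
proof (induction k)
  case 0
  have "chain c a b 0 = (\<lambda>x. x)" by auto
  then show ?case by simp
next
  case (Suc k)
  let ?t = "if even k then a else b"
  have t: "?t \<noteq> 0" using ab by simp
  have eq: "chain c a b (Suc k) = cnbr c ?t \<circ> chain c a b k" by (rule ext) simp
  show ?case unfolding eq by (rule measurable_comp[OF Suc.IH cnbr_measurable[OF t]])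
qed

lemma run_sets:
  assumes ab: "a \<noteq> 0" "b \<noteq> 0"
  shows "{x \<in> space \<nu>. run c a b k x} \<in> sets \<nu>"
proof (induction k)
  case (Suc k)
  let ?t = "if even k then a else b"
  have t: "?t \<noteq> 0" using ab by simp
  have "{x \<in> space \<nu>. run c a b (Suc k) x} = {x \<in> space \<nu>. run c a b k x} -
      (chain c a b k -` {x \<in> space \<nu>. missing c ?t x} \<inter> space \<nu>)"
    using cnbr_fixed_iff[OF pc t] measurable_space[OF chain_measurable[OF ab]]
    unfolding run_Suc chain.simps by blast
  then show ?case
    using Suc measurable_sets[OF chain_measurable[OF ab] missing_sets[OF t]] by simp
qed simp

text \<open>The images of \<open>R\<close> are disjoint by \<open>chain_inj\<close> and all have the
  measure of \<open>R\<close>. Since a probability is at most 1, long chains can start only on a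
  small set.\<close>

lemma chain_packing:
  assumes ab: "a \<noteq> 0" "b \<noteq> 0" and R: "R \<in> sets \<nu>" and I: "finite I"
    and m: "\<And>y. y \<in> R \<Longrightarrow> missing c b y" and s: "\<And>y z. y \<in> R \<Longrightarrow> z \<in> R \<Longrightarrow> y \<in> S \<longleftrightarrow> z \<in> S"
    and r: "\<And>y i. y \<in> R \<Longrightarrow> i \<in> I \<Longrightarrow> run c a b i y"
  shows "prob (\<Union>i\<in>I. chain c a b i ` R) = card I * prob R"
proof -
  have "disjoint_family_on (\<lambda>i. chain c a b i ` R) I"
    unfolding disjoint_family_on_def
  proof (intro ballI impI)
    fix i j assume ij: "i \<in> I" "j \<in> I" "i \<noteq> j"
    show "chain c a b i ` R \<inter> chain c a b j ` R = {}"
    proof (rule ccontr)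
      assume "chain c a b i ` R \<inter> chain c a b j ` R \<noteq> {}"
      then obtain y z where yz: "y \<in> R" "z \<in> R" "chain c a b i y = chain c a b j z" by blast
      from chain_inj[OF pc ab m[OF yz(1)] m[OF yz(2)] s[OF yz(1,2)] r[OF yz(1) ij(1)] r[OF yz(2) ij(2)] yz(3)]
      show False using ij(3) by blast
    qed
  qed
  then have "prob (\<Union>i\<in>I. chain c a b i ` R) = (\<Sum>i\<in>I. prob (chain c a b i ` R))"
    using chain_image[OF ab R] I by (intro finite_measure_finite_Union) auto
  also have "\<dots> = (\<Sum>i\<in>I. prob R)" using chain_image[OF ab R] by (simp add: measure_def)
  finally show ?thesis by simp
qed

text \<open>By \<open>stop\<close> the chains have at most \<open>k\<close> steps, so
  \<open>Z\<close> is covered by \<open>k + 1\<close> images of \<open>?Q\<close> and has measure at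
  most \<open>(k + 1) * measure EM M\<close>. Each of the colors \<open>a\<close> and
  \<open>b\<close> contributes at most \<open>prob Z\<close> to the change and \<open>M\<close>
  itself once, which adds up to \<open>2 * k + 3\<close>.\<close>

lemma augment_measurable:
  assumes a: "a \<noteq> 0" "a \<le> K" and b: "b \<noteq> 0" "b \<le> K"
    and M: "M \<subseteq> E" "sym M" "single_valued M" "\<And>e. e \<in> M \<Longrightarrow> c e = 0" and Ms: "M \<in> sets P"
    and miss: "\<And>y x. (y, x) \<in> M \<Longrightarrow> y \<in> S \<Longrightarrow> missing c b y \<and> missing c a x"
    and stop: "\<And>y x. (y, x) \<in> M \<Longrightarrow> y \<in> S \<Longrightarrow> \<not> run c a b (Suc k) y"
  shows "measurable_coloring K (augment c a b S M)"
    "measure EM {e. c e \<noteq> augment c a b S M e} \<le> real (2 * k + 3) * measure EM M"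
proof -
  let ?c = "augment c a b S M" and ?Q = "Domain M \<inter> S"
  define Z where "Z = kempe_set c a b ?Q"
  have Q: "?Q \<in> sets \<nu>" using Domain_sets[OF Ms M(1)] S_sets by blast
  have Z_eq: "Z = (\<Union>j\<in>{..k}. chain c a b j ` (?Q \<inter> {x \<in> space \<nu>. run c a b j x}))"
  proof (intro equalityI subsetI)
    fix v assume v: "v \<in> Z"
    then obtain j y where j: "v = chain c a b j y" "y \<in> ?Q" "run c a b j y"
      unfolding Z_def kempe_set_def by (elim CollectE exE conjE) (rule that)
    have "j \<le> k"
    proof (rule ccontr)
      assume "\<not> j \<le> k"
      then have "run c a b (Suc k) y" using run_mono[OF j(3), of "Suc k"] by simp
      then show False using stop j(2) by blast
    qed
    moreover have "y \<in> space \<nu>" using j(2) sets.sets_into_space[OF Q] by blast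
    ultimately show "v \<in> (\<Union>j\<in>{..k}. chain c a b j ` (?Q \<inter> {x \<in> space \<nu>. run c a b j x}))"
      using j by blast
  next
    fix v assume "v \<in> (\<Union>j\<in>{..k}. chain c a b j ` (?Q \<inter> {x \<in> space \<nu>. run c a b j x}))"
    then show "v \<in> Z" unfolding Z_def kempe_set_def by blast
  qed
  have Z_sub: "Z \<subseteq> (\<Union>j\<in>{..k}. chain c a b j ` ?Q)" unfolding Z_eq by blast
  have Zs: "Z \<in> sets \<nu>"
    unfolding Z_eq using chain_image[OF a(1) b(1)] run_sets[OF a(1) b(1)] Q
    by (intro sets.finite_UN) auto
  have "prob Z \<le> prob (\<Union>j\<in>{..k}. chain c a b j ` ?Q)"
    using Z_sub chain_image[OF a(1) b(1) Q] by (intro finite_measure_mono sets.finite_UN) auto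
  also have "\<dots> \<le> (\<Sum>j\<in>{..k}. prob (chain c a b j ` ?Q))"
    using chain_image[OF a(1) b(1) Q] by (intro finite_measure_subadditive_finite) auto
  also have "\<dots> = (\<Sum>j\<in>{..k}. prob ?Q)" using chain_image[OF a(1) b(1) Q] by (simp add: measure_def)
  also have "\<dots> = (k + 1) * prob ?Q" by simp
  also have "prob ?Q \<le> prob (Domain M)" using Domain_sets[OF Ms M(1)] by (intro finite_measure_mono) auto
  also have "prob (Domain M) = measure EM M" using EM_single_valued[OF Ms M(1,3)] by (simp add: measure_def)
  finally have Z_prob: "prob Z \<le> (k + 1) * measure EM M" by (simp add: mult_left_mono)
  define t where "t i = (if i = b then a else if i = a then b else i)" for i
  have cls: "{e. ?c e = i} = (if i = a then M else {}) \<union>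
      (({e. c e = t i} \<inter> Z \<times> space \<nu>) \<union> ({e. c e = i} - Z \<times> space \<nu>) - M)" if i: "i \<noteq> 0" for i
  proof -
    have "t i \<noteq> 0" using i a b by (simp add: t_def)
    then have "{e. c e = t i} \<inter> Z \<times> space \<nu> = {e. c e = t i \<and> fst e \<in> Z}"
      using sets_P_subset[OF color_class_sets] by auto
    moreover have "{e. c e = i} - Z \<times> space \<nu> = {e. c e = i \<and> fst e \<notin> Z}"
      using sets_P_subset[OF color_class_sets[OF i]] by auto
    ultimately show ?thesis
      unfolding augment_def kempe_def Z_def[symmetric] by (auto simp: t_def split: if_splits)
  qed
  have "{e. ?c e = i} \<in> sets P" if i: "i \<noteq> 0" for i
  proof -
    have "t i \<noteq> 0" using i a b by (simp add: t_def)
    then show ?thesis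
      unfolding cls[OF i] using Ms color_class_sets i Zs by (intro sets.Un sets.Diff sets.Int) auto
  qed
  then show mc': "measurable_coloring K ?c"
    unfolding measurable_coloring_def using augment_partial_coloring(1)[OF pc a b M miss] by blast
  let ?A = "\<lambda>i. {e. c e = i} \<inter> Z \<times> space \<nu>"
  have A: "?A i \<in> sets P" "measure EM (?A i) \<le> prob Z" if "i \<noteq> 0" for i
  proof -
    show "?A i \<in> sets P" using color_class_sets[OF that] Zs by auto
    then have "emeasure EM (?A i) = emeasure \<nu> (Domain (?A i))"
      using color_class_subset[OF that] color_class_single_valued[OF that]
      by (intro EM_single_valued) (auto intro: single_valued_subset[rotated])
    also have "\<dots> \<le> emeasure \<nu> Z" using Zs by (intro emeasure_mono) auto
    finally show "measure EM (?A i) \<le> prob Z" by (simp add: EM.emeasure_eq_measure emeasure_eq_measure)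
  qed
  have sub: "{e. c e \<noteq> ?c e} \<subseteq> M \<union> (?A a \<union> ?A b)"
  proof
    fix e assume e: "e \<in> {e. c e \<noteq> ?c e}"
    have "e \<in> {e. c e = a} \<Longrightarrow> snd e \<in> space \<nu>" "e \<in> {e. c e = b} \<Longrightarrow> snd e \<in> space \<nu>"
      using sets_P_subset[OF color_class_sets[OF a(1)]] sets_P_subset[OF color_class_sets[OF b(1)]] by auto
    then show "e \<in> M \<union> (?A a \<union> ?A b)"
      using e unfolding augment_def kempe_def Z_def[symmetric] by (cases e) (auto split: if_splits)
  qed
  have "measure EM {e. c e \<noteq> ?c e} \<le> measure EM (M \<union> (?A a \<union> ?A b))"
    using sub Ms A a(1) b(1) by (intro EM.finite_measure_mono) auto
  also have "\<dots> \<le> measure EM M + (measure EM (?A a) + measure EM (?A b))"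
    using Ms A a(1) b(1)
    by (intro order_trans[OF measure_Un_le] add_left_mono measure_Un_le) auto
  also have "\<dots> \<le> measure EM M + (prob Z + prob Z)"
    using A a(1) b(1) by (intro add_left_mono add_mono) auto
  also have "\<dots> \<le> real (2 * k + 3) * measure EM M" using Z_prob by (simp add: algebra_simps)
  finally show "measure EM {e. c e \<noteq> ?c e} \<le> real (2 * k + 3) * measure EM M" .
qed

end

end

section \<open>Augmentations\<close>

text \<open>A chain sees only the two color classes between which it alternates. The congruences
  carry a chain found in one coloring over to another obtained by recoloring in other
  colors.\<close>

lemma cnbr_cong:
  assumes "{e. c e = a} = {e. c' e = a}"
  shows "cnbr c a = cnbr c' a"
proof
  fix x
  have "(\<lambda>y. c (x, y) = a) = (\<lambda>y. c' (x, y) = a)"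
    using assms by (intro ext) blast
  then have "(SOME y. c (x, y) = a) = (SOME y. c' (x, y) = a)" "(\<exists>y. c (x, y) = a) = (\<exists>y. c' (x, y) = a)"
    by (simp_all only:)
  then show "cnbr c a x = cnbr c' a x" unfolding cnbr_def missing_def by auto
qed

lemma chain_cong:
  assumes "{e. c e = a} = {e. c' e = a}" "{e. c e = b} = {e. c' e = b}"
  shows "chain c a b k x = chain c' a b k x"
  using cnbr_cong[OF assms(1)] cnbr_cong[OF assms(2)] by (induction k) simp_all

lemma run_cong:
  assumes "{e. c e = a} = {e. c' e = a}" "{e. c e = b} = {e. c' e = b}"
  shows "run c a b k x \<longleftrightarrow> run c' a b k x"
  unfolding run_def by (simp only: chain_cong[OF assms])

lemma missing_cong: "{e. c e = a} = {e. c' e = a} \<Longrightarrow> missing c a x \<longleftrightarrow> missing c' a x"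
  unfolding missing_def by blast

lemma augment_other_color:
  assumes "g \<noteq> a" "g \<noteq> b" "\<And>e. e \<in> M \<Longrightarrow> c e \<noteq> g"
  shows "{e. c e = g} = {e. augment c a b S M e = g}"
  using assms by (auto simp: augment_def kempe_def)

section \<open>Recoloring steps and their cost\<close>

context borel_graph
begin

definition uncolored :: "('a \<times> 'a \<Rightarrow> nat) \<Rightarrow> ('a \<times> 'a) set" where
  "uncolored c = {e \<in> E. c e = 0}"

definition dist_col :: "('a \<times> 'a \<Rightarrow> nat) \<Rightarrow> ('a \<times> 'a \<Rightarrow> nat) \<Rightarrow> real" where
  "dist_col c c' = measure EM {e. c e \<noteq> c' e}"

abbreviation umeas where "umeas c \<equiv> measure EM (uncolored c)"

lemma uncolored_in_sets: "measurable_coloring K c \<Longrightarrow> uncolored c \<in> sets P"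
  unfolding uncolored_def by (rule uncolored_sets)

lemma dist_col_triangle:
  assumes "measurable_coloring K c" "measurable_coloring K c'" "measurable_coloring K c''"
  shows "dist_col c c'' \<le> dist_col c c' + dist_col c' c''"
proof -
  have "dist_col c c'' \<le> measure EM ({e. c e \<noteq> c' e} \<union> {e. c' e \<noteq> c'' e})"
    unfolding dist_col_def
  proof (rule EM.finite_measure_mono)
    show "{e. c e \<noteq> c'' e} \<subseteq> {e. c e \<noteq> c' e} \<union> {e. c' e \<noteq> c'' e}" by auto
    show "{e. c e \<noteq> c' e} \<union> {e. c' e \<noteq> c'' e} \<in> sets EM"
      unfolding sets_EM by (intro sets.Un color_diff_sets[OF assms(1,2)] color_diff_sets[OF assms(2,3)])
  qed
  also have "\<dots> \<le> dist_col c c' + dist_col c' c''"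
    unfolding dist_col_def
    by (rule measure_Un_le; unfold sets_EM; rule color_diff_sets[OF assms(1,2)] color_diff_sets[OF assms(2,3)])
  finally show ?thesis .
qed

lemma uncolored_dist:
  assumes "measurable_coloring K c" "measurable_coloring K c'"
  shows "umeas c' \<le> umeas c + dist_col c c'"
proof -
  have "umeas c' \<le> measure EM (uncolored c \<union> {e. c e \<noteq> c' e})"
    using color_diff_sets[OF assms] uncolored_in_sets assms
    by (intro EM.finite_measure_mono) (auto simp: uncolored_def)
  also have "\<dots> \<le> umeas c + dist_col c c'"
    unfolding dist_col_def using color_diff_sets[OF assms] uncolored_in_sets assms
    by (intro measure_Un_le) auto
  finally show ?thesis .
qed

text \<open>Edges that are augmented together must not share a vertex. The pieces
  \<open>G n \<inter> (G m)\<inverse>\<close> are single valued in both directions and countably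
  many cover \<open>E\<close>, so one of them meets \<open>C\<close> in positive measure. As
  \<open>C\<close> leads out of \<open>S\<close>, adding the reversed edges creates no
  conflict.\<close>

lemma ex_matching_subset:
  assumes mc: "measurable_coloring K c"
    and C: "C \<in> sets P" "C \<subseteq> uncolored c" "measure EM C > 0" "C \<subseteq> S \<times> UNIV"
  obtains M where "M \<in> sets P" "M \<subseteq> E" "sym M" "single_valued M" "measure EM M > 0"
    "M \<inter> S \<times> UNIV \<subseteq> C" "\<And>e. e \<in> M \<Longrightarrow> c e = 0"
proof -
  have CE: "C \<subseteq> E" using C(2) unfolding uncolored_def by blast
  have C0: "c e = 0" if "e \<in> C" for e using C(2) that unfolding uncolored_def by blast
  let ?H = "\<lambda>p. C \<inter> G (fst p) \<inter> (G (snd p))\<inverse>"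
  have H: "?H p \<in> sets P" for p :: "nat \<times> nat" using C(1) G_sets converse_sets by (intro sets.Int) auto
  have "C \<subseteq> (\<Union>p. ?H p)"
  proof
    fix e assume e: "e \<in> C"
    obtain x y where xy: "e = (x, y)" by (cases e)
    have "(x, y) \<in> E" using e xy CE by blast
    moreover have "(y, x) \<in> E" using \<open>(x, y) \<in> E\<close> symE by (simp add: symD)
    ultimately obtain n m where "(x, y) \<in> G n" "(y, x) \<in> G m" unfolding G_UN[symmetric] by blast
    then have "e \<in> ?H (n, m)" using e xy by simp
    then show "e \<in> (\<Union>p. ?H p)" by blast
  qed
  have "\<exists>p. measure EM (?H p) > 0"
  proof (rule ccontr)
    assume "\<not> ?thesis"
    then have "measure EM (?H p) = 0" for p by (meson measure_nonneg not_less order_antisym)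
    then have "?H p \<in> null_sets EM" for p using H by (auto simp: EM.emeasure_eq_measure)
    then have "(\<Union>p. ?H p) \<in> null_sets EM" by (intro null_sets_UN) auto
    then have "C \<in> null_sets EM"
      by (rule null_sets_subset) (use C(1) \<open>C \<subseteq> (\<Union>p. ?H p)\<close> in simp_all)
    then show False using C(3) by (simp add: measure_def null_setsD1)
  qed
  then obtain p where p: "measure EM (?H p) > 0" by blast
  define M0 where "M0 = ?H p"
  have M0: "M0 \<in> sets P" "M0 \<subseteq> C" "single_valued M0" "single_valued (M0\<inverse>)"
  proof -
    show "M0 \<in> sets P" unfolding M0_def by (rule H)
    show "M0 \<subseteq> C" unfolding M0_def by blast
    show "single_valued M0" by (rule single_valued_subset[OF _ G_sv]) (auto simp: M0_def)
    show "single_valued (M0\<inverse>)" by (rule single_valued_subset[OF _ G_sv]) (auto simp: M0_def)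
  qed
  have side0: "x \<in> S" "y \<notin> S" if "(x, y) \<in> M0" for x y
    using that M0(2) CE C(4) side by blast+
  show ?thesis
  proof (rule that[of "M0 \<union> M0\<inverse>"])
    show Ms: "M0 \<union> M0\<inverse> \<in> sets P" using M0(1) converse_sets by blast
    show "M0 \<union> M0\<inverse> \<subseteq> E" using M0(2) CE symE by (auto dest: symD)
    show "sym (M0 \<union> M0\<inverse>)" by (auto simp: sym_def)
    show "single_valued (M0 \<union> M0\<inverse>)"
      unfolding single_valued_def
    proof (intro allI impI)
      fix x y z assume xy: "(x, y) \<in> M0 \<union> M0\<inverse>" and xz: "(x, z) \<in> M0 \<union> M0\<inverse>"
      show "y = z"
      proof (cases "x \<in> S")
        case True
        then have "(x, y) \<in> M0" "(x, z) \<in> M0" using xy xz side0 by blast+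
        then show ?thesis using M0(3) by (simp add: single_valuedD)
      next
        case False
        then have "(x, y) \<in> M0\<inverse>" "(x, z) \<in> M0\<inverse>" using xy xz side0 by blast+
        then show ?thesis using M0(4) by (simp only: single_valuedD)
      qed
    qed
    have "measure EM M0 \<le> measure EM (M0 \<union> M0\<inverse>)" using Ms by (intro EM.finite_measure_mono) auto
    then show "measure EM (M0 \<union> M0\<inverse>) > 0" using p by (simp add: M0_def)
    show "(M0 \<union> M0\<inverse>) \<inter> S \<times> UNIV \<subseteq> C" using M0(2) side0 by blast
    show "c e = 0" if "e \<in> M0 \<union> M0\<inverse>" for e
    proof -
      obtain x y where e: "e = (x, y)" by (cases e)
      have "(x, y) \<in> C \<or> (y, x) \<in> C" using that M0(2) unfolding e by blast
      then show ?thesis using C0 color_sym[OF pc[OF mc], of x y] unfolding e by metis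
    qed
  qed
qed

text \<open>An uncolored edge \<open>(y, x)\<close> in \<open>short_edges\<close> can be colored by swapping along a chain of at most
  \<open>L\<close> steps. For \<open>detour_edges\<close> the \<open>a\<close>/\<open>b\<close>-chain is cut at its \<open>i\<close>-th vertex \<open>v\<close> by uncoloring its next
  edge \<open>vu\<close>, and \<open>vu\<close> is then recolored by means of a \<open>g\<close>/\<open>h\<close>-chain from \<open>u\<close>. Since \<open>g\<close> and \<open>h\<close> differ from
  \<open>a\<close> and \<open>b\<close>, the first swap does not affect the second chain.\<close>

definition short_edges :: "('a \<times> 'a \<Rightarrow> nat) \<Rightarrow> nat \<Rightarrow> nat \<Rightarrow> nat \<Rightarrow> ('a \<times> 'a) set" where
  "short_edges c a b L = {(y, x) \<in> uncolored c. y \<in> S \<and> missing c b y \<and> missing c a x \<and>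
     \<not> run c a b (Suc L) y}"

definition detour_edges :: "('a \<times> 'a \<Rightarrow> nat) \<Rightarrow> nat \<Rightarrow> nat \<Rightarrow> nat \<Rightarrow> nat \<Rightarrow> nat \<Rightarrow> nat \<Rightarrow> ('a \<times> 'a) set" where
  "detour_edges c a b i g h L = {(y, x) \<in> uncolored c. y \<in> S \<and> missing c b y \<and> missing c a x \<and>
     run c a b i y \<and> missing c g (chain c a b i y) \<and> missing c h (chain c a b (Suc i) y) \<and>
     \<not> run c g h (Suc L) (chain c a b (Suc i) y)}"

lemma uncolored_subset: "uncolored c \<subseteq> E"
  by (auto simp: uncolored_def)

lemma short_edges_sets:
  assumes mc: "measurable_coloring K c" and ab: "a \<noteq> 0" "b \<noteq> 0"
  shows "short_edges c a b L \<in> sets P"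
proof -
  have "short_edges c a b L = uncolored c \<inter>
      ((S \<inter> {y \<in> space \<nu>. missing c b y} - {y \<in> space \<nu>. run c a b (Suc L) y}) \<times> {x \<in> space \<nu>. missing c a x})"
    using E_subset uncolored_subset[of c] unfolding short_edges_def by blast
  also have "\<dots> \<in> sets P"
    using uncolored_in_sets[OF mc] missing_sets[OF mc] run_sets[OF mc ab] S_sets ab
    by (intro sets.Int pair_measureI sets.Diff) auto
  finally show ?thesis .
qed

lemma detour_edges_sets:
  assumes mc: "measurable_coloring K c" and ab: "a \<noteq> 0" "b \<noteq> 0" and gh: "g \<noteq> 0" "h \<noteq> 0"
  shows "detour_edges c a b i g h L \<in> sets P"
proof -
  let ?pre = "\<lambda>j B. chain c a b j -` B \<inter> space \<nu>"
  have pre: "?pre j B \<in> sets \<nu>" if "B \<in> sets \<nu>" for j B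
    using chain_measurable[OF mc ab] that by (rule measurable_sets)
  have sp: "chain c a b j y \<in> space \<nu>" if "y \<in> space \<nu>" for j y
    using measurable_space[OF chain_measurable[OF mc ab] that] .
  have "detour_edges c a b i g h L = uncolored c \<inter>
      ((S \<inter> {y \<in> space \<nu>. missing c b y} \<inter> {y \<in> space \<nu>. run c a b i y} \<inter>
        ?pre i {y \<in> space \<nu>. missing c g y} \<inter> ?pre (Suc i) {y \<in> space \<nu>. missing c h y} -
        ?pre (Suc i) {y \<in> space \<nu>. run c g h (Suc L) y}) \<times> {x \<in> space \<nu>. missing c a x})"
    using E_subset uncolored_subset[of c] sp unfolding detour_edges_def by blast
  also have "\<dots> \<in> sets P"
    using uncolored_in_sets[OF mc] missing_sets[OF mc] run_sets[OF mc ab] run_sets[OF mc gh] S_sets ab gh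
    by (intro sets.Int pair_measureI sets.Diff pre) auto
  finally show ?thesis .
qed

lemma measure_uncolored_Diff:
  assumes "measurable_coloring K c" "M \<in> sets P" "M \<subseteq> uncolored c" "uncolored c' = uncolored c - M"
  shows "umeas c' = umeas c - measure EM M"
  using assms uncolored_in_sets[OF assms(1)] by (simp add: EM.finite_measure_Diff)

text \<open>The gain is \<open>measure EM M\<close>, and the price per unit of gain is that of
  \<open>augment_measurable\<close> with \<open>k = L\<close>.\<close>

lemma improve_short:
  assumes mc: "measurable_coloring K c" and a: "a \<noteq> 0" "a \<le> K" and b: "b \<noteq> 0" "b \<le> K"
    and pos: "measure EM (short_edges c a b L) > 0"
  shows "\<exists>c'. measurable_coloring K c' \<and> umeas c' < umeas c \<and>
    dist_col c c' \<le> real (2 * L + 3) * (umeas c - umeas c')"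
proof -
  let ?C = "short_edges c a b L"
  obtain M where M: "M \<in> sets P" "M \<subseteq> E" "sym M" "single_valued M" "measure EM M > 0"
    "M \<inter> S \<times> UNIV \<subseteq> ?C" and M0: "\<And>e. e \<in> M \<Longrightarrow> c e = 0"
  proof (rule ex_matching_subset[OF mc])
    show "?C \<in> sets P" by (rule short_edges_sets[OF mc a(1) b(1)])
    show "?C \<subseteq> uncolored c" unfolding short_edges_def by blast
    show "?C \<subseteq> S \<times> UNIV" unfolding short_edges_def by blast
  qed (use pos in auto)
  have miss: "missing c b y \<and> missing c a x" "\<not> run c a b (Suc L) y" if "(y, x) \<in> M" "y \<in> S" for x y
    using that M(6) unfolding short_edges_def by blast+
  let ?c = "augment c a b S M"
  note aug = augment_measurable[OF mc a b M(2-4) M0 M(1) miss]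
  have "uncolored ?c = uncolored c - M"
    unfolding uncolored_def using augment_partial_coloring(2)[OF pc[OF mc] a b M(2-4) M0 miss(1)] by blast
  moreover have "M \<subseteq> uncolored c" unfolding uncolored_def using M(2) M0 by blast
  ultimately have u: "umeas ?c = umeas c - measure EM M"
    using measure_uncolored_Diff[OF mc M(1)] by blast
  show ?thesis
  proof (intro exI[of _ ?c] conjI)
    show "measurable_coloring K ?c" by (rule aug(1))
    show "umeas ?c < umeas c" using u M(5) by simp
    show "dist_col c ?c \<le> real (2 * L + 3) * (umeas c - umeas ?c)"
      unfolding u dist_col_def using aug(2) by simp
  qed
qed

text \<open>A detour cuts the first chain at an even position, so the second chain starts outside
  \<open>S\<close>. Exchanging the sides makes the results on \<open>augment\<close> apply to
  it.\<close>

lemma opposite_side_graph: "borel_graph \<nu> E (space \<nu> - S) d G"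
proof
  show "x \<in> space \<nu> - S \<longleftrightarrow> y \<notin> space \<nu> - S" if "(x, y) \<in> E" for x y
    using side[OF that] E_subset that by blast
qed (assumption | rule sets.Diff[OF sets.top S_sets] symE fin_deg deg_le G_sets G_sv G_UN
  Domain_sets mass_transport)+

text \<open>The stages are \<open>c1\<close> (cut edges \<open>F\<close> uncolored),
  \<open>c2\<close> (\<open>M\<close> colored) and \<open>c3\<close> (\<open>F\<close> colored
  again). \<open>F\<close> has at most one edge per chain, in both orientations, so its measure is
  at most twice that of \<open>M\<close>. The stages cost once \<open>F\<close>,
  \<open>2 * i + 3\<close> times \<open>M\<close> and \<open>2 * L + 3\<close> times
  \<open>F\<close>; hence the constant \<open>2 * (2 * L + 4) + 2 * i + 3\<close>.\<close>

lemma improve_detour: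
  assumes mc: "measurable_coloring K c" and a: "a \<noteq> 0" "a \<le> K" and b: "b \<noteq> 0" "b \<le> K"
    and g: "g \<noteq> 0" "g \<le> K" "g \<notin> {a, b}" and h: "h \<noteq> 0" "h \<le> K" "h \<notin> {a, b}" and i: "even i"
    and pos: "measure EM (detour_edges c a b i g h L) > 0"
  shows "\<exists>c'. measurable_coloring K c' \<and> umeas c' < umeas c \<and>
    dist_col c c' \<le> real (2 * i + 4 * L + 11) * (umeas c - umeas c')"
proof -
  note pc = pc[OF mc]
  let ?C = "detour_edges c a b i g h L"
  obtain M where M: "M \<in> sets P" "M \<subseteq> E" "sym M" "single_valued M" "measure EM M > 0"
    "M \<inter> S \<times> UNIV \<subseteq> ?C" and M0: "\<And>e. e \<in> M \<Longrightarrow> c e = 0"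
  proof (rule ex_matching_subset[OF mc])
    show "?C \<in> sets P" by (rule detour_edges_sets[OF mc a(1) b(1) g(1) h(1)])
    show "?C \<subseteq> uncolored c" unfolding detour_edges_def by blast
    show "?C \<subseteq> S \<times> UNIV" unfolding detour_edges_def by blast
  qed (use pos in auto)
  let ?w = "\<lambda>j. chain c a b j" and ?Q = "Domain M \<inter> S"
  have pr: "missing c b y" "missing c a x" "run c a b i y" "missing c g (?w i y)"
    "missing c h (?w (Suc i) y)" "\<not> run c g h (Suc L) (?w (Suc i) y)"
    if "(y, x) \<in> M" "y \<in> S" for x y
    using that M(6) unfolding detour_edges_def by blast+
  have Qb: "missing c b y" and Qr: "run c a b i y" if "y \<in> ?Q" for y
    using that pr by blast+
  have Q: "?Q \<in> sets \<nu>" using Domain_sets[OF M(1,2)] S_sets by blast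
  define W where "W = ?w i ` ?Q"
  have W: "W \<in> sets \<nu>" "emeasure \<nu> W = emeasure \<nu> ?Q"
    using chain_image[OF mc a(1) b(1) Q] unfolding W_def by blast+
  have WS: "v \<in> S" if "v \<in> W" for v
    using that chain_side[OF pc a(1) b(1) Qr] i unfolding W_def by blast
  \<comment> \<open>The edges \<open>vu\<close> at the cut vertices. Having one common color, no two
    of them share a vertex.\<close>
  define F where "F = {e. c e = a \<and> (fst e \<in> W \<or> snd e \<in> W)}"
  let ?A = "{e. c e = a} \<inter> W \<times> space \<nu>"
  have A: "?A \<in> sets P" using color_class_sets[OF mc a(1)] W(1) by auto
  have Ea: "{e. c e = a} \<subseteq> E" by (rule color_class_subset[OF mc a(1)])
  have F_eq: "F = ?A \<union> ?A\<inverse>"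
    using Ea E_subset color_sym[OF pc] unfolding F_def by auto
  have F: "F \<in> sets P" "F \<subseteq> E" "sym F" "single_valued F"
  proof -
    show "F \<in> sets P" unfolding F_eq using A converse_sets by blast
    show "F \<subseteq> E" using Ea unfolding F_def by blast
    show "sym F" unfolding F_eq by (auto simp: sym_def)
    show "single_valued F"
      by (rule single_valued_subset[OF _ color_class_single_valued[OF mc a(1)]]) (auto simp: F_def)
  qed
  have F_meas: "measure EM F \<le> 2 * measure EM M"
  proof -
    have "emeasure EM ?A = emeasure \<nu> (Domain ?A)"
      using A Ea by (intro EM_single_valued single_valued_subset[OF _ color_class_single_valued[OF mc a(1)]]) auto
    also have "\<dots> \<le> emeasure \<nu> W" using W(1) by (intro emeasure_mono) auto
    also have "\<dots> \<le> emeasure \<nu> (Domain M)"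
      unfolding W(2) using Domain_sets[OF M(1,2)] by (intro emeasure_mono) auto
    also have "\<dots> = emeasure EM M" using EM_single_valued[OF M(1,2,4)] by simp
    finally have "measure EM ?A \<le> measure EM M" by (simp add: EM.emeasure_eq_measure)
    moreover have "measure EM (?A\<inverse>) = measure EM ?A" using EM_converse[OF A] by (simp add: measure_def)
    moreover have "measure EM F \<le> measure EM ?A + measure EM (?A\<inverse>)"
      unfolding F_eq using A converse_sets[OF A] by (intro measure_Un_le) auto
    ultimately show ?thesis by simp
  qed
  \<comment> \<open>Without \<open>F\<close> every first chain stops at its \<open>i\<close>-th
    vertex, so coloring \<open>M\<close> swaps along at most \<open>i\<close> steps.\<close>
  define c1 where "c1 e = (if e \<in> F then 0 else c e)" for e
  have Fflip: "(x, y) \<in> F \<longleftrightarrow> (y, x) \<in> F" for x y using F(3) by (auto dest: symD)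
  have c1_eq: "c1 e = j \<Longrightarrow> j \<noteq> 0 \<Longrightarrow> c e = j" for e j by (simp add: c1_def split: if_splits)
  have pc1: "partial_coloring E K c1"
    unfolding partial_coloring_def
  proof (intro conjI allI impI)
    show "c1 e \<le> K" for e using color_le[OF pc] by (simp add: c1_def)
    show "e \<in> E" if "c1 e \<noteq> 0" for e
      using that color_edge[OF pc, of "fst e" "snd e"] by (simp add: c1_def split: if_splits)
    show "c1 (x, y) = c1 (y, x)" for x y
      using Fflip[of x y] color_sym[OF pc, of x y] unfolding c1_def by presburger
    show "y = z" if "c1 (x, y) = c1 (x, z) \<and> c1 (x, y) \<noteq> 0" for x y z
    proof -
      have "c (x, y) = c1 (x, y)" "c (x, z) = c1 (x, y)" using that c1_eq by metis+
      then show ?thesis using color_unique[OF pc, of x y z] that by metis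
    qed
  qed
  have mc1: "measurable_coloring K c1"
    unfolding measurable_coloring_def
  proof (intro conjI allI impI pc1)
    fix j :: nat assume j: "j \<noteq> 0"
    have "{e. c1 e = j} = {e. c e = j} - F" using j by (auto simp: c1_def)
    then show "{e. c1 e = j} \<in> sets P" using color_class_sets[OF mc j] F(1) by auto
  qed
  have chain1: "chain c1 a b j y = ?w j y" if y: "y \<in> ?Q" and "j \<le> i" for j y
    using \<open>j \<le> i\<close>
  proof (induction j)
    case (Suc j)
    let ?t = "if even j then a else b"
    have t: "?t \<noteq> 0" using a b by simp
    have runj: "run c a b j y" "run c a b (Suc j) y" using run_mono[OF Qr[OF y]] Suc.prems by simp_all
    have "\<not> missing c ?t (?w j y)"
      using runj(2) cnbr_missing[OF pc, of ?t "?w j y"] unfolding run_Suc chain.simps by blast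
    then have ct: "c (?w j y, ?w (Suc j) y) = ?t" unfolding chain.simps by (rule color_cnbr[OF pc])
    \<comment> \<open>By \<open>chain_inj\<close> a chain meets \<open>W\<close> only at position
      \<open>i\<close>. Before that, only the step into the \<open>i\<close>-th vertex touches
      \<open>W\<close>, and as \<open>i\<close> is even it has color \<open>b\<close>, whereas
      \<open>F\<close> has color \<open>a\<close>. If \<open>a = b\<close>, the chain could not even
      leave \<open>y\<close>.\<close>
    have "(?w j y, ?w (Suc j) y) \<notin> F"
    proof
      assume "(?w j y, ?w (Suc j) y) \<in> F"
      then have Fc: "c (?w j y, ?w (Suc j) y) = a" "?w j y \<in> W \<or> ?w (Suc j) y \<in> W"
        unfolding F_def mem_Collect_eq fst_conv snd_conv by blast+
      have ta: "?t = a" by (rule trans[OF ct[symmetric] Fc(1)])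
      from Fc(2) consider z where "z \<in> ?Q" "?w j y = ?w i z" | z where "z \<in> ?Q" "?w (Suc j) y = ?w i z"
        unfolding W_def by blast
      then show False
      proof cases
        case 1
        from chain_inj[OF pc a(1) b(1) Qb[OF y] Qb[OF 1(1)] _ runj(1) Qr[OF 1(1)] 1(2)]
        show False using y 1(1) Suc.prems by simp
      next
        case 2
        from chain_inj[OF pc a(1) b(1) Qb[OF y] Qb[OF 2(1)] _ runj(2) Qr[OF 2(1)] 2(2)]
        have "Suc j = i" using y 2(1) by simp
        then have "?t = b" "odd j" using i by auto
        then have "a = b" using ta by metis
        then have "missing c a y" using Qb[OF y] by simp
        then have "?w 1 y = ?w 0 y" using cnbr_missing[OF pc] by simp
        moreover have "run c a b (Suc 0) y" using run_mono[OF Qr[OF y]] Suc.prems by simp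
        ultimately show False by (simp add: run_Suc)
      qed
    qed
    then have "c1 (?w j y, ?w (Suc j) y) = ?t" using ct by (simp only: c1_def if_False)
    then have "cnbr c1 ?t (?w j y) = ?w (Suc j) y" using t by (rule cnbr_eq[OF pc1])
    then show ?case using Suc.IH Suc.prems by simp
  qed simp
  have stop1: "\<not> run c1 a b (Suc i) y" if y: "y \<in> ?Q" for y
  proof -
    have "missing c1 a (?w i y)"
      unfolding missing_def
    proof (intro allI notI)
      fix z assume z: "c1 (?w i y, z) = a"
      then have "c (?w i y, z) = a" using c1_eq a(1) by blast
      then have "(?w i y, z) \<in> F" using y unfolding F_def W_def by auto
      then show False using z a(1) by (simp add: c1_def)
    qed
    then have "chain c1 a b (Suc i) y = chain c1 a b i y"
      using i chain1[OF y order_refl] cnbr_missing[OF pc1] by simp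
    then show ?thesis by (simp only: run_Suc not_False_eq_True simp_thms)
  qed
  have M1: "c1 e = 0" if "e \<in> M" for e using M0[OF that] by (simp add: c1_def)
  have miss1: "missing c1 b y \<and> missing c1 a x" if "(y, x) \<in> M" "y \<in> S" for x y
    using pr(1,2)[OF that] c1_eq a(1) b(1) unfolding missing_def by blast
  define c2 where "c2 = augment c1 a b S M"
  have mc2: "measurable_coloring K c2" "dist_col c1 c2 \<le> real (2 * i + 3) * measure EM M"
    unfolding c2_def dist_col_def
    using augment_measurable(1,2)[OF mc1 a b M(2-4) M1 M(1) miss1, where k = i] stop1 by blast+
  have c2_0: "c2 e = 0 \<longleftrightarrow> c1 e = 0 \<and> e \<notin> M" for e
    unfolding c2_def by (rule augment_partial_coloring(2)[OF pc1 a b M(2-4) M1 miss1])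
  have cls: "{e. c e = k} = {e. c2 e = k}" if k: "k \<noteq> 0" "k \<notin> {a, b}" for k
  proof -
    have "{e. c e = k} = {e. c1 e = k}" using k by (auto simp: c1_def F_def)
    also have "\<dots> = {e. c2 e = k}"
      unfolding c2_def by (rule augment_other_color) (use k M1 in auto)
    finally show ?thesis .
  qed
  note cls_g = cls[OF g(1,3)] and cls_h = cls[OF h(1,3)]
  interpret opp: borel_graph \<nu> E "space \<nu> - S" d G by (rule opposite_side_graph)
  \<comment> \<open>The end of a cut edge outside \<open>S\<close> is the next vertex
    \<open>u\<close> of the chain that was cut, so the conditions in \<open>detour_edges\<close>
    speak about it; they survive into \<open>c2\<close> because the classes of \<open>g\<close> and
    \<open>h\<close> are unchanged.\<close>
  have F_start: "missing c2 h u \<and> missing c2 g v" "\<not> run c2 g h (Suc L) u"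
    if "(u, v) \<in> F" "u \<in> space \<nu> - S" for u v
  proof -
    have uv: "c (u, v) = a" "u \<in> W \<or> v \<in> W" using that(1) by (auto simp: F_def)
    then have "v \<in> W" using WS that(2) by blast
    then obtain y x where y: "(y, x) \<in> M" "y \<in> S" "v = ?w i y" unfolding W_def by blast
    have "c (v, u) = a" using uv(1) color_sym[OF pc, of u v] by simp
    then have u: "u = ?w (Suc i) y" using cnbr_eq[OF pc _ a(1)] y(3) i by simp
    show "missing c2 h u \<and> missing c2 g v"
      using pr(4,5)[OF y(1,2)] missing_cong[OF cls_g] missing_cong[OF cls_h] u y(3) by blast
    show "\<not> run c2 g h (Suc L) u"
      using pr(6)[OF y(1,2)] run_cong[OF cls_g cls_h] u by blast
  qed
  have F0: "c2 e = 0" if "e \<in> F" for e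
  proof -
    have "e \<notin> M" using that M0[of e] a(1) by (auto simp: F_def)
    then show ?thesis using that by (simp add: c2_0 c1_def)
  qed
  define c3 where "c3 = augment c2 g h (space \<nu> - S) F"
  have mc3: "measurable_coloring K c3" "dist_col c2 c3 \<le> real (2 * L + 3) * measure EM F"
    unfolding c3_def dist_col_def
    by (rule opp.augment_measurable(1,2)[OF mc2(1) g(1,2) h(1,2) F(2-4) F0 F(1) F_start]; assumption)+
  have c3_0: "c3 e = 0 \<longleftrightarrow> c2 e = 0 \<and> e \<notin> F" for e
    unfolding c3_def
    by (rule opp.augment_partial_coloring(2)[OF _ g(1,2) h(1,2) F(2-4) F0 F_start(1)])
      (rule measurable_coloringD(1)[OF mc2(1)])
  have "uncolored c3 = uncolored c - M"
  proof -
    have "c3 e = 0 \<longleftrightarrow> c e = 0 \<and> e \<notin> M" for e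
      using a(1) unfolding c3_0 c2_0 c1_def F_def by auto
    then show ?thesis unfolding uncolored_def by blast
  qed
  moreover have "M \<subseteq> uncolored c" unfolding uncolored_def using M(2) M0 by blast
  ultimately have u: "umeas c3 = umeas c - measure EM M"
    using measure_uncolored_Diff[OF mc M(1)] by blast
  have "dist_col c c1 \<le> measure EM F"
    unfolding dist_col_def using F(1) by (intro EM.finite_measure_mono) (auto simp: c1_def)
  moreover have "dist_col c c3 \<le> dist_col c c1 + (dist_col c1 c2 + dist_col c2 c3)"
    using dist_col_triangle[OF mc mc1 mc3(1)] dist_col_triangle[OF mc1 mc2(1) mc3(1)] by linarith
  ultimately have "dist_col c c3 \<le> measure EM F + (real (2 * i + 3) * measure EM M + real (2 * L + 3) * measure EM F)"
    using mc2(2) mc3(2) by linarith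
  also have "\<dots> = real (2 * L + 4) * measure EM F + real (2 * i + 3) * measure EM M"
    by (simp add: algebra_simps)
  also have "\<dots> \<le> real (2 * L + 4) * (2 * measure EM M) + real (2 * i + 3) * measure EM M"
    using F_meas by (intro add_right_mono mult_left_mono) auto
  also have "\<dots> = real (2 * i + 4 * L + 11) * measure EM M" by (simp add: algebra_simps)
  finally have "dist_col c c3 \<le> real (2 * i + 4 * L + 11) * measure EM M" .
  then show ?thesis
    using mc3(1) u M(5) by (intro exI[of _ c3]) simp
qed

section \<open>Bounding the uncolored edges\<close>

lemma EM_section_bound:
  assumes R: "R \<in> sets \<nu>"
  shows "measure EM (E \<inter> R \<times> space \<nu>) \<le> d * prob R"
proof -
  have s: "E \<inter> R \<times> space \<nu> \<in> sets P" using E_sets R by auto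
  have "section_count (E \<inter> R \<times> space \<nu>) x \<le> of_nat d * indicator R x" for x
  proof (cases "x \<in> R")
    case True
    then show ?thesis using section_count_le[of _ x] by simp
  next
    case False
    then have "(E \<inter> R \<times> space \<nu> \<inter> E) `` {x} = {}" by blast
    then show ?thesis by (simp add: section_count_def)
  qed
  then have "emeasure EM (E \<inter> R \<times> space \<nu>) \<le> (\<integral>\<^sup>+x. of_nat d * indicator R x \<partial>\<nu>)"
    unfolding emeasure_EM[OF s] by (rule nn_integral_mono)
  also have "\<dots> = of_nat d * emeasure \<nu> R" using R by (simp add: nn_integral_cmult_indicator)
  also have "\<dots> = ennreal (d * prob R)"
    by (simp add: emeasure_eq_measure ennreal_mult ennreal_of_nat_eq_real_of_nat)
  finally show ?thesis by (simp add: EM.emeasure_eq_measure)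
qed

text \<open>\<open>cov\<close> assigns a pair of colors to almost every uncolored edge oriented out
  of \<open>S\<close>. The factor 2 accounts for the reversed edges, \<open>K * K\<close> for the
  pairs, and \<open>d\<close> for the edges at a vertex of \<open>R a b\<close>.\<close>

lemma uncolored_bound:
  fixes r :: real
  assumes mc: "measurable_coloring K c" and R: "\<And>a b. a \<in> {1..K} \<Longrightarrow> b \<in> {1..K} \<Longrightarrow> R a b \<in> sets \<nu>"
    and N: "N \<in> null_sets EM"
    and cov: "\<And>x y. (y, x) \<in> uncolored c \<Longrightarrow> y \<in> S \<Longrightarrow> (y, x) \<notin> N \<Longrightarrow> \<exists>a\<in>{1..K}. \<exists>b\<in>{1..K}. y \<in> R a b"
    and r: "\<And>a b. a \<in> {1..K} \<Longrightarrow> b \<in> {1..K} \<Longrightarrow> prob (R a b) \<le> r"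
  shows "umeas c \<le> 2 * (K * (K * (d * r)))"
proof -
  note us = uncolored_in_sets[OF mc]
  let ?U = "uncolored c \<inter> S \<times> space \<nu>"
  have Us: "?U \<in> sets P" using us S_sets by auto
  have flip: "(y, x) \<in> uncolored c" if "(x, y) \<in> uncolored c" for x y
    using that symE color_sym[OF pc[OF mc], of x y] unfolding uncolored_def by (auto dest: symD)
  have "uncolored c \<subseteq> ?U \<union> ?U\<inverse>"
  proof
    fix e assume e: "e \<in> uncolored c"
    obtain x y where xy: "e = (x, y)" by (cases e)
    have "(x, y) \<in> E" using e xy uncolored_subset by blast
    then have "x \<in> space \<nu>" "y \<in> space \<nu>" "x \<in> S \<or> y \<in> S" using E_subset side by blast+
    then show "e \<in> ?U \<union> ?U\<inverse>" using e flip[of x y] xy by blast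
  qed
  then have "umeas c \<le> measure EM (?U \<union> ?U\<inverse>)"
    using Us converse_sets[OF Us] by (intro EM.finite_measure_mono) auto
  also have "\<dots> \<le> measure EM ?U + measure EM (?U\<inverse>)"
    using Us converse_sets[OF Us] by (intro measure_Un_le) auto
  also have "measure EM (?U\<inverse>) = measure EM ?U" using EM_converse[OF Us] by (simp add: measure_def)
  finally have half: "umeas c \<le> 2 * measure EM ?U" by simp
  let ?B = "\<lambda>a b. E \<inter> R a b \<times> space \<nu>"
  have Bs: "?B a b \<in> sets EM" if "a \<in> {1..K}" "b \<in> {1..K}" for a b
    using E_sets R[OF that] by auto
  have Bs': "(\<Union>b\<in>{1..K}. ?B a b) \<in> sets EM" if "a \<in> {1..K}" for a
    using Bs that by (intro sets.finite_UN) auto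
  have sub: "?U \<subseteq> N \<union> (\<Union>a\<in>{1..K}. \<Union>b\<in>{1..K}. ?B a b)"
  proof
    fix e assume e: "e \<in> ?U"
    obtain y x where yx: "e = (y, x)" by (cases e)
    have u: "(y, x) \<in> uncolored c" "y \<in> S" "x \<in> space \<nu>" "(y, x) \<in> E"
      using e yx uncolored_subset by blast+
    show "e \<in> N \<union> (\<Union>a\<in>{1..K}. \<Union>b\<in>{1..K}. ?B a b)"
      using cov[OF u(1,2)] u(3,4) unfolding yx by blast
  qed
  have Ns: "N \<in> sets EM" using N by blast
  have Ds: "(\<Union>a\<in>{1..K}. \<Union>b\<in>{1..K}. ?B a b) \<in> sets EM"
    by (rule sets.finite_UN[OF _ Bs']) simp
  have "measure EM ?U \<le> measure EM (N \<union> (\<Union>a\<in>{1..K}. \<Union>b\<in>{1..K}. ?B a b))"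
    by (rule EM.finite_measure_mono[OF sub sets.Un[OF Ns Ds]])
  also have "\<dots> \<le> measure EM N + measure EM (\<Union>a\<in>{1..K}. \<Union>b\<in>{1..K}. ?B a b)"
    by (rule measure_Un_le[OF Ns Ds])
  also have "measure EM N = 0" using N by (simp add: measure_def null_setsD1)
  also have "measure EM (\<Union>a\<in>{1..K}. \<Union>b\<in>{1..K}. ?B a b) \<le> (\<Sum>a\<in>{1..K}. measure EM (\<Union>b\<in>{1..K}. ?B a b))"
    by (rule EM.finite_measure_subadditive_finite) (use Bs' in blast)+
  also have "\<dots> \<le> (\<Sum>a\<in>{1..K}. \<Sum>b\<in>{1..K}. measure EM (?B a b))"
    by (rule sum_mono, rule EM.finite_measure_subadditive_finite) (use Bs in blast)+
  also have "\<dots> \<le> (\<Sum>a\<in>{1..K}. \<Sum>b\<in>{1..K}. d * r)"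
    by (rule sum_mono, rule sum_mono, rule order_trans[OF EM_section_bound[OF R] mult_left_mono[OF r]]) auto
  also have "\<dots> = K * (K * (d * r))" by simp
  finally show ?thesis using half by simp
qed

text \<open>A chain with \<open>Suc L\<close> proper steps has \<open>L + 2\<close> vertices, so by
  \<open>chain_packing\<close> the chains that are too long start on a set of measure at most
  \<open>1 / real (L + 2)\<close> for each pair of colors.\<close>

lemma short_count:
  assumes mc: "measurable_coloring K c" and K: "\<And>x. card (E `` {x}) \<le> K"
    and null: "\<And>a b. a \<in> {1..K} \<Longrightarrow> b \<in> {1..K} \<Longrightarrow> measure EM (short_edges c a b L) = 0"
  shows "umeas c \<le> 2 * (K * (K * (d * (1 / real (L + 2)))))"
proof -
  define R where "R a b = S \<inter> {y \<in> space \<nu>. missing c b y} \<inter> {y \<in> space \<nu>. run c a b (Suc L) y}" for a b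
  define N where "N = (\<Union>a\<in>{1..K}. \<Union>b\<in>{1..K}. short_edges c a b L)"
  show ?thesis
  proof (rule uncolored_bound[OF mc, where R = R and N = N])
    show Rs: "R a b \<in> sets \<nu>" if "a \<in> {1..K}" "b \<in> {1..K}" for a b
      unfolding R_def using that S_sets missing_sets[OF mc] run_sets[OF mc] by (intro sets.Int) auto
    have "short_edges c a b L \<in> null_sets EM" if "a \<in> {1..K}" "b \<in> {1..K}" for a b
      using null[OF that] short_edges_sets[OF mc] that by (auto simp: EM.emeasure_eq_measure)
    then show "N \<in> null_sets EM" unfolding N_def by (intro null_sets_UN') auto
    show "\<exists>a\<in>{1..K}. \<exists>b\<in>{1..K}. y \<in> R a b"
      if yx: "(y, x) \<in> uncolored c" "y \<in> S" "(y, x) \<notin> N" for x y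
    proof -
      have E: "(y, x) \<in> E" "c (y, x) = 0" "(x, y) \<in> E" "c (x, y) = 0" "y \<in> space \<nu>"
        using yx(1) symE color_sym[OF pc[OF mc], of x y] E_subset unfolding uncolored_def by (auto dest: symD)
      obtain b where b: "b \<noteq> 0" "b \<le> K" "missing c b y"
        using ex_missing[OF pc[OF mc] fin_deg] K E(1,2) by blast
      obtain a where a: "a \<noteq> 0" "a \<le> K" "missing c a x"
        using ex_missing[OF pc[OF mc] fin_deg] K E(3,4) by blast
      have ab: "a \<in> {1..K}" "b \<in> {1..K}" using a b by auto
      have "(y, x) \<notin> short_edges c a b L" using yx(3) ab unfolding N_def by blast
      then have "run c a b (Suc L) y" using yx a b unfolding short_edges_def by blast
      then have "y \<in> R a b" using yx(2) b(3) E(5) unfolding R_def by blast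
      then show ?thesis using ab by blast
    qed
    show "prob (R a b) \<le> 1 / real (L + 2)" if ab: "a \<in> {1..K}" "b \<in> {1..K}" for a b
    proof -
      have "prob (\<Union>i\<in>{..Suc L}. chain c a b i ` R a b) = card {..Suc L} * prob (R a b)"
      proof (rule chain_packing[OF mc _ _ Rs[OF ab]])
        show "run c a b i y" if "y \<in> R a b" "i \<in> {..Suc L}" for y i
          using that run_mono[of c a b "Suc L" y i] unfolding R_def by simp
      qed (use ab in \<open>auto simp: R_def\<close>)
      then have "card {..Suc L} * prob (R a b) \<le> 1" by (metis prob_le_1)
      then show ?thesis by (simp add: field_simps)
    qed
  qed
qed

text \<open>The gain over \<open>short_count\<close>: about \<open>l\<close> vertices of every first chain start a second chain of
  length more than \<open>2 * l\<close>, and as each of these vertices is an endpoint of its second chain, all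
  these chains are disjoint by \<open>chain_packing\<close>. Hence a bound of order \<open>1 / l\<^sup>2\<close>, which makes the total
  change summable in \<open>ex_almost_full_coloring\<close>.\<close>

lemma detour_count:
  assumes mc: "measurable_coloring K c" and K: "\<And>x. card (E `` {x}) < K" and l: "1 \<le> l"
    and null1: "\<And>a b. a \<in> {1..K} \<Longrightarrow> b \<in> {1..K} \<Longrightarrow> measure EM (short_edges c a b (2 * l + 1)) = 0"
    and null2: "\<And>a b i g h. a \<in> {1..K} \<Longrightarrow> b \<in> {1..K} \<Longrightarrow> i \<in> {1..l} \<Longrightarrow>
      g \<in> {1..K} - {a, b} \<Longrightarrow> h \<in> {1..K} - {a, b} \<Longrightarrow>
      measure EM (detour_edges c a b (2 * i) g h (2 * l + 1)) = 0"
  shows "umeas c \<le> 2 * (K * (K * (d * (real K * real K / (real l)\<^sup>2))))"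
proof -
  note pc = pc[OF mc]
  let ?L = "2 * l + 1"
  define N where "N = (\<Union>a\<in>{1..K}. \<Union>b\<in>{1..K}. short_edges c a b ?L \<union>
    (\<Union>i\<in>{1..l}. \<Union>g\<in>{1..K} - {a, b}. \<Union>h\<in>{1..K} - {a, b}. detour_edges c a b (2 * i) g h ?L))"
  have N: "N \<in> null_sets EM"
  proof -
    have "short_edges c a b ?L \<in> null_sets EM" if "a \<in> {1..K}" "b \<in> {1..K}" for a b
      using null1[OF that] short_edges_sets[OF mc] that by (auto simp: EM.emeasure_eq_measure)
    moreover have "detour_edges c a b (2 * i) g h ?L \<in> null_sets EM"
      if "a \<in> {1..K}" "b \<in> {1..K}" "i \<in> {1..l}" "g \<in> {1..K} - {a, b}" "h \<in> {1..K} - {a, b}" for a b i g h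
      using null2[OF that] detour_edges_sets[OF mc] that by (auto simp: EM.emeasure_eq_measure)
    ultimately show ?thesis
      unfolding N_def by (intro null_sets_UN' null_sets.Un) auto
  qed
  \<comment> \<open>Off \<open>N\<close> neither improvement applies: first chains are long, and so
    are the second chains from the chosen positions, for all admissible colors.\<close>
  define U where "U = uncolored c \<inter> S \<times> space \<nu> - N"
  have Us: "U \<in> sets P" unfolding U_def using uncolored_in_sets[OF mc] S_sets N by auto
  have UE: "U \<subseteq> E" using uncolored_subset unfolding U_def by blast
  define R where "R a b = Domain (U \<inter> space \<nu> \<times> {x \<in> space \<nu>. missing c a x}) \<inter> {y \<in> space \<nu>. missing c b y}"
    for a b
  \<comment> \<open>Starting points of long second chains. Packing \<open>2 * l + 3\<close> vertices
    per chain bounds each set; \<open>1 / l\<close> is a convenient weakening.\<close>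
  define T where "T g h = {u \<in> space \<nu>. missing c h u} \<inter> {u \<in> space \<nu>. run c g h (Suc ?L) u} - S" for g h
  have ab0: "a \<noteq> 0" if "a \<in> {1..K}" for a using that by simp
  have Rs: "R a b \<in> sets \<nu>" if ab: "a \<in> {1..K}" "b \<in> {1..K}" for a b
  proof -
    have "U \<inter> space \<nu> \<times> {x \<in> space \<nu>. missing c a x} \<in> sets P"
      using Us missing_sets[OF mc ab0[OF ab(1)]] by auto
    then show ?thesis
      unfolding R_def using UE by (intro sets.Int[OF Domain_sets missing_sets[OF mc ab0[OF ab(2)]]]) auto
  qed
  have Rprop: "\<exists>x. (y, x) \<in> U \<and> missing c a x" "y \<in> S" "missing c b y" "run c a b (Suc ?L) y"
    if ab: "a \<in> {1..K}" "b \<in> {1..K}" and y: "y \<in> R a b" for a b y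
  proof -
    obtain x where x: "(y, x) \<in> U" "missing c a x" using y unfolding R_def by blast
    then show "\<exists>x. (y, x) \<in> U \<and> missing c a x" by blast
    show "y \<in> S" using x(1) unfolding U_def by blast
    show "missing c b y" using y unfolding R_def by blast
    have "(y, x) \<notin> short_edges c a b ?L" using x(1) ab unfolding U_def N_def by blast
    then show "run c a b (Suc ?L) y"
      using x \<open>y \<in> S\<close> \<open>missing c b y\<close> unfolding short_edges_def U_def by blast
  qed
  have Ts: "T g h \<in> sets \<nu>" "prob (T g h) \<le> 1 / l" if gh: "g \<in> {1..K}" "h \<in> {1..K}" for g h
  proof -
    show Ts: "T g h \<in> sets \<nu>"
      unfolding T_def using missing_sets[OF mc] run_sets[OF mc] S_sets gh by (intro sets.Int sets.Diff) auto
    have "prob (\<Union>i\<in>{..Suc ?L}. chain c g h i ` T g h) = card {..Suc ?L} * prob (T g h)"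
    proof (rule chain_packing[OF mc _ _ Ts])
      show "run c g h i y" if "y \<in> T g h" "i \<in> {..Suc ?L}" for y i
        using that run_mono[of c g h "Suc ?L" y i] unfolding T_def by simp
    qed (use gh in \<open>auto simp: T_def\<close>)
    then have "card {..Suc ?L} * prob (T g h) \<le> 1" by (metis prob_le_1)
    moreover have "l * prob (T g h) \<le> card {..Suc ?L} * prob (T g h)"
      by (intro mult_right_mono) auto
    ultimately have "l * prob (T g h) \<le> 1" by linarith
    then show "prob (T g h) \<le> 1 / l" using l by (simp add: field_simps)
  qed
  have R_T: "chain c a b (Suc (2 * i)) y \<in> (\<Union>g\<in>{1..K}. \<Union>h\<in>{1..K}. T g h)"
    if ab: "a \<in> {1..K}" "b \<in> {1..K}" and y: "y \<in> R a b" and i: "i \<in> {1..l}" for a b y i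
  proof -
    note Ry = Rprop[OF ab y]
    let ?v = "chain c a b (2 * i) y" and ?u = "chain c a b (Suc (2 * i)) y"
    have r: "run c a b j y" if "j \<le> 2 * i + 2" for j
      using run_mono[OF Ry(4), of j] that i by simp
    have step: "\<not> missing c (if even j then a else b) (chain c a b j y)"
      "\<not> missing c (if even j then a else b) (chain c a b (Suc j) y)" if "j \<le> 2 * i + 1" for j
    proof -
      let ?t = "if even j then a else b"
      have t: "?t \<noteq> 0" using ab by simp
      have "run c a b (Suc j) y" using r that by simp
      then show n: "\<not> missing c ?t (chain c a b j y)"
        using cnbr_missing[OF pc, of ?t "chain c a b j y"] unfolding run_Suc chain.simps by blast
      then have "c (chain c a b j y, chain c a b (Suc j) y) = ?t"
        unfolding chain.simps by (rule color_cnbr[OF pc])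
      then have "c (chain c a b (Suc j) y, chain c a b j y) = ?t"
        using color_sym[OF pc] by metis
      then show "\<not> missing c ?t (chain c a b (Suc j) y)" unfolding missing_def by blast
    qed
    \<comment> \<open>The vertices at positions \<open>2 * i\<close> and \<open>2 * i + 1\<close>
      are strictly inside the first chain, because \<open>1 \<le> i \<le> l\<close> and the chain
      makes at least \<open>2 * l + 2\<close> steps (whence the choice of \<open>?L\<close>). They
      carry both \<open>a\<close> and \<open>b\<close>, so the colors \<open>g\<close> and
      \<open>h\<close> missing there differ from both.\<close>
    obtain m where m: "i = Suc m" using i by (cases i) auto
    define k where "k = Suc (2 * m)"
    have k: "2 * i = Suc k" "odd k" by (simp_all add: k_def m)
    have v: "\<not> missing c a ?v" "\<not> missing c b ?v"
      using step(1)[of "2 * i"] step(2)[of k] k by simp_all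
    have u: "\<not> missing c a ?u" "\<not> missing c b ?u"
      using step(2)[of "2 * i"] step(1)[of "Suc (2 * i)"] by simp_all
    obtain g where g: "g \<noteq> 0" "g \<le> K" "missing c g ?v"
      using ex_missing[OF pc fin_deg, of ?v] K by blast
    obtain h where h: "h \<noteq> 0" "h \<le> K" "missing c h ?u"
      using ex_missing[OF pc fin_deg, of ?u] K by blast
    have gh: "g \<in> {1..K} - {a, b}" "h \<in> {1..K} - {a, b}"
      using g h u v by (auto simp: Suc_le_eq)
    obtain x where x: "(y, x) \<in> U" "missing c a x" using Ry(1) by blast
    have "(y, x) \<notin> detour_edges c a b (2 * i) g h ?L"
      using x(1) ab i gh unfolding U_def N_def by blast
    then have "run c g h (Suc ?L) ?u"
      using x Ry(2,3) r[of "2 * i"] g(3) h(3) unfolding detour_edges_def U_def by simp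
    moreover have "?u \<notin> S"
      using chain_side[OF pc ab0[OF ab(1)] ab0[OF ab(2)] r[of "Suc (2 * i)"]] Ry(2) by simp
    moreover have "y \<in> space \<nu>" using y unfolding R_def by blast
    then have "?u \<in> space \<nu>" by (rule measurable_space[OF chain_measurable[OF mc ab0[OF ab(1)] ab0[OF ab(2)]]])
    ultimately have "?u \<in> T g h" using h(3) unfolding T_def by blast
    then show ?thesis using gh by blast
  qed
  have Rprob: "prob (R a b) \<le> real K * real K / (real l)\<^sup>2" if ab: "a \<in> {1..K}" "b \<in> {1..K}" for a b
  proof -
    \<comment> \<open>The images of \<open>R a b\<close> at the \<open>l\<close> odd positions are
      disjoint and all lie in the union of the sets \<open>T g h\<close>, so \<open>l\<close> times
      the measure of \<open>R a b\<close> is at most \<open>K * K / l\<close>.\<close>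
    let ?I = "(\<lambda>i. Suc (2 * i)) ` {1..l}"
    have cardI: "card ?I = l" by (subst card_image) (auto simp: inj_on_def)
    have "prob (\<Union>j\<in>?I. chain c a b j ` R a b) = card ?I * prob (R a b)"
    proof (rule chain_packing[OF mc ab0[OF ab(1)] ab0[OF ab(2)] Rs[OF ab]])
      show "run c a b j y" if "y \<in> R a b" "j \<in> ?I" for y j
        using run_mono[OF Rprop(4)[OF ab that(1)], of j] that(2) by auto
    qed (use Rprop[OF ab] in auto)
    then have "l * prob (R a b) = prob (\<Union>j\<in>?I. chain c a b j ` R a b)" unfolding cardI by simp
    also have "\<dots> \<le> prob (\<Union>g\<in>{1..K}. \<Union>h\<in>{1..K}. T g h)"
      using R_T[OF ab] Ts by (intro finite_measure_mono sets.finite_UN) auto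
    also have "\<dots> \<le> (\<Sum>g\<in>{1..K}. prob (\<Union>h\<in>{1..K}. T g h))"
      using Ts by (intro finite_measure_subadditive_finite) (auto intro!: sets.finite_UN)
    also have "\<dots> \<le> (\<Sum>g\<in>{1..K}. \<Sum>h\<in>{1..K}. prob (T g h))"
      using Ts by (intro sum_mono finite_measure_subadditive_finite) auto
    also have "\<dots> \<le> (\<Sum>g\<in>{1..K}. \<Sum>h\<in>{1..K}. 1 / l)"
      using Ts by (intro sum_mono) auto
    also have "\<dots> = real K * real K / real l" by simp
    finally show ?thesis using l by (simp add: field_simps power2_eq_square)
  qed
  show ?thesis
  proof (rule uncolored_bound[OF mc, where R = R and N = N])
    show "R a b \<in> sets \<nu>" "prob (R a b) \<le> real K * real K / (real l)\<^sup>2"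
      if "a \<in> {1..K}" "b \<in> {1..K}" for a b
      using Rs[OF that] Rprob[OF that] by blast+
    show "N \<in> null_sets EM" by (rule N)
    show "\<exists>a\<in>{1..K}. \<exists>b\<in>{1..K}. y \<in> R a b"
      if yx: "(y, x) \<in> uncolored c" "y \<in> S" "(y, x) \<notin> N" for x y
    proof -
      have sp: "y \<in> space \<nu>" "x \<in> space \<nu>" using yx(1) uncolored_subset E_subset by blast+
      obtain b where b: "b \<noteq> 0" "b \<le> K" "missing c b y" using ex_missing[OF pc fin_deg] K by blast
      obtain a where a: "a \<noteq> 0" "a \<le> K" "missing c a x" using ex_missing[OF pc fin_deg] K by blast
      have "(y, x) \<in> U" using yx sp unfolding U_def by blast
      then have "y \<in> R a b" using a b sp unfolding R_def by blast
      then show ?thesis using a b by (intro bexI[of _ a] bexI[of _ b]) (auto simp: Suc_le_eq)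
    qed
  qed
qed

section \<open>Limits of colorings\<close>

lemma dist_col_nonneg [simp]: "0 \<le> dist_col c c'"
  by (simp add: dist_col_def)

lemma dist_col_refl [simp]: "dist_col c c = 0"
  by (simp add: dist_col_def)

text \<open>The limit takes the eventual color of each edge, so \<open>f n\<close> can differ from
  it only where a later change occurs. Two edges reach their eventual colors at a common index,
  which transfers the conditions of a partial coloring.\<close>

lemma coloring_limit:
  assumes mc: "\<And>n. measurable_coloring K (f n)" and sm: "summable (\<lambda>n. dist_col (f n) (f (Suc n)))"
  obtains c where "measurable_coloring K c"
    "\<And>n. dist_col (f n) c \<le> (\<Sum>k. dist_col (f (k + n)) (f (Suc (k + n))))"
proof -
  define ev where "ev e i \<longleftrightarrow> (\<exists>N. \<forall>n\<ge>N. f n e = i)" for e i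
  have ev_unique: "i = j" if ij: "ev e i" "ev e j" for e i j
  proof -
    from ij(1) obtain N1 where "\<forall>n\<ge>N1. f n e = i" unfolding ev_def ..
    moreover from ij(2) obtain N2 where "\<forall>n\<ge>N2. f n e = j" unfolding ev_def ..
    ultimately have "f (max N1 N2) e = i" "f (max N1 N2) e = j" by (meson max.cobounded1 max.cobounded2)+
    then show ?thesis by metis
  qed
  \<comment> \<open>Edges whose color never settles become uncolored.\<close>
  define c where "c e = (if \<exists>i. ev e i then SOME i. ev e i else 0)" for e
  have c_ev: "ev e (c e)" if "ev e i" for e i
  proof -
    have "\<exists>i. ev e i" using that by blast
    from someI_ex[OF this] show ?thesis using \<open>\<exists>i. ev e i\<close> by (simp only: c_def if_True)
  qed
  have c_eq: "c e = i" if "ev e i" for e i using ev_unique[OF c_ev[OF that] that] .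
  have c_ev0: "ev e (c e)" if "c e \<noteq> 0" for e
    using that c_ev unfolding c_def by metis
  have pcf: "partial_coloring E K (f n)" for n by (rule measurable_coloringD(1)[OF mc])
  have common: "\<exists>n. f n e = c e \<and> f n e' = c e'" if "ev e (c e)" "ev e' (c e')" for e e'
  proof -
    from that(1) obtain N1 where "\<forall>n\<ge>N1. f n e = c e" unfolding ev_def ..
    moreover from that(2) obtain N2 where "\<forall>n\<ge>N2. f n e' = c e'" unfolding ev_def ..
    ultimately have "f (max N1 N2) e = c e \<and> f (max N1 N2) e' = c e'"
      by (meson max.cobounded1 max.cobounded2)
    then show ?thesis by (rule exI)
  qed
  have ev_sym: "ev (x, y) i \<longleftrightarrow> ev (y, x) i" for x y i
    unfolding ev_def color_sym[OF pcf, of _ x y] ..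
  have "partial_coloring E K c"
    unfolding partial_coloring_def
  proof (intro conjI allI impI)
    fix e
    show "c e \<le> K"
    proof (cases "c e = 0")
      case False
      then obtain n where "f n e = c e" using common[OF c_ev0 c_ev0] by blast
      then show ?thesis using color_le[OF pcf, of n e] by simp
    qed simp
  next
    fix e assume ne: "c e \<noteq> 0"
    then obtain n where n: "f n e = c e" using common[OF c_ev0 c_ev0] by blast
    obtain x y where e: "e = (x, y)" by (cases e)
    have "f n (x, y) \<noteq> 0" using n ne unfolding e by metis
    then show "e \<in> E" unfolding e by (rule color_edge[OF pcf])
  next
    fix x y show "c (x, y) = c (y, x)" unfolding c_def ev_sym[of x y] ..
  next
    fix x y z assume *: "c (x, y) = c (x, z) \<and> c (x, y) \<noteq> 0"
    then have "c (x, z) \<noteq> 0" by metis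
    then obtain n where n: "f n (x, y) = c (x, y)" "f n (x, z) = c (x, z)"
      using common[OF c_ev0 c_ev0, of "(x, y)" "(x, z)"] * by blast
    then have "f n (x, y) = f n (x, z)" "f n (x, y) \<noteq> 0" using * by metis+
    then show "y = z" by (rule color_unique[OF pcf])
  qed
  moreover have "{e. c e = i} \<in> sets P" if i: "i \<noteq> 0" for i
  proof -
    have "c e = i \<longleftrightarrow> ev e i" for e using c_eq c_ev0 i by metis
    then have "{e. c e = i} = (\<Union>N. \<Inter>n\<in>{N..}. {e. f n e = i})" unfolding ev_def by auto
    also have "\<dots> \<in> sets P"
      using measurable_coloringD(2)[OF mc i] by (intro sets.countable_nat_UN) (auto intro!: sets.countable_INT')
    finally show ?thesis .
  qed
  ultimately have c: "measurable_coloring K c" unfolding measurable_coloring_def by blast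
  have "dist_col (f n) c \<le> (\<Sum>k. dist_col (f (k + n)) (f (Suc (k + n))))" for n
  proof -
    let ?D = "\<lambda>k. {e. f (k + n) e \<noteq> f (Suc (k + n)) e}"
    have "{e. f n e \<noteq> c e} \<subseteq> (\<Union>k. ?D k)"
    proof
      fix e assume e: "e \<in> {e. f n e \<noteq> c e}"
      show "e \<in> (\<Union>k. ?D k)"
      proof (rule ccontr)
        assume "e \<notin> (\<Union>k. ?D k)"
        then have step: "f (k + n) e = f (Suc (k + n)) e" for k by blast
        have "f (k + n) e = f n e" for k
        proof (induction k)
          case (Suc k)
          then show ?case using step[of k] by simp
        qed simp
        then have "ev e (f n e)" unfolding ev_def by (intro exI[of _ n]) (metis le_add_diff_inverse2)
        then have "c e = f n e" by (rule c_eq)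
        then show False using e by simp
      qed
    qed
    then have "dist_col (f n) c \<le> measure EM (\<Union>k. ?D k)"
      unfolding dist_col_def using color_diff_sets[OF mc mc]
      by (intro EM.finite_measure_mono) (auto simp del: UN_iff)
    also have "\<dots> \<le> (\<Sum>k. measure EM (?D k))"
    proof (rule EM.finite_measure_subadditive_countably)
      show "range ?D \<subseteq> sets EM" using color_diff_sets[OF mc mc] by auto
      show "summable (\<lambda>k. measure EM (?D k))"
        using summable_ignore_initial_segment[OF sm, of n] by (simp add: dist_col_def)
    qed
    finally show ?thesis by (simp add: dist_col_def)
  qed
  then show ?thesis using c that by blast
qed

text \<open>Ekeland's variational principle: reachability at a price of at most
  \<open>\<Lambda>\<close> per unit of gain is transitive, and along a sequence of reachable
  colorings the prices telescope. So the distances are summable, and the limit is still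
  reachable.\<close>

lemma ex_unimprovable:
  assumes mc: "measurable_coloring K c" and L: "0 < \<Lambda>"
  obtains c' where "measurable_coloring K c'"
    "dist_col c c' \<le> \<Lambda> * (umeas c - umeas c')"
    "\<And>c''. measurable_coloring K c'' \<Longrightarrow>
       dist_col c' c'' \<le> \<Lambda> * (umeas c' - umeas c'') \<Longrightarrow>
       umeas c' \<le> umeas c''"
proof -
  define reach where "reach c = {c'. measurable_coloring K c' \<and> dist_col c c' \<le> \<Lambda> * (umeas c - umeas c')}" for c
  have reach_refl: "c \<in> reach c" if "measurable_coloring K c" for c
    using that by (simp add: reach_def)
  have reach_trans: "c3 \<in> reach c1" if "measurable_coloring K c1" "c2 \<in> reach c1" "c3 \<in> reach c2" for c1 c2 c3
  proof -
    have "dist_col c1 c3 \<le> dist_col c1 c2 + dist_col c2 c3"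
      using that by (intro dist_col_triangle) (auto simp: reach_def)
    also have "\<dots> \<le> \<Lambda> * (umeas c1 - umeas c2) + \<Lambda> * (umeas c2 - umeas c3)"
      using that by (intro add_mono) (auto simp: reach_def)
    also have "\<dots> = \<Lambda> * (umeas c1 - umeas c3)" by (simp add: algebra_simps)
    finally show ?thesis using that(3) by (simp add: reach_def)
  qed
  have reach_le: "umeas c2 \<le> umeas c1" if "c2 \<in> reach c1" for c1 c2
  proof -
    have "dist_col c1 c2 \<le> \<Lambda> * (umeas c1 - umeas c2)" using that by (simp add: reach_def)
    then have "0 \<le> \<Lambda> * (umeas c1 - umeas c2)" using dist_col_nonneg[of c1 c2] by linarith
    then show ?thesis using L by (simp add: zero_le_mult_iff)
  qed
  define I where "I c = Inf (umeas ` reach c)" for c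
  have bdd: "bdd_below (umeas ` reach c)" for c by (rule bdd_belowI[of _ 0]) auto
  \<comment> \<open>Each choice comes within \<open>1 / Suc n\<close> of the best value still
    reachable. What is reachable from the limit was reachable from every \<open>f n\<close>, so it
    cannot be better than the limit.\<close>
  have "\<exists>f. \<forall>n. (measurable_coloring K (f n) \<and> (n = 0 \<longrightarrow> f n = c)) \<and>
      (f (Suc n) \<in> reach (f n) \<and> umeas (f (Suc n)) < I (f n) + 1 / Suc n)"
  proof (rule dependent_nat_choice)
    show "\<exists>x. measurable_coloring K x \<and> (0 = (0::nat) \<longrightarrow> x = c)" using mc by blast
  next
    fix x :: "'a \<times> 'a \<Rightarrow> nat" and n :: nat
    assume x: "measurable_coloring K x \<and> (n = 0 \<longrightarrow> x = c)"
    have "umeas ` reach x \<noteq> {}" using reach_refl x by blast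
    then obtain y where y: "y \<in> reach x" "umeas y < I x + 1 / Suc n"
      using cInf_lessD[of "umeas ` reach x" "I x + 1 / Suc n"] unfolding I_def by auto
    then show "\<exists>y. (measurable_coloring K y \<and> (Suc n = 0 \<longrightarrow> y = c)) \<and>
        (y \<in> reach x \<and> umeas y < I x + 1 / Suc n)"
      unfolding reach_def by auto
  qed
  then obtain f where f: "\<forall>n. (measurable_coloring K (f n) \<and> (n = 0 \<longrightarrow> f n = c)) \<and>
      (f (Suc n) \<in> reach (f n) \<and> umeas (f (Suc n)) < I (f n) + 1 / Suc n)" ..
  have fm: "measurable_coloring K (f n)" and f0: "f 0 = c" and fr: "f (Suc n) \<in> reach (f n)"
    and fi: "umeas (f (Suc n)) < I (f n) + 1 / Suc n" for n
    using f by blast+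
  have dec: "decseq (\<lambda>n. umeas (f n))" using reach_le[OF fr] by (rule decseq_SucI)
  then obtain l where l: "(\<lambda>n. umeas (f n)) \<longlonglongrightarrow> l" "\<And>n. l \<le> umeas (f n)"
    using decseq_convergent[OF dec, of 0] by (metis measure_nonneg)
  have tel: "(\<lambda>k. \<Lambda> * (umeas (f (k + n)) - umeas (f (Suc (k + n))))) sums (\<Lambda> * (umeas (f n) - l))" for n
  proof -
    have "(\<lambda>k. umeas (f (k + n))) \<longlonglongrightarrow> l" using l(1) by (rule LIMSEQ_ignore_initial_segment)
    from telescope_sums'[OF this] show ?thesis by (intro sums_mult) simp
  qed
  have df: "dist_col (f n) (f (Suc n)) \<le> \<Lambda> * (umeas (f n) - umeas (f (Suc n)))" for n
    using fr[of n] by (simp add: reach_def)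
  have sm: "summable (\<lambda>n. dist_col (f n) (f (Suc n)))"
    by (rule summable_comparison_test'[OF sums_summable[OF tel[of 0]], of 0]) (use df in simp)
  obtain c' where c': "measurable_coloring K c'"
    "\<And>n. dist_col (f n) c' \<le> (\<Sum>k. dist_col (f (k + n)) (f (Suc (k + n))))"
    by (rule coloring_limit[OF fm sm]) (rule that)
  have d': "dist_col (f n) c' \<le> \<Lambda> * (umeas (f n) - l)" for n
  proof -
    have "(\<Sum>k. dist_col (f (k + n)) (f (Suc (k + n)))) \<le> (\<Sum>k. \<Lambda> * (umeas (f (k + n)) - umeas (f (Suc (k + n)))))"
      using df summable_ignore_initial_segment[OF sm, of n] sums_summable[OF tel[of n]] by (intro suminf_le) auto
    then show ?thesis using c'(2)[of n] sums_unique[OF tel[of n]] by linarith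
  qed
  have "umeas c' \<le> l"
  proof (rule LIMSEQ_le_const)
    show "(\<lambda>n. umeas (f n) + \<Lambda> * (umeas (f n) - l)) \<longlonglongrightarrow> l"
      using tendsto_add[OF l(1) tendsto_mult[OF tendsto_const[of \<Lambda>] tendsto_diff[OF l(1) tendsto_const[of l]]]] by simp
    have "umeas c' \<le> umeas (f n) + \<Lambda> * (umeas (f n) - l)" for n
      using uncolored_dist[OF fm[of n] c'(1)] d'[of n] by linarith
    then show "\<exists>N. \<forall>n\<ge>N. umeas c' \<le> umeas (f n) + \<Lambda> * (umeas (f n) - l)" by blast
  qed
  then have reach': "c' \<in> reach (f n)" for n
  proof -
    have "\<Lambda> * (umeas (f n) - l) \<le> \<Lambda> * (umeas (f n) - umeas c')" using \<open>umeas c' \<le> l\<close> L by simp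
    then show ?thesis using d'[of n] c'(1) unfolding reach_def by simp
  qed
  show ?thesis
  proof (rule that[OF c'(1)])
    show "dist_col c c' \<le> \<Lambda> * (umeas c - umeas c')" using reach'[of 0] f0 by (simp add: reach_def)
    fix c'' assume "measurable_coloring K c''" "dist_col c' c'' \<le> \<Lambda> * (umeas c' - umeas c'')"
    then have "c'' \<in> reach c'" by (simp add: reach_def)
    then have r: "c'' \<in> reach (f n)" for n using reach_trans[OF fm reach'] by blast
    have "umeas (f (Suc n)) \<le> umeas c'' + 1 / Suc n" for n
    proof -
      have "I (f n) \<le> umeas c''" unfolding I_def using r bdd by (intro cInf_lower) auto
      then show ?thesis using fi[of n] by linarith
    qed
    moreover have "(\<lambda>n. umeas (f (Suc n))) \<longlonglongrightarrow> l" using l(1) by (rule LIMSEQ_Suc)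
    moreover have "(\<lambda>n. umeas c'' + 1 / Suc n) \<longlonglongrightarrow> umeas c''"
      using tendsto_add[OF tendsto_const[of "umeas c''"] LIMSEQ_inverse_real_of_nat] by (simp add: inverse_eq_divide)
    ultimately have "l \<le> umeas c''" by (intro LIMSEQ_le) auto
    then show "umeas c' \<le> umeas c''" using \<open>umeas c' \<le> l\<close> by linarith
  qed
qed

text \<open>Applied to the empty coloring with the price of \<open>improve_short\<close>. Detours
  are no option with \<open>d\<close> colors, as an inner vertex of a chain need not miss
  any.\<close>

lemma ex_few_uncolored:
  obtains c where "measurable_coloring d c" "umeas c \<le> 2 * (d * (d * (d * (1 / real (L + 2)))))"
proof -
  have "measurable_coloring d (\<lambda>_. 0)" by (simp add: measurable_coloring_def partial_coloring_def)
  then obtain c where c: "measurable_coloring d c" and opt: "\<And>c''. measurable_coloring d c'' \<Longrightarrow>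
       dist_col c c'' \<le> real (2 * L + 3) * (umeas c - umeas c'') \<Longrightarrow>
       umeas c \<le> umeas c''"
    using ex_unimprovable[of d "\<lambda>_. 0" "real (2 * L + 3)"] by (metis of_nat_0_less_iff zero_less_numeral add_pos_pos add_nonneg_pos le0)
  have "measure EM (short_edges c a b L) = 0" if ab: "a \<in> {1..d}" "b \<in> {1..d}" for a b
  proof (rule ccontr)
    assume "measure EM (short_edges c a b L) \<noteq> 0"
    then have "measure EM (short_edges c a b L) > 0" by (simp add: zero_less_measure_iff)
    then obtain c' where c': "measurable_coloring d c'" "umeas c' < umeas c"
      "dist_col c c' \<le> real (2 * L + 3) * (umeas c - umeas c')"
      using improve_short[OF c, of a b L] ab by auto
    show False using opt[OF c'(1,3)] c'(2) by simp
  qed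
  then have "umeas c \<le> 2 * (d * (d * (d * (1 / real (L + 2)))))"
    by (intro short_count[OF c deg_le]) auto
  then show ?thesis using c that by blast
qed

text \<open>The price \<open>12 * l + 17\<close> covers a short swap, \<open>4 * l + 5\<close>, and
  a detour, \<open>4 * i + 8 * l + 15\<close> with \<open>i \<le> l\<close>; it is at most
  \<open>29 * l\<close>. The fifth power collects two pairs of colors and the degree.\<close>

lemma ex_fewer_uncolored:
  assumes mc: "measurable_coloring (d + 1) c" and l: "1 \<le> l"
  obtains c' where "measurable_coloring (d + 1) c'"
    "dist_col c c' \<le> 29 * real l * umeas c"
    "umeas c' \<le> 2 * real (d + 1) ^ 5 / (real l)\<^sup>2"
proof -
  let ?K = "d + 1" and ?L = "2 * l + 1"
  let ?lam = "real (12 * l + 17)"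
  have lam: "0 < ?lam" by simp
  obtain c' where c': "measurable_coloring ?K c'" "dist_col c c' \<le> ?lam * (umeas c - umeas c')"
    and opt: "\<And>c''. measurable_coloring ?K c'' \<Longrightarrow> dist_col c' c'' \<le> ?lam * (umeas c' - umeas c'') \<Longrightarrow> umeas c' \<le> umeas c''"
    by (rule ex_unimprovable[OF mc lam]) (rule that)
  have no_improve: False if imp: "measurable_coloring ?K c''" "umeas c'' < umeas c'"
    "dist_col c' c'' \<le> real k * (umeas c' - umeas c'')" "k \<le> 12 * l + 17" for c'' k
  proof -
    have "real k * (umeas c' - umeas c'') \<le> ?lam * (umeas c' - umeas c'')"
      using imp(2,4) by (intro mult_right_mono) auto
    then have "dist_col c' c'' \<le> ?lam * (umeas c' - umeas c'')" using imp(3) by linarith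
    then show False using opt[OF imp(1)] imp(2) by simp
  qed
  have null1: "measure EM (short_edges c' a b ?L) = 0" if ab: "a \<in> {1..?K}" "b \<in> {1..?K}" for a b
  proof (rule ccontr)
    assume "measure EM (short_edges c' a b ?L) \<noteq> 0"
    then have pos: "measure EM (short_edges c' a b ?L) > 0" by (simp add: zero_less_measure_iff)
    have "a \<noteq> 0" "a \<le> ?K" "b \<noteq> 0" "b \<le> ?K" using ab by auto
    from improve_short[OF c'(1) this pos] show False
      using no_improve[of _ "2 * ?L + 3"] by auto
  qed
  have null2: "measure EM (detour_edges c' a b (2 * i) g h ?L) = 0"
    if ab: "a \<in> {1..?K}" "b \<in> {1..?K}" "i \<in> {1..l}" "g \<in> {1..?K} - {a, b}" "h \<in> {1..?K} - {a, b}" for a b i g h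
  proof (rule ccontr)
    assume "measure EM (detour_edges c' a b (2 * i) g h ?L) \<noteq> 0"
    then have pos: "measure EM (detour_edges c' a b (2 * i) g h ?L) > 0" by (simp add: zero_less_measure_iff)
    have *: "a \<noteq> 0" "a \<le> ?K" "b \<noteq> 0" "b \<le> ?K" "g \<noteq> 0" "g \<le> ?K" "g \<notin> {a, b}"
      "h \<noteq> 0" "h \<le> ?K" "h \<notin> {a, b}" "even (2 * i)" using ab by auto
    from improve_detour[OF c'(1) * pos] show False
      using no_improve[of _ "2 * (2 * i) + 4 * ?L + 11"] ab(3) by auto
  qed
  have "card (E `` {x}) < ?K" for x using deg_le[of x] by simp
  from detour_count[OF c'(1) this l null1 null2]
  have "umeas c' \<le> 2 * (real ?K * (real ?K * (d * (real ?K * real ?K / (real l)\<^sup>2))))" by simp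
  also have "\<dots> \<le> 2 * (real ?K * (real ?K * (real ?K * (real ?K * real ?K / (real l)\<^sup>2))))"
    by (intro mult_left_mono mult_right_mono) auto
  also have "\<dots> = 2 * real ?K ^ 5 / (real l)\<^sup>2" by (simp add: eval_nat_numeral)
  finally have "umeas c' \<le> 2 * real ?K ^ 5 / (real l)\<^sup>2" .
  moreover have "dist_col c c' \<le> 29 * real l * umeas c"
  proof -
    have "?lam * (umeas c - umeas c') \<le> ?lam * umeas c" by (intro mult_left_mono) auto
    also have "\<dots> \<le> 29 * real l * umeas c" using l by (intro mult_right_mono) auto
    finally show ?thesis using c'(2) by linarith
  qed
  ultimately show ?thesis using c'(1) that by blast
qed

text \<open>At scale \<open>l n\<close> the uncolored measure is at most
  \<open>4 * B / (real (l n))\<^sup>2\<close>, so the next step costs at most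
  \<open>29 * l n\<close> times this, that is \<open>116 * B / l n\<close>. Doubling the scale makes
  this a geometric series with sum \<open>232 * B / l0\<close>, which the choice of
  \<open>l0\<close> puts below \<open>\<epsilon>\<close>.\<close>

lemma ex_almost_full_coloring:
  assumes eps: "0 < \<epsilon>"
  obtains c where "measurable_coloring (d + 1) c" "umeas c = 0"
    "measure EM {e. c e = d + 1} \<le> \<epsilon>"
proof -
  define B where "B = 2 * real (d + 1) ^ 5"
  have B: "B > 0" by (simp add: B_def)
  obtain l0 where l0: "232 * B / \<epsilon> < real l0" using reals_Archimedean2 by blast
  have l0_pos: "0 < real l0" using l0 B eps by (meson divide_pos_pos less_trans mult_pos_pos zero_less_numeral)
  define l where "l n = 2 ^ n * l0" for n :: nat
  have l1: "1 \<le> l n" for n using l0_pos by (simp add: l_def Suc_le_eq)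
  \<comment> \<open>Chains of length \<open>l0\<^sup>2\<close> bring the weaker bound for
    \<open>d\<close> colors down to the order required at scale \<open>l0\<close>; the cost of
    reaching \<open>c0\<close> does not count, since distances are measured from it.\<close>
  obtain c0 where c0: "measurable_coloring d c0" "umeas c0 \<le> 2 * (d * (d * (d * (1 / real (l0\<^sup>2 + 2)))))"
    by (rule ex_few_uncolored) (rule that)
  have u0: "umeas c0 \<le> 4 * B / (real (l 0))\<^sup>2"
  proof -
    have "umeas c0 \<le> 2 * real d ^ 3 * (1 / real (l0\<^sup>2 + 2))" using c0(2) by (simp add: power3_eq_cube mult.assoc)
    also have "\<dots> \<le> (4 * B) * (1 / (real l0)\<^sup>2)"
    proof (rule mult_mono)
      have "real d ^ 3 \<le> real (d + 1) ^ 3" by (intro power_mono) auto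
      also have "\<dots> \<le> real (d + 1) ^ 5" by (intro power_increasing) auto
      finally have "real d ^ 3 \<le> real (d + 1) ^ 5" .
      moreover have "0 \<le> real (d + 1) ^ 5" by simp
      ultimately show "2 * real d ^ 3 \<le> 4 * B" unfolding B_def by linarith
      show "1 / real (l0\<^sup>2 + 2) \<le> 1 / (real l0)\<^sup>2"
        using l0_pos by (intro divide_left_mono) (auto intro!: mult_pos_pos add_pos_nonneg)
    qed (use B in auto)
    finally show ?thesis by (simp add: l_def)
  qed
  have mc0: "measurable_coloring (d + 1) c0"
  proof -
    note pc0 = measurable_coloringD(1)[OF c0(1)]
    have "partial_coloring E (d + 1) c0"
      unfolding partial_coloring_def
    proof (rule conjI)
      show "\<forall>e. c0 e \<le> d + 1" using color_le[OF pc0] by (simp add: le_SucI)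
    qed (rule pc0[unfolded partial_coloring_def, THEN conjunct2])
    then show ?thesis using measurable_coloringD(2)[OF c0(1)] unfolding measurable_coloring_def by blast
  qed
  have "\<exists>f. \<forall>n. (measurable_coloring (d + 1) (f n) \<and> (n = 0 \<longrightarrow> f n = c0) \<and> umeas (f n) \<le> 4 * B / (real (l n))\<^sup>2) \<and>
      dist_col (f n) (f (Suc n)) \<le> 29 * real (l n) * umeas (f n)"
  proof (rule dependent_nat_choice)
    show "\<exists>x. measurable_coloring (d + 1) x \<and> (0 = (0::nat) \<longrightarrow> x = c0) \<and> umeas x \<le> 4 * B / (real (l 0))\<^sup>2"
      using mc0 u0 by blast
  next
    fix x n assume x: "measurable_coloring (d + 1) x \<and> (n = 0 \<longrightarrow> x = c0) \<and> umeas x \<le> 4 * B / (real (l n))\<^sup>2"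
    obtain y where y: "measurable_coloring (d + 1) y" "dist_col x y \<le> 29 * real (l n) * umeas x"
      "umeas y \<le> 2 * real (d + 1) ^ 5 / (real (l n))\<^sup>2"
      by (rule ex_fewer_uncolored[OF _ l1[of n], of x]) (use x in blast, rule that)
    \<comment> \<open>The factor 4 of the invariant comes from expressing the bound at the old scale
      by the doubled one.\<close>
    have "2 * real (d + 1) ^ 5 / (real (l n))\<^sup>2 = 4 * B / (real (l (Suc n)))\<^sup>2"
      by (simp add: B_def l_def power_mult_distrib)
    then show "\<exists>y. (measurable_coloring (d + 1) y \<and> (Suc n = 0 \<longrightarrow> y = c0) \<and> umeas y \<le> 4 * B / (real (l (Suc n)))\<^sup>2) \<and>
        dist_col x y \<le> 29 * real (l n) * umeas x"
      using y by auto
  qed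
  then obtain f where f: "\<forall>n. (measurable_coloring (d + 1) (f n) \<and> (n = 0 \<longrightarrow> f n = c0) \<and> umeas (f n) \<le> 4 * B / (real (l n))\<^sup>2) \<and>
      dist_col (f n) (f (Suc n)) \<le> 29 * real (l n) * umeas (f n)" ..
  have fm: "measurable_coloring (d + 1) (f n)" and f0: "f 0 = c0" and fu: "umeas (f n) \<le> 4 * B / (real (l n))\<^sup>2"
    and fd: "dist_col (f n) (f (Suc n)) \<le> 29 * real (l n) * umeas (f n)" for n
    using f by blast+
  have lpos: "0 < real (l n)" for n using l1[of n] by simp
  have fd': "dist_col (f n) (f (Suc n)) \<le> 116 * B / l0 * (1 / 2) ^ n" for n
  proof -
    have "29 * real (l n) * umeas (f n) \<le> 29 * real (l n) * (4 * B / (real (l n))\<^sup>2)"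
      using fu by (intro mult_left_mono) auto
    also have "\<dots> = 116 * B / real (l n)" using lpos[of n] by (simp add: power2_eq_square)
    also have "\<dots> = 116 * B / l0 * (1 / 2) ^ n" by (simp add: l_def power_one_over field_simps)
    finally show ?thesis using fd[of n] by linarith
  qed
  have geo: "(\<lambda>k. 116 * B / l0 * (1 / 2) ^ (k + n)) sums (116 * B / l0 * ((1 / 2) ^ n * 2))" for n
  proof -
    have "(\<lambda>k. (1 / 2 :: real) ^ k) sums 2" using geometric_sums[of "1 / 2 :: real"] by simp
    then have "(\<lambda>k. 116 * B / l0 * ((1 / 2) ^ n * (1 / 2) ^ k)) sums (116 * B / l0 * ((1 / 2) ^ n * 2))"
      by (intro sums_mult)
    then show ?thesis by (simp add: power_add mult.commute)
  qed
  have sm: "summable (\<lambda>n. dist_col (f n) (f (Suc n)))"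
    by (rule summable_comparison_test'[OF sums_summable[OF geo[of 0]], of 0]) (use fd' in simp)
  obtain c where c: "measurable_coloring (d + 1) c"
    "\<And>n. dist_col (f n) c \<le> (\<Sum>k. dist_col (f (k + n)) (f (Suc (k + n))))"
    by (rule coloring_limit[OF fm sm]) (rule that)
  have dc: "dist_col (f n) c \<le> 232 * B / l0 * (1 / 2) ^ n" for n
  proof -
    have "(\<Sum>k. dist_col (f (k + n)) (f (Suc (k + n)))) \<le> (\<Sum>k. 116 * B / l0 * (1 / 2) ^ (k + n))"
      using fd' summable_ignore_initial_segment[OF sm, of n] sums_summable[OF geo[of n]] by (intro suminf_le) auto
    also have "\<dots> = 116 * B / l0 * ((1 / 2) ^ n * 2)" using sums_unique[OF geo[of n]] by simp
    finally show ?thesis using c(2)[of n] by simp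
  qed
  have "umeas c \<le> 0"
  proof (rule LIMSEQ_le_const)
    show "(\<lambda>n. (4 * B + 232 * B / l0) * (1 / 2) ^ n) \<longlonglongrightarrow> 0"
      by (intro tendsto_mult_right_zero LIMSEQ_power_zero) simp
    have "umeas c \<le> (4 * B + 232 * B / l0) * (1 / 2) ^ n" for n
    proof -
      have "2 ^ n \<le> real (l n)" using l0_pos by (simp add: l_def Suc_le_eq)
      also have "\<dots> \<le> (real (l n))\<^sup>2"
        using l1[of n] self_le_power[of "real (l n)" 2] by simp
      finally have "4 * B / (real (l n))\<^sup>2 \<le> 4 * B / 2 ^ n" using B lpos[of n] by (intro divide_left_mono) auto
      also have "\<dots> = 4 * B * (1 / 2) ^ n" by (simp add: power_one_over)
      finally have "umeas (f n) \<le> 4 * B * (1 / 2) ^ n" using fu[of n] by linarith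
      then show ?thesis
        using uncolored_dist[OF fm[of n] c(1)] dc[of n] by (simp add: distrib_right)
    qed
    then show "\<exists>N. \<forall>n\<ge>N. umeas c \<le> (4 * B + 232 * B / l0) * (1 / 2) ^ n" by blast
  qed
  then have "umeas c = 0" by (simp add: order_antisym)
  moreover have "measure EM {e. c e = d + 1} \<le> \<epsilon>"
  proof -
    \<comment> \<open>\<open>c0\<close> avoids color \<open>d + 1\<close>, so its limiting color
      class lies in the set of changed edges.\<close>
    have "c0 e \<le> d" for e by (rule color_le[OF measurable_coloringD(1)[OF c0(1)]])
    then have "c0 e \<noteq> d + 1" for e by (metis Suc_eq_plus1 not_less_eq_eq order_refl)
    then have "{e. c e = d + 1} \<subseteq> {e. c0 e \<noteq> c e}" by force
    then have "measure EM {e. c e = d + 1} \<le> dist_col c0 c"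
      unfolding dist_col_def
      by (rule EM.finite_measure_mono) (unfold sets_EM, rule color_diff_sets[OF mc0 c(1)])
    also have "\<dots> \<le> 232 * B / l0" using dc[of 0] f0 by simp
    also have "\<dots> \<le> \<epsilon>" using l0 l0_pos eps by (simp add: field_simps)
    finally show ?thesis .
  qed
  ultimately show ?thesis using c(1) that by blast
qed

section \<open>From an almost everywhere defined coloring to a total one\<close>

lemma Domain_null_sets:
  assumes C: "C \<in> sets P" "C \<subseteq> E" and 0: "emeasure EM C = 0"
  shows "Domain C \<in> null_sets \<nu>"
proof -
  have ae: "AE x in \<nu>. section_count C x = 0"
    using 0 emeasure_EM[OF C(1)] section_count_measurable[OF C(1)] by (simp add: nn_integral_0_iff_AE)
  have "x \<notin> Domain C" if "section_count C x = 0" for x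
  proof
    assume "x \<in> Domain C"
    then have "C `` {x} \<noteq> {}" by blast
    moreover have "finite (C `` {x})" by (rule finite_subset[OF Image_mono[OF C(2) order_refl] fin_deg])
    ultimately show False using that C(2) by (simp add: section_count_eq)
  qed
  then have "AE x in \<nu>. x \<notin> Domain C" using ae by (auto elim: eventually_mono)
  then show ?thesis using AE_iff_null_sets[OF Domain_sets[OF C]] by blast
qed

lemma measurable_coloring_measurable:
  assumes mc: "measurable_coloring K c"
  shows "c \<in> P \<rightarrow>\<^sub>M count_space UNIV"
proof -
  have "c -` {a} \<inter> space P \<in> sets P" for a
  proof (cases "a = 0")
    case True
    have "c e \<noteq> 0 \<longleftrightarrow> (\<exists>i. c e = Suc i)" for e by (metis not0_implies_Suc nat.distinct(1))
    then have "c -` {a} \<inter> space P = space P - (\<Union>i. {e. c e = Suc i})" using True by blast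
    also have "\<dots> \<in> sets P"
      using measurable_coloringD(2)[OF mc] by (intro sets.Diff sets.countable_nat_UN) auto
    finally show ?thesis .
  next
    case False
    have "c -` {a} \<inter> space P = {e. c e = a}"
      using sets.sets_into_space[OF measurable_coloringD(2)[OF mc False]] by blast
    then show ?thesis using measurable_coloringD(2)[OF mc False] by simp
  qed
  then show ?thesis by (simp add: measurable_count_space_eq_countable)
qed

end

theorem theorem3:
  fixes \<nu> :: "'a measure" and X\<^sub>1 X\<^sub>2 :: "'a set" and E :: "('a \<times> 'a) set"
    and d :: nat and \<epsilon> :: real
  assumes "d \<ge> 1"
    and "bipartite_graphing \<nu> X\<^sub>1 X\<^sub>2 E"
    and "regular_graph d (space \<nu>) E"
    and "\<epsilon> > 0"
  shows "\<exists>c :: 'a \<times> 'a \<Rightarrow> nat.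
           proper_edge_coloring E {1..d + 1} c \<and>
           measurable_edge_coloring \<nu> E c \<and>
           edge_measure \<nu> {e \<in> E. c e = d + 1} \<le> ennreal \<epsilon>"
proof -
  interpret bipartite_graphing \<nu> X\<^sub>1 X\<^sub>2 E by fact
  have reg: "finite (E `` {x})" "card (E `` {x}) \<le> d" for x
  proof -
    show "finite (E `` {x})" by (rule finite_section)
    show "card (E `` {x}) \<le> d"
    proof (cases "x \<in> space \<nu>")
      case False
      then have "E `` {x} = {}" using edges_subset by blast
      then show ?thesis by simp
    qed (use assms(3) in \<open>simp add: regular_graph_def\<close>)
  qed
  have side: "x \<in> X\<^sub>2 \<longleftrightarrow> y \<notin> X\<^sub>2" if "(x, y) \<in> E" for x y
    using that edges_between parts_disjoint by blast
  obtain N and G :: "nat \<Rightarrow> ('a \<times> 'a) set" where N: "N \<in> null_sets \<nu>" "E `` N \<subseteq> N"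
    and G: "\<And>n. G n \<in> sets (\<nu> \<Otimes>\<^sub>M \<nu>)" "\<And>n. single_valued (G n)"
      "(\<Union>n. G n) = E \<inter> (space \<nu> - N) \<times> space \<nu>"
    and dom: "\<And>C. C \<in> sets (\<nu> \<Otimes>\<^sub>M \<nu>) \<Longrightarrow> C \<subseteq> E \<inter> (space \<nu> - N) \<times> space \<nu> \<Longrightarrow> Domain C \<in> sets \<nu>"
    by (rule lusin_novikov_mod_null) (rule that)
  \<comment> \<open>As \<open>N\<close> is invariant, restricting the first end restricts both, and
    \<open>E'\<close> remains symmetric.\<close>
  define E' where "E' = E \<inter> (space \<nu> - N) \<times> space \<nu>"
  have flip: "(y, x) \<in> E" if "(x, y) \<in> E" for x y using that edges_sym by (simp add: symD)
  have E'_iff: "(x, y) \<in> E' \<longleftrightarrow> (x, y) \<in> E \<and> x \<notin> N \<and> y \<notin> N" for x y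
  proof -
    have "y \<in> N \<Longrightarrow> (x, y) \<in> E \<Longrightarrow> x \<in> N" using N(2) flip by blast
    then show ?thesis using edges_subset unfolding E'_def by blast
  qed
  have E'_E: "E' \<subseteq> E" unfolding E'_def by blast
  interpret bg: borel_graph \<nu> E' X\<^sub>2 d G
  proof
    show "sym E'" using flip E'_iff by (simp add: sym_def)
    show "x \<in> X\<^sub>2 \<longleftrightarrow> y \<notin> X\<^sub>2" if "(x, y) \<in> E'" for x y using that side E'_E by blast
    show "X\<^sub>2 \<in> sets \<nu>" by (rule parts_measurable(2))
    show "finite (E' `` {x})" for x by (rule finite_subset[OF Image_mono[OF E'_E order_refl] reg(1)])
    show "card (E' `` {x}) \<le> d" for x
      using card_mono[OF reg(1)[of x] Image_mono[OF E'_E order_refl]] reg(2)[of x] by linarith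
    show "G n \<in> sets (\<nu> \<Otimes>\<^sub>M \<nu>)" "single_valued (G n)" for n by (rule G)+
    show "(\<Union>n. G n) = E'" unfolding E'_def by (rule G(3))
    show "Domain C \<in> sets \<nu>" if "C \<in> sets (\<nu> \<Otimes>\<^sub>M \<nu>)" "C \<subseteq> E'" for C
      using dom that unfolding E'_def by blast
    fix A B assume AB: "A \<in> sets \<nu>" "B \<in> sets \<nu>"
    have deg': "deg E' x B = (if x \<in> N then 0 else deg E x (B - N))" for x B
    proof (cases "x \<in> N")
      case True
      then have "E' `` {x} = {}" using E'_iff by blast
      then show ?thesis using True by (simp add: deg_def)
    next
      case False
      then have "E' `` {x} \<inter> B = E `` {x} \<inter> (B - N)" using E'_iff by blast
      then show ?thesis using False by (simp add: deg_def)
    qed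
    have "(\<integral>\<^sup>+x\<in>A. of_nat (deg E' x B) \<partial>\<nu>) = (\<integral>\<^sup>+x\<in>A - N. of_nat (deg E x (B - N)) \<partial>\<nu>)" for A B
      by (rule nn_integral_cong) (simp add: deg' indicator_def)
    then show "(\<integral>\<^sup>+x\<in>A. of_nat (deg E' x B) \<partial>\<nu>) = (\<integral>\<^sup>+x\<in>B. of_nat (deg E' x A) \<partial>\<nu>)"
      using measure_preserving[of "A - N" "B - N"] AB N(1) by auto
  qed
  \<comment> \<open>\<open>EM\<close> counts ordered pairs, hence the factor 2.\<close>
  have half_eps: "2 * \<epsilon> > 0" using assms(4) by simp
  obtain c0 where c0: "bg.measurable_coloring (d + 1) c0" "measure bg.EM (bg.uncolored c0) = 0"
    "measure bg.EM {e. c0 e = d + 1} \<le> 2 * \<epsilon>"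
    by (rule bg.ex_almost_full_coloring[OF half_eps]) (rule that)
  note pc0 = bg.measurable_coloringD(1)[OF c0(1)]
  \<comment> \<open>All vertices at which \<open>c0\<close> may leave an edge uncolored. The
    invariant null set \<open>N2\<close> around them consists of whole components, which can be
    colored anew.\<close>
  define N1 where "N1 = N \<union> Domain (bg.uncolored c0)"
  have us: "bg.uncolored c0 \<in> sets (\<nu> \<Otimes>\<^sub>M \<nu>)" by (rule bg.uncolored_in_sets[OF c0(1)])
  have "emeasure bg.EM (bg.uncolored c0) = 0" using c0(2) by (simp add: bg.EM.emeasure_eq_measure)
  then have "Domain (bg.uncolored c0) \<in> null_sets \<nu>"
    by (rule bg.Domain_null_sets[OF us bg.uncolored_subset])
  then have "N1 \<in> null_sets \<nu>" using N(1) unfolding N1_def by (intro null_sets.Un)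
  from null_saturation[OF this]
  obtain N2 where N2: "N2 \<in> null_sets \<nu>" "N1 \<subseteq> N2" "E `` N2 \<subseteq> N2" by blast
  have "N \<subseteq> N2" using N2(2) unfolding N1_def by blast
  have inv: "x \<in> N2 \<longleftrightarrow> y \<in> N2" if "(x, y) \<in> E" for x y
    using that flip[OF that] N2(3) by blast
  have "sided_graph E X\<^sub>2" using edges_sym side by unfold_locales auto
  then obtain f where f: "proper_edge_coloring E {1..d} f"
    using konig_edge_coloring[OF _ reg] by blast
  \<comment> \<open>No edge leaves \<open>N2\<close>, so no vertex sees both colorings and they need
    not be compatible.\<close>
  define c where "c e = (if fst e \<in> N2 then f e else c0 e)" for e
  have good: "c0 (x, y) \<noteq> 0" if "(x, y) \<in> E" "x \<notin> N2" for x y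
  proof -
    have "y \<notin> N2" using inv[OF that(1)] that(2) by blast
    then have "(x, y) \<in> E'" using that \<open>N \<subseteq> N2\<close> E'_iff by blast
    moreover have "(x, y) \<notin> bg.uncolored c0" using that(2) N2(2) unfolding N1_def by blast
    ultimately show ?thesis by (simp add: bg.uncolored_def)
  qed
  have c0_le: "c0 e \<le> d + 1" for e by (rule bg.color_le[OF pc0])
  \<comment> \<open>The edges colored by \<open>f\<close>, about whose measurability nothing is
    known; they form the discarded null set.\<close>
  define Z where "Z = E \<inter> N2 \<times> space \<nu>"
  have Z_iff: "(x, y) \<in> Z \<longleftrightarrow> (x, y) \<in> E \<and> x \<in> N2" for x y
    using edges_subset unfolding Z_def by blast
  have ae: "AE x in \<nu>. x \<notin> N2" by (rule AE_not_in[OF N2(1)])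
  show ?thesis
  proof (intro exI[of _ c] conjI)
    show "proper_edge_coloring E {1..d + 1} c"
      unfolding proper_edge_coloring_def
    proof (intro conjI allI impI funcsetI)
      fix e assume "e \<in> E"
      then obtain x y where e: "e = (x, y)" "(x, y) \<in> E" by (cases e) auto
      show "c e \<in> {1..d + 1}"
      proof (cases "x \<in> N2")
        case True
        have "f (x, y) \<in> {1..d}" using f e(2) unfolding proper_edge_coloring_def by blast
        then show ?thesis using True e(1) by (simp add: c_def)
      next
        case False
        then show ?thesis using good[OF e(2) False] c0_le[of "(x, y)"] e(1) by (simp add: c_def)
      qed
    next
      fix x y assume xy: "(x, y) \<in> E"
      have "f (x, y) = f (y, x)" using f xy unfolding proper_edge_coloring_def by blast
      moreover have "c0 (x, y) = c0 (y, x)" by (rule bg.color_sym[OF pc0])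
      ultimately show "c (x, y) = c (y, x)" using inv[OF xy] unfolding c_def fst_conv by presburger
    next
      fix x y z assume xyz: "(x, y) \<in> E" "(x, z) \<in> E" "y \<noteq> z"
      show "c (x, y) \<noteq> c (x, z)"
      proof (cases "x \<in> N2")
        case True
        have "f (x, y) \<noteq> f (x, z)" using f xyz unfolding proper_edge_coloring_def by blast
        then show ?thesis using True by (simp add: c_def)
      next
        case False
        have "c0 (x, y) \<noteq> c0 (x, z)"
          using bg.color_unique[OF pc0, of x y z] good[OF xyz(1) False] xyz(3) by blast
        then show ?thesis using False by (simp add: c_def)
      qed
    qed
    show "measurable_edge_coloring \<nu> E c"
      unfolding measurable_edge_coloring_def
    proof (intro bexI[of _ Z] conjI)
      show "Z \<in> sets (\<nu> \<Otimes>\<^sub>M \<nu>)" unfolding Z_def using edges_borel N2(1) by auto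
      show "Z \<subseteq> E" unfolding Z_def by blast
      show "sym Z" unfolding sym_def Z_iff using inv flip by blast
      have "deg Z x UNIV = 0" if "x \<notin> N2" for x
      proof -
        have "Z `` {x} = {}" using that Z_iff by blast
        then show ?thesis by (simp add: deg_def)
      qed
      then have "(\<integral>\<^sup>+x. of_nat (deg Z x UNIV) \<partial>\<nu>) = (\<integral>\<^sup>+x. 0 \<partial>\<nu>)"
        by (intro nn_integral_cong_AE eventually_mono[OF ae]) simp
      then show "edge_measure \<nu> Z = 0" by (simp add: edge_measure_def)
      have eq: "c e = c0 e" if "e \<in> space (restrict_space (\<nu> \<Otimes>\<^sub>M \<nu>) (E - Z))" for e
      proof -
        have "e \<in> E - Z" using that by (simp add: space_restrict_space)
        then have "fst e \<notin> N2" using Z_iff by (cases e) auto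
        then show ?thesis by (simp add: c_def)
      qed
      show "c \<in> restrict_space (\<nu> \<Otimes>\<^sub>M \<nu>) (E - Z) \<rightarrow>\<^sub>M count_space UNIV"
        by (rule iffD2[OF measurable_cong[OF eq]], assumption)
          (rule measurable_restrict_space1[OF bg.measurable_coloring_measurable[OF c0(1)]])
    qed
    let ?C = "{e. c0 e = d + 1}"
    have C: "?C \<in> sets (\<nu> \<Otimes>\<^sub>M \<nu>)" "?C \<subseteq> E'"
      using bg.color_class_sets[OF c0(1), of "d + 1"] bg.color_class_subset[OF c0(1), of "d + 1"] by simp_all
    have "deg {e \<in> E. c e = d + 1} x UNIV = deg ?C x UNIV" if "x \<notin> N2" for x
    proof -
      have "{e \<in> E. c e = d + 1} `` {x} = ?C `` {x}" using that C(2) E'_E by (auto simp: c_def)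
      then show ?thesis by (simp add: deg_def)
    qed
    then have "(\<integral>\<^sup>+x. of_nat (deg {e \<in> E. c e = d + 1} x UNIV) \<partial>\<nu>) = (\<integral>\<^sup>+x. of_nat (deg ?C x UNIV) \<partial>\<nu>)"
      by (intro nn_integral_cong_AE eventually_mono[OF ae]) simp
    also have "\<dots> = emeasure bg.EM ?C" by (rule bg.emeasure_EM_edges[OF C, symmetric])
    also have "\<dots> \<le> ennreal (2 * \<epsilon>)"
      using c0(3) assms(4) by (simp add: bg.EM.emeasure_eq_measure ennreal_leI)
    finally have "edge_measure \<nu> {e \<in> E. c e = d + 1} \<le> ennreal (2 * \<epsilon>) / 2"
      unfolding edge_measure_def by (rule divide_right_mono_ennreal)
    also have "\<dots> = ennreal \<epsilon>" using assms(4) by (simp add: ennreal_divide_numeral)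
    finally show "edge_measure \<nu> {e \<in> E. c e = d + 1} \<le> ennreal \<epsilon>" .
  qed
qed

end
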